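(* Let $T>0$, $\sigma\in\mathbb{R}$, and let $a,\kappa,\xi,\mathcal{H}$ and the sequence $\zeta^1,\zeta^2,\dots\in[0,1]^{\infty}$ satisfy assumptions A1)–A4) of the context. Let $W$ be a Wiener process (independent of $\xi$) and let $Z$ be the strong solution of the McKean–Vlasov equation with additive noise $$Z(t)=\xi+\int_0^t a\Big(Z(s),\int_{\mathbb{R}}\kappa(Z(s),z)\,\mathcal{L}(Z(s))(dz)\Big)ds+\sigma W(t),\qquad t\in[0,T],$$ where $\mathcal{L}(\cdot)$ denotes the law of a random variable. For a dissection $D$ of $[0,T]$ into $N=2^d$ equal steps and $P\in\mathbb{N}$, let $X_i^E(T)$, $1\le i\le P$, be the terminal values of the Euler–Maruyama particle scheme driven by the coupled low-discrepancy input described in the context. Let $g:\mathbb{R}\to\mathbb{R}$ be bounded and globally Lipschitz continuous. Then for every $\varepsilon>0$ there exists $\delta>0$ such that for every such dissection $D$ with $|D|<\delta$ there exists $\tilde P=\tilde P(\varepsilon,D)\in\mathbb{N}$ such that for all $P\ge\tilde P$ $$\left|\mathbb{E}\left[g(Z(T))-\frac1P\sum_{i=1}^P g(X_i^E(T))\right]\right|\le\varepsilon .$$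
   Context: Assumptions: A1) $a:\mathbb{R}\times\mathbb{R}\to\mathbb{R}$ is bounded and once continuously differentiable with bounded first derivatives. A2) $\xi$ is a real random variable for which there is a continuous map $\mathcal{H}:[0,1]\to\mathbb{R}$ with $\lambda\circ\mathcal{H}^{-1}=\mathcal{L}(\xi)$, $\lambda$ being Lebesgue measure on $[0,1]$. A3) $\kappa:\mathbb{R}\times\mathbb{R}\to\mathbb{R}$ is bounded with continuous and bounded first-order partial derivatives. A4) $\zeta^1,\zeta^2,\dots$ is a sequence in $[0,1]^\infty$ such that for any finite $I\subset\mathbb{N}$ and any Riemann integrable $h:[0,1]^{\#I}\to\mathbb{R}$, the projections $\pi_I(\zeta^j)=(\zeta^j_i)_{i\in I}$ satisfy $\frac1P\sum_{j=1}^P h(\pi_I(\zeta^j))\to\int_{[0,1]^{\#I}}h\,dx$ as $P\to\infty$. Notation: $\{x\}$ is the fractional part of $x$ (componentwise for vectors); $\phi$ is the standard Gaussian distribution function; $|D|$ is the maximal step size of a dissection $D$; $v_{k:n}$ is the vector of components $k,\dots,n$ of $v$. Brownian bridge construction: for $n=2^d$, $\zeta,u\in[0,1]^n$, the piecewise linear path $T^{(n)}(\zeta,u)=w$ on $[0,T]$ is defined as follows. Set $w(0)=0$, $w(T)=\sqrt{T}\,\phi^{-1}(\{\zeta_1+u_1\})$, $k=1$. Given that $w$ is defined at the $k+1$ times $0=t^{(0)}<\dots<t^{(k)}=T$, for each $1\le i\le k$ set, at the midpoint $m_i=\frac{t^{(i-1)}+t^{(i)}}{2}$, $$w(m_i)=\tfrac12\big(w(t^{(i-1)})+w(t^{(i)})\big)+\tfrac12\sqrt{t^{(i)}-t^{(i-1)}}\;\phi^{-1}(\{\zeta_{k+i}+u_{k+i}\}).$$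 Replace $k$ by $2k$ and repeat until $k=n$. Finally interpolate linearly between the $n+1$ uniformly spaced nodes $jT/n$. Coupled input and scheme: let $D=\{0=t_0<\dots<t_N=T\}$ be uniform with $N=2^d$, and let $U$ be uniformly distributed on $[0,1]^{N+1}$ (one shift common to all particles). For $1\le p\le P$ set $\xi_p^C=\mathcal{H}(\{\zeta^p_1+U_1\})$ and $W_p^{(N)}=T^{(N)}(\zeta^p_{2:N+1},U_{2:N+1})$. The Euler–Maruyama scheme is $X_p^E(t_0)=\xi_p^C$ and, for $0\le n<N$, $$X_p^E(t_{n+1})=X_p^E(t_n)+a\Big(X_p^E(t_n),\frac1P\sum_{j=1}^P\kappa(X_p^E(t_n),X_j^E(t_n))\Big)(t_{n+1}-t_n)+\sigma\big(W_p^{(N)}(t_{n+1})-W_p^{(N)}(t_n)\big).$$ *)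

theory Defs
  imports "HOL-Probability.Probability"
begin

definition C1_bounded :: "(real \<times> real \<Rightarrow> real) \<Rightarrow> bool" where
  "C1_bounded f \<longleftrightarrow> bounded (range f) \<and>
     (\<exists>f' :: real \<times> real \<Rightarrow> (real \<times> real) \<Rightarrow>\<^sub>L real.
        (\<forall>p. (f has_derivative blinfun_apply (f' p)) (at p)) \<and>
        continuous_on UNIV f' \<and> bounded (range f'))"

definition bounded_with_C0_bounded_partials :: "(real \<times> real \<Rightarrow> real) \<Rightarrow> bool" where
  "bounded_with_C0_bounded_partials f \<longleftrightarrow> bounded (range f) \<and>
     (\<exists>f\<^sub>1 f\<^sub>2 :: real \<times> real \<Rightarrow> real.
        (\<forall>x y. ((\<lambda>x'. f (x', y)) has_real_derivative f\<^sub>1 (x, y)) (at x)) \<and>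
        (\<forall>x y. ((\<lambda>y'. f (x, y')) has_real_derivative f\<^sub>2 (x, y)) (at y)) \<and>
        continuous_on UNIV f\<^sub>1 \<and> continuous_on UNIV f\<^sub>2 \<and>
        bounded (range f\<^sub>1) \<and> bounded (range f\<^sub>2))"

text \<open>
  The proper Riemann integral over the cube with coordinates indexed by the finite set \<open>I\<close>,
  as the limit of Riemann sums over tagged product grids when the mesh tends to 0: coordinate
  \<open>i\<close> is dissected by \<open>0 = s i 0 < \<dots> < s i (m i) = 1\<close>, the multi-index \<open>c\<close> selects a cell,
  and \<open>\<tau> c\<close> is the tag in that cell.  Points of the cube are functions in
  \<open>PiE I (\<lambda>_. {0..1})\<close>; the values of \<open>h\<close> elsewhere are irrelevant.
  The gauge integral of the library is not used, because it admits more functions and because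
  the dimension would have to be a type.
\<close>

definition has_riemann_integral_cube ::
    "nat set \<Rightarrow> ((nat \<Rightarrow> real) \<Rightarrow> real) \<Rightarrow> real \<Rightarrow> bool" where
  "has_riemann_integral_cube I h J \<longleftrightarrow>
     (\<forall>\<epsilon>>0. \<exists>\<delta>>0. \<forall>(m :: nat \<Rightarrow> nat) (s :: nat \<Rightarrow> nat \<Rightarrow> real) (\<tau> :: (nat \<Rightarrow> nat) \<Rightarrow> nat \<Rightarrow> real).
        (\<forall>i\<in>I. s i 0 = 0 \<and> s i (m i) = 1 \<and>
           (\<forall>k<m i. s i k < s i (Suc k) \<and> s i (Suc k) - s i k < \<delta>)) \<and>
        (\<forall>c\<in>PiE I (\<lambda>i. {..<m i}). \<tau> c \<in> PiE I (\<lambda>i. {s i (c i)..s i (Suc (c i))})) \<longrightarrow>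
        \<bar>(\<Sum>c\<in>PiE I (\<lambda>i. {..<m i}). h (\<tau> c) * (\<Prod>i\<in>I. s i (Suc (c i)) - s i (c i))) - J\<bar> < \<epsilon>)"

text \<open>
  \<open>\<zeta> j i\<close> is the \<open>i\<close>-th coordinate of the \<open>j\<close>-th point; both indices start at 1, and nothing is
  said about index 0.
\<close>

definition low_discrepancy :: "(nat \<Rightarrow> nat \<Rightarrow> real) \<Rightarrow> bool" where
  "low_discrepancy \<zeta> \<longleftrightarrow>
     (\<forall>j\<ge>1. \<forall>i\<ge>1. \<zeta> j i \<in> {0..1}) \<and>
     (\<forall>I h J. finite I \<and> I \<subseteq> {1..} \<and> has_riemann_integral_cube I h J \<longrightarrow>
        (\<lambda>P. 1 / real P * (\<Sum>j=1..P. h (restrict (\<zeta> j) I))) \<longlonglongrightarrow> J)"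

definition wiener_process :: "'a measure \<Rightarrow> (real \<Rightarrow> 'a \<Rightarrow> real) \<Rightarrow> bool" where
  "wiener_process M W \<longleftrightarrow> prob_space M \<and>
     (\<forall>t\<ge>0. W t \<in> borel_measurable M) \<and>
     (AE \<omega> in M. W 0 \<omega> = 0) \<and>
     (AE \<omega> in M. continuous_on {0..} (\<lambda>t. W t \<omega>)) \<and>
     (\<forall>s t. 0 \<le> s \<and> s < t \<longrightarrow>
        distributed M lborel (\<lambda>\<omega>. W t \<omega> - W s \<omega>)
          (\<lambda>x. ennreal (normal_density 0 (sqrt (t - s)) x))) \<and>
     (\<forall>n (t :: nat \<Rightarrow> real). 0 \<le> t 0 \<and> (\<forall>i<n. t i \<le> t (Suc i)) \<longrightarrow>
        prob_space.indep_vars M (\<lambda>_. borel) (\<lambda>i \<omega>. W (t (Suc i)) \<omega> - W (t i) \<omega>) {..<n})"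

text \<open>
  The filtration generated by the initial value and the noise, augmented by the null sets.
  Adaptedness to it is what makes a solution a strong one.
\<close>

definition augmented_filtration ::
    "'a measure \<Rightarrow> ('a \<Rightarrow> real) \<Rightarrow> (real \<Rightarrow> 'a \<Rightarrow> real) \<Rightarrow> real \<Rightarrow> 'a measure" where
  "augmented_filtration M \<xi> W t = sigma (space M)
     ({\<xi> -` A \<inter> space M | A. A \<in> sets borel} \<union>
      {W s -` A \<inter> space M | s A. s \<in> {0..t} \<and> A \<in> sets borel} \<union>
      null_sets M)"

definition mckean_vlasov_strong_solution ::
    "'a measure \<Rightarrow> (real \<times> real \<Rightarrow> real) \<Rightarrow> (real \<times> real \<Rightarrow> real) \<Rightarrow> real \<Rightarrow> real \<Rightarrow>
     ('a \<Rightarrow> real) \<Rightarrow> (real \<Rightarrow> 'a \<Rightarrow> real) \<Rightarrow> (real \<Rightarrow> 'a \<Rightarrow> real) \<Rightarrow> bool" where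
  "mckean_vlasov_strong_solution M a \<kappa> \<sigma> T \<xi> W Z \<longleftrightarrow>
     (\<forall>t\<in>{0..T}. Z t \<in> borel_measurable (augmented_filtration M \<xi> W t)) \<and>
     (AE \<omega> in M. continuous_on {0..T} (\<lambda>t. Z t \<omega>)) \<and>
     (AE \<omega> in M. \<forall>t\<in>{0..T}.
        Z t \<omega> = \<xi> \<omega>
          + (LBINT s:{0..t}. a (Z s \<omega>, \<integral>z. \<kappa> (Z s \<omega>, z) \<partial>distr M borel (Z s)))
          + \<sigma> * W t \<omega>)"

text \<open>
  Inverse of the standard Gaussian distribution function.  Outside the open unit interval, in
  particular at 0 (where the mathematical value is \<open>-\<infinity>\<close>), the value is an unspecified real
  number; the uniform shift hits such arguments only with probability 0.
\<close>

definition std_normal_quantile :: "real \<Rightarrow> real" where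
  "std_normal_quantile = inv (cdf (density lborel (\<lambda>x. ennreal (std_normal_density x))))"

definition dyadic_node :: "real \<Rightarrow> nat \<Rightarrow> nat \<Rightarrow> real" where
  "dyadic_node T l j = real j * T / 2 ^ l"

text \<open>
  \<open>bridge_value T v l j\<close> is the value of the path at \<open>dyadic_node T l j\<close> (\<open>j \<le> 2 ^ l\<close>) after
  \<open>l\<close> rounds of refinement, \<open>v\<close> being the Gaussian input with index starting at 1.
  At the beginning of round \<open>Suc l\<close> there are \<open>k = 2 ^ l\<close> intervals.  Odd nodes \<open>j = 2 * i - 1\<close>
  of the new level are the midpoints of the \<open>i\<close>-th interval of the old one.
\<close>

primrec bridge_value :: "real \<Rightarrow> (nat \<Rightarrow> real) \<Rightarrow> nat \<Rightarrow> nat \<Rightarrow> real" where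
  "bridge_value T v 0 j = (if j = 0 then 0 else sqrt T * v 1)"
| "bridge_value T v (Suc l) j =
     (if even j then bridge_value T v l (j div 2)
      else let i = (j + 1) div 2; k = 2 ^ l in
        1 / 2 * (bridge_value T v l (i - 1) + bridge_value T v l i)
        + 1 / 2 * sqrt (dyadic_node T l i - dyadic_node T l (i - 1)) * v (k + i))"

text \<open>
  The path for \<open>n = 2 ^ d\<close>, as a function of the time in \<open>{0..T}\<close>; only the coordinates
  \<open>1, \<dots>, n\<close> of \<open>z\<close> and \<open>u\<close> are used.
\<close>

definition bridge_path ::
    "real \<Rightarrow> nat \<Rightarrow> (nat \<Rightarrow> real) \<Rightarrow> (nat \<Rightarrow> real) \<Rightarrow> real \<Rightarrow> real" where
  "bridge_path T d z u t =
     (let w = bridge_value T (\<lambda>k. std_normal_quantile (frac (z k + u k))) d;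
          r = t * 2 ^ d / T;
          j = nat \<lfloor>r\<rfloor>
      in w j + (r - real j) * (w (Suc j) - w j))"

definition uniform_on_cube :: "'a measure \<Rightarrow> nat \<Rightarrow> ('a \<Rightarrow> nat \<Rightarrow> real) \<Rightarrow> bool" where
  "uniform_on_cube M n U \<longleftrightarrow>
     U \<in> measurable M (PiM {1..n} (\<lambda>_. borel)) \<and>
     distr M (PiM {1..n} (\<lambda>_. borel)) U = PiM {1..n} (\<lambda>_. uniform_measure lborel {0..1})"

definition coupled_initial ::
    "(real \<Rightarrow> real) \<Rightarrow> (nat \<Rightarrow> nat \<Rightarrow> real) \<Rightarrow> (nat \<Rightarrow> real) \<Rightarrow> nat \<Rightarrow> real" where
  "coupled_initial H \<zeta> u p = H (frac (\<zeta> p 1 + u 1))"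

definition coupled_path ::
    "real \<Rightarrow> nat \<Rightarrow> (nat \<Rightarrow> nat \<Rightarrow> real) \<Rightarrow> (nat \<Rightarrow> real) \<Rightarrow> nat \<Rightarrow> real \<Rightarrow> real" where
  "coupled_path T d \<zeta> u p = bridge_path T d (\<lambda>k. \<zeta> p (k + 1)) (\<lambda>k. u (k + 1))"

text \<open>
  \<open>euler_particle a \<kappa> \<sigma> T d P x\<^sub>0 w n p\<close> is the state of particle \<open>p \<in> {1..P}\<close> at the \<open>n\<close>-th
  time of the uniform dissection of \<open>{0..T}\<close> into \<open>2 ^ d\<close> steps, where \<open>x\<^sub>0 p\<close> is the initial
  value and \<open>w p\<close> the driving path of particle \<open>p\<close>.
\<close>

primrec euler_particle ::
    "(real \<times> real \<Rightarrow> real) \<Rightarrow> (real \<times> real \<Rightarrow> real) \<Rightarrow> real \<Rightarrow> real \<Rightarrow> nat \<Rightarrow> nat \<Rightarrow>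
     (nat \<Rightarrow> real) \<Rightarrow> (nat \<Rightarrow> real \<Rightarrow> real) \<Rightarrow> nat \<Rightarrow> nat \<Rightarrow> real" where
  "euler_particle a \<kappa> \<sigma> T d P x\<^sub>0 w 0 p = x\<^sub>0 p"
| "euler_particle a \<kappa> \<sigma> T d P x\<^sub>0 w (Suc n) p =
     (let X = euler_particle a \<kappa> \<sigma> T d P x\<^sub>0 w n; t = dyadic_node T d in
        X p
        + a (X p, 1 / real P * (\<Sum>j=1..P. \<kappa> (X p, X j))) * (t (Suc n) - t n)
        + \<sigma> * (w p (t (Suc n)) - w p (t n)))"

definition euler_terminal ::
    "(real \<times> real \<Rightarrow> real) \<Rightarrow> (real \<times> real \<Rightarrow> real) \<Rightarrow> real \<Rightarrow> real \<Rightarrow> (real \<Rightarrow> real) \<Rightarrow>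
     (nat \<Rightarrow> nat \<Rightarrow> real) \<Rightarrow> nat \<Rightarrow> nat \<Rightarrow> (nat \<Rightarrow> real) \<Rightarrow> nat \<Rightarrow> real" where
  "euler_terminal a \<kappa> \<sigma> T H \<zeta> d P u =
     euler_particle a \<kappa> \<sigma> T d P (coupled_initial H \<zeta> u) (coupled_path T d \<zeta> u) (2 ^ d)"

end

(*
  Let m_k be the laws of the Euler scheme whose drift uses its own law instead of the empirical
  measure of the particles. Driven by W, this scheme differs from Z by a bounded quantity, since the
  additive noise cancels, and a discrete Gronwall argument bounds the L1 distance at time T by
  O(|D| + sqrt |D|).

  For a fixed dissection and a fixed shift u, each step of that scheme is a function of the shifted
  point {zeta^p + u} that is continuous off finitely many hyperplanes. Bounded functions of it are
  therefore Riemann integrable on the cube, and A4 gives weak convergence of the empirical measures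
  to m_k: the shift preserves the uniform law, and in normalised increments the Brownian bridge
  construction is a product of 45 degree rotations of coordinate planes, which preserve the standard
  Gaussian law. By induction over the time steps the particles stay close on average to this limit
  scheme, the interaction term being controlled by a finite net for the first argument of kappa.
  Dominated convergence in u concludes.
*)

theory Submission
  imports Defs
begin

section \<open>Riemann integrability on the cube\<close>

text \<open>One shift \<open>U\<close> serves all particles, so their inputs are dependent and no
  law of large numbers over the particles is at hand. The particle limit is therefore proved for
  each single shift, as a statement about a deterministic point sequence, and its value is the same
  for every shift; the randomness of \<open>U\<close> returns only in the last expectation. A4
  speaks of Riemann integrable functions, whereas the Gaussian quantile is unbounded near 0 and 1
  and the shift tears the cube along hyperplanes. Both defects sit on null sets, and a bounded
  continuous test function on top restores boundedness. Weak convergence settles the interaction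
  term for each fixed first argument of \<kappa>, but that argument is itself a particle. A finite
  net covers only a compact range, so the particles outside it have to be counted as well, by a
  continuous cutoff. The square root in the rate is the mean absolute Brownian increment over one
  step.\<close>

abbreviation unit_uniform :: "real measure" where
  "unit_uniform \<equiv> uniform_measure lborel {0..1}"

abbreviation unit_cube :: "nat set \<Rightarrow> (nat \<Rightarrow> real) measure" where
  "unit_cube I \<equiv> PiM I (\<lambda>_. unit_uniform)"

lemma prob_space_unit_uniform: "prob_space unit_uniform"
  by (rule prob_space_uniform_measure) auto

lemma prob_space_unit_cube: "prob_space (unit_cube I)"
  by (intro prob_space_PiM prob_space_unit_uniform)

lemma sets_unit_cube [measurable_cong]: "sets (unit_cube I) = sets (PiM I (\<lambda>_. borel))"
  by (intro sets_PiM_cong) auto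

lemma AE_unit_uniform_interior: "AE x in unit_uniform. 0 < x \<and> x < 1"
proof (rule AE_uniform_measureI)
  have "AE x in lborel. x \<noteq> (0::real)" "AE x in lborel. x \<noteq> (1::real)"
    by (rule AE_lborel_singleton)+
  then show "AE x in lborel. x \<in> {0..1::real} \<longrightarrow> 0 < x \<and> x < 1"
    by eventually_elim auto
qed simp

lemma AE_unit_cube_component:
  assumes "finite I" and "\<And>i. i \<in> I \<Longrightarrow> AE t in unit_uniform. R i t"
  shows "AE x in unit_cube I. \<forall>i\<in>I. R i (x i)"
proof (rule AE_finite_allI[OF assms(1)])
  fix i assume i: "i \<in> I"
  show "AE x in unit_cube I. R i (x i)"
    by (rule AE_PiM_component[OF prob_space_unit_uniform i assms(2)[OF i]])
qed

section \<open>Dissections of the unit interval and their step functions\<close>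

lemma grid_mono:
  fixes s :: "nat \<Rightarrow> real"
  assumes "\<forall>k<m. s k < s (Suc k)" "i \<le> j" "j \<le> m"
  shows "s i \<le> s j"
  using assms(2,3)
proof (induction j)
  case (Suc j)
  show ?case
  proof (cases "i = Suc j")
    case False
    then have "s i \<le> s j" using Suc by simp
    also have "s j < s (Suc j)" using assms(1) Suc.prems by simp
    finally show ?thesis by simp
  qed simp
qed simp

lemma grid_cell_exists:
  fixes s :: "nat \<Rightarrow> real"
  assumes "s 0 \<le> x" "x < s m"
  shows "\<exists>k<m. s k \<le> x \<and> x < s (Suc k)"
  using assms(2)
proof (induction m)
  case (Suc m)
  show ?case
  proof (cases "x < s m")
    case True
    then show ?thesis using Suc.IH less_SucI by blast
  next
    case False
    then show ?thesis using Suc.prems by (auto intro!: exI[of _ m])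
  qed
qed (use assms(1) in auto)

lemma grid_cell_unique:
  fixes s :: "nat \<Rightarrow> real"
  assumes "\<forall>k<m. s k < s (Suc k)" "i < m" "j < m"
    and "s i \<le> x" "x < s (Suc i)" "s j \<le> x" "x < s (Suc j)"
  shows "i = j"
proof (rule ccontr)
  assume "i \<noteq> j"
  then consider "Suc i \<le> j" | "Suc j \<le> i" by linarith
  then show False
    using grid_mono[OF assms(1), of "Suc i" j] grid_mono[OF assms(1), of "Suc j" i] assms
    by cases auto
qed

text \<open>Half-open cells make the grid a partition of the cube without its upper faces, and
  writing a cell as a product of one-dimensional indicators lets the integral over the product
  measure factor.\<close>

definition grid_step_function ::
    "nat set \<Rightarrow> (nat \<Rightarrow> nat) \<Rightarrow> (nat \<Rightarrow> nat \<Rightarrow> real) \<Rightarrow> ((nat \<Rightarrow> nat) \<Rightarrow> real) \<Rightarrow> (nat \<Rightarrow> real) \<Rightarrow> real" where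
  "grid_step_function I m s v x =
     (\<Sum>c\<in>PiE I (\<lambda>i. {..<m i}). v c * (\<Prod>i\<in>I. indicator {s i (c i)..<s i (Suc (c i))} (x i)))"

lemma integral_grid_step_function:
  assumes I: "finite I"
    and s: "\<forall>i\<in>I. s i 0 = 0 \<and> s i (m i) = 1 \<and> (\<forall>k<m i. s i k < s i (Suc k))"
  shows "(\<integral>x. grid_step_function I m s v x \<partial>unit_cube I) =
    (\<Sum>c\<in>PiE I (\<lambda>i. {..<m i}). v c * (\<Prod>i\<in>I. s i (Suc (c i)) - s i (c i)))"
proof -
  interpret product_prob_space "\<lambda>_::nat. unit_uniform"
    by (intro product_prob_spaceI prob_space_unit_uniform)
  have int: "integrable unit_uniform (indicator {p..<q} :: real \<Rightarrow> real)" for p q :: real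
    by (intro integrable_real_indicator) (auto simp: less_top[symmetric] simp del: emeasure_uniform_measure)
  have len: "(\<integral>x. indicator {s i (c i)..<s i (Suc (c i))} x \<partial>unit_uniform) = s i (Suc (c i)) - s i (c i)"
    if c: "c \<in> PiE I (\<lambda>i. {..<m i})" and i: "i \<in> I" for c i
  proof -
    have ci: "c i < m i" using c i by auto
    have mono: "\<forall>k<m i. s i k < s i (Suc k)" using s i by blast
    \<comment> \<open>The cell lies inside [0,1], so intersecting it with the support of the uniform
      law does not shorten it.\<close>
    have "0 \<le> s i (c i)" "s i (Suc (c i)) \<le> 1" "s i (c i) \<le> s i (Suc (c i))"
      using grid_mono[OF mono, of 0 "c i"] grid_mono[OF mono, of "Suc (c i)" "m i"]
        grid_mono[OF mono, of "c i" "Suc (c i)"] ci s i by auto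
    then have "{0..1} \<inter> {s i (c i)..<s i (Suc (c i))} = {s i (c i)..<s i (Suc (c i))}"
      and "measure lborel {s i (c i)..<s i (Suc (c i))} = s i (Suc (c i)) - s i (c i)"
      by auto
    then show ?thesis by simp
  qed
  have "(\<integral>x. grid_step_function I m s v x \<partial>unit_cube I) =
      (\<Sum>c\<in>PiE I (\<lambda>i. {..<m i}). v c *
        (\<integral>x. (\<Prod>i\<in>I. indicator {s i (c i)..<s i (Suc (c i))} (x i)) \<partial>unit_cube I))"
    unfolding grid_step_function_def
    by (subst Bochner_Integration.integral_sum)
      (auto intro!: integrable_mult_right product_integrable_prod I int)
  also have "\<dots> = (\<Sum>c\<in>PiE I (\<lambda>i. {..<m i}). v c * (\<Prod>i\<in>I. s i (Suc (c i)) - s i (c i)))"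
  proof (intro sum.cong refl arg_cong2[where f="(*)"])
    fix c assume c: "c \<in> PiE I (\<lambda>i. {..<m i})"
    show "(\<integral>x. (\<Prod>i\<in>I. indicator {s i (c i)..<s i (Suc (c i))} (x i)) \<partial>unit_cube I) =
        (\<Prod>i\<in>I. s i (Suc (c i)) - s i (c i))"
      by (subst product_integral_prod[OF I int]) (rule prod.cong[OF refl len[OF c]])
  qed
  finally show ?thesis .
qed

text \<open>Two different cells differ in some coordinate, and there their intervals are disjoint,
  so one factor of the product vanishes: of the whole sum only the cell containing \<open>x\<close>
  is left.\<close>

lemma grid_step_function_eq:
  assumes I: "finite I"
    and s: "\<forall>i\<in>I. s i 0 = 0 \<and> s i (m i) = 1 \<and> (\<forall>k<m i. s i k < s i (Suc k))"
    and x: "\<forall>i\<in>I. 0 \<le> x i \<and> x i < 1"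
  shows "\<exists>c\<in>PiE I (\<lambda>i. {..<m i}). grid_step_function I m s v x = v c \<and>
    (\<forall>i\<in>I. x i \<in> {s i (c i)..<s i (Suc (c i))})"
proof -
  have "\<forall>i\<in>I. \<exists>k<m i. s i k \<le> x i \<and> x i < s i (Suc k)"
  proof
    fix i assume "i \<in> I"
    with s x show "\<exists>k<m i. s i k \<le> x i \<and> x i < s i (Suc k)"
      by (intro grid_cell_exists) auto
  qed
  then obtain k where k: "\<forall>i\<in>I. k i < m i \<and> s i (k i) \<le> x i \<and> x i < s i (Suc (k i))"
    by metis
  define c where "c = restrict k I"
  have c: "c \<in> PiE I (\<lambda>i. {..<m i})" "\<forall>i\<in>I. x i \<in> {s i (c i)..<s i (Suc (c i))}"
    using k by (auto simp: c_def)
  have fin: "finite (PiE I (\<lambda>i. {..<m i}))" using I by (auto intro: finite_PiE)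
  have "(\<Prod>i\<in>I. indicator {s i (c' i)..<s i (Suc (c' i))} (x i)) = (if c' = c then 1 else 0::real)"
    if c': "c' \<in> PiE I (\<lambda>i. {..<m i})" for c'
  proof (cases "c' = c")
    case True
    then show ?thesis using c(2) by (auto intro!: prod.neutral)
  next
    case False
    then obtain i where i: "i \<in> I" "c' i \<noteq> c i"
      using PiE_ext[OF c' c(1)] by blast
    then have "x i \<notin> {s i (c' i)..<s i (Suc (c' i))}"
      using grid_cell_unique[of "m i" "s i" "c' i" "c i" "x i"] c' c s by fastforce
    then show ?thesis using False I i by (auto intro!: prod_zero bexI[of _ i])
  qed
  then have "grid_step_function I m s v x = (\<Sum>c'\<in>PiE I (\<lambda>i. {..<m i}). if c' = c then v c' else 0)"
    unfolding grid_step_function_def by (intro sum.cong) auto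
  also have "\<dots> = v c" using fin c(1) by simp
  finally show ?thesis using c by blast
qed

text \<open>The Riemann sums are integrals of step functions that converge wherever \<open>h\<close> is continuous,
  so bounded convergence applies along every sequence of grids with mesh tending to 0.\<close>

lemma has_riemann_integral_cubeI:
  assumes I: "finite I"
    and h[measurable]: "h \<in> borel_measurable (PiM I (\<lambda>_. borel))"
    and B: "\<And>x. x \<in> PiE I (\<lambda>_. {0..1}) \<Longrightarrow> \<bar>h x\<bar> \<le> B"
    and cont: "AE x in unit_cube I. \<forall>y. (\<forall>k. y k \<in> PiE I (\<lambda>_. {0..1})) \<and>
        (\<forall>i\<in>I. (\<lambda>k. y k i) \<longlonglongrightarrow> x i) \<longrightarrow> (\<lambda>k. h (y k)) \<longlonglongrightarrow> h x"
  shows "has_riemann_integral_cube I h (\<integral>x. h x \<partial>unit_cube I)"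
proof -
  define J where "J = (\<integral>x. h x \<partial>unit_cube I)"
  define grid where "grid \<delta> m s \<tau> \<longleftrightarrow>
        (\<forall>i\<in>I. s i 0 = 0 \<and> s i (m i) = 1 \<and>
           (\<forall>k<m i. s i k < s i (Suc k) \<and> s i (Suc k) - s i k < \<delta>)) \<and>
        (\<forall>c\<in>PiE I (\<lambda>i. {..<m i}). \<tau> c \<in> PiE I (\<lambda>i. {s i (c i)..s i (Suc (c i))}))"
    for \<delta> :: real and m :: "nat \<Rightarrow> nat" and s :: "nat \<Rightarrow> nat \<Rightarrow> real" and \<tau> :: "(nat \<Rightarrow> nat) \<Rightarrow> nat \<Rightarrow> real"
  define rs where "rs m s \<tau> =
      (\<Sum>c\<in>PiE I (\<lambda>i. {..<m i}). h (\<tau> c) * (\<Prod>i\<in>I. s i (Suc (c i)) - s i (c i)))"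
    for m :: "nat \<Rightarrow> nat" and s :: "nat \<Rightarrow> nat \<Rightarrow> real" and \<tau> :: "(nat \<Rightarrow> nat) \<Rightarrow> nat \<Rightarrow> real"
  have riemann_iff: "has_riemann_integral_cube I h J \<longleftrightarrow>
      (\<forall>\<epsilon>>0. \<exists>\<delta>>0. \<forall>m s \<tau>. grid \<delta> m s \<tau> \<longrightarrow> \<bar>rs m s \<tau> - J\<bar> < \<epsilon>)"
    unfolding has_riemann_integral_cube_def grid_def rs_def by (rule refl)
  show "has_riemann_integral_cube I h (\<integral>x. h x \<partial>unit_cube I)"
    unfolding J_def[symmetric] riemann_iff
  proof (intro allI impI, rule ccontr)
    fix \<epsilon> :: real assume \<epsilon>: "\<epsilon> > 0"
    assume nex: "\<not> (\<exists>\<delta>>0. \<forall>m s \<tau>. grid \<delta> m s \<tau> \<longrightarrow> \<bar>rs m s \<tau> - J\<bar> < \<epsilon>)"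
    \<comment> \<open>If \<epsilon> fails, each mesh bound 1/(n+1) admits a tagged grid whose
      Riemann sum stays at distance at least \<epsilon> from \<open>J\<close>; the contradiction
      will be that these sums converge to \<open>J\<close>.\<close>
    have "\<exists>m s \<tau>. grid (1 / Suc n) m s \<tau> \<and> \<not> \<bar>rs m s \<tau> - J\<bar> < \<epsilon>" for n
    proof (rule ccontr)
      assume "\<not> ?thesis"
      then have "\<forall>m s \<tau>. grid (1 / Suc n) m s \<tau> \<longrightarrow> \<bar>rs m s \<tau> - J\<bar> < \<epsilon>" by simp
      moreover have "1 / real (Suc n) > 0" by simp
      ultimately show False using nex by blast
    qed
    then obtain m s \<tau> where G: "\<And>n. grid (1 / Suc n) (m n) (s n) (\<tau> n) \<and>
        \<not> \<bar>rs (m n) (s n) (\<tau> n) - J\<bar> < \<epsilon>"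
      by metis
    then have grid: "grid (1 / Suc n) (m n) (s n) (\<tau> n)" and far: "\<not> \<bar>rs (m n) (s n) (\<tau> n) - J\<bar> < \<epsilon>" for n
      by blast+
    have s: "\<forall>i\<in>I. s n i 0 = 0 \<and> s n i (m n i) = 1 \<and> (\<forall>k<m n i. s n i k < s n i (Suc k))" for n
      using grid[of n] by (auto simp: grid_def)
    have mesh: "s n i (Suc k) - s n i k < 1 / Suc n" if "i \<in> I" "k < m n i" for n i k
      using grid[of n] that by (auto simp: grid_def)
    have \<tau>: "\<tau> n c \<in> PiE I (\<lambda>i. {s n i (c i)..s n i (Suc (c i))})"
      if "c \<in> PiE I (\<lambda>i. {..<m n i})" for n c
      using grid[of n] that by (auto simp: grid_def)
    \<comment> \<open>The bound \<open>B\<close> and the continuity hypothesis speak of points of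
      the cube, so the tags have to be placed there.\<close>
    have \<tau>01: "\<tau> n c \<in> PiE I (\<lambda>_. {0..1})" if c: "c \<in> PiE I (\<lambda>i. {..<m n i})" for n c
    proof (rule PiE_I)
      fix i assume i: "i \<in> I"
      then have mono: "\<forall>k<m n i. s n i k < s n i (Suc k)" using s by blast
      have ci: "c i < m n i" using c i by auto
      have "\<tau> n c i \<in> {s n i (c i)..s n i (Suc (c i))}" using \<tau>[OF c] i by auto
      moreover have "0 \<le> s n i (c i)" "s n i (Suc (c i)) \<le> 1"
        using grid_mono[OF mono, of 0 "c i"] grid_mono[OF mono, of "Suc (c i)" "m n i"] s[of n] i ci
        by auto
      ultimately show "\<tau> n c i \<in> {0..1}" by auto
    next
      fix i assume "i \<notin> I"
      then show "\<tau> n c i = undefined" using \<tau>[OF c] by (auto simp: PiE_def extensional_def)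
    qed
    define S where "S n = grid_step_function I (m n) (s n) (\<lambda>c. h (\<tau> n c))" for n
    have rs: "rs (m n) (s n) (\<tau> n) = (\<integral>x. S n x \<partial>unit_cube I)" for n
      unfolding S_def rs_def by (rule integral_grid_step_function[OF I s, symmetric])
    interpret prob_space "unit_cube I" by (rule prob_space_unit_cube)
    have inside: "AE x in unit_cube I. \<forall>i\<in>I. 0 < x i \<and> x i < 1"
      by (rule AE_unit_cube_component[OF I AE_unit_uniform_interior])
    \<comment> \<open>The tag is within the mesh of every point of its cell, so the step function at
      \<open>x\<close> is the value of \<open>h\<close> at a point that tends to
      \<open>x\<close>.\<close>
    have cell: "\<exists>y. y \<in> PiE I (\<lambda>_. {0..1}) \<and> S n x = h y \<and> (\<forall>i\<in>I. \<bar>y i - x i\<bar> \<le> 1 / Suc n)"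
      if x: "\<forall>i\<in>I. 0 < x i \<and> x i < 1" for n x
    proof -
      from grid_step_function_eq[OF I s[of n], where x=x and v="\<lambda>c. h (\<tau> n c)"] x
      obtain c where c: "c\<in>PiE I (\<lambda>i. {..<m n i})" and Sc: "S n x = h (\<tau> n c)"
        and xc: "\<forall>i\<in>I. x i \<in> {s n i (c i)..<s n i (Suc (c i))}"
        unfolding S_def by (auto simp: less_imp_le)
      have "\<bar>\<tau> n c i - x i\<bar> \<le> 1 / Suc n" if i: "i \<in> I" for i
      proof -
        have "\<tau> n c i \<in> {s n i (c i)..s n i (Suc (c i))}" using \<tau>[OF c] i by auto
        moreover have "s n i (Suc (c i)) - s n i (c i) < 1 / Suc n" using mesh i c by auto
        moreover have "x i \<in> {s n i (c i)..<s n i (Suc (c i))}" using xc i by blast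
        ultimately show ?thesis by auto
      qed
      then show ?thesis using \<tau>01[OF c] Sc by blast
    qed
    have "(\<lambda>n. \<integral>x. S n x \<partial>unit_cube I) \<longlonglongrightarrow> J"
      unfolding J_def
    proof (rule integral_dominated_convergence[where w="\<lambda>_. B"])
      show "AE x in unit_cube I. (\<lambda>n. S n x) \<longlonglongrightarrow> h x"
        using inside cont
      proof eventually_elim
        fix x assume x: "\<forall>i\<in>I. 0 < x i \<and> x i < 1" and
          c: "\<forall>y. (\<forall>k. y k \<in> PiE I (\<lambda>_. {0..1})) \<and>
          (\<forall>i\<in>I. (\<lambda>k. y k i) \<longlonglongrightarrow> x i) \<longrightarrow> (\<lambda>k. h (y k)) \<longlonglongrightarrow> h x"
        from cell[OF x] obtain y where y: "\<And>n. y n \<in> PiE I (\<lambda>_. {0..1})" "\<And>n. S n x = h (y n)"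
          "\<And>n i. i \<in> I \<Longrightarrow> \<bar>y n i - x i\<bar> \<le> 1 / Suc n" by metis
        have "(\<lambda>k. y k i) \<longlonglongrightarrow> x i" if i: "i \<in> I" for i
        proof (rule LIM_zero_cancel, rule Lim_null_comparison)
          show "\<forall>\<^sub>F n in sequentially. norm (y n i - x i) \<le> 1 / real (Suc n)"
            using y(3)[OF i] by (intro always_eventually) auto
          show "(\<lambda>n. 1 / real (Suc n)) \<longlonglongrightarrow> 0" by (rule LIMSEQ_Suc[OF lim_1_over_n])
        qed
        then show "(\<lambda>n. S n x) \<longlonglongrightarrow> h x" unfolding y(2) using c y(1) by blast
      qed
      show "AE x in unit_cube I. norm (S n x) \<le> B" for n
        using inside
      proof eventually_elim
        case (elim x)
        then show ?case using cell[OF elim, of n] B by auto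
      qed
      show "S n \<in> borel_measurable (unit_cube I)" for n
        unfolding S_def grid_step_function_def[abs_def] by measurable
    qed (auto intro!: integrable_const)
    then have "\<forall>\<^sub>F n in sequentially. \<bar>(\<integral>x. S n x \<partial>unit_cube I) - J\<bar> < \<epsilon>"
      using \<epsilon> by (auto simp: tendsto_iff dist_real_def)
    then show False using far unfolding rs by (auto simp: eventually_sequentially)
  qed
qed

section \<open>Gaussian and uniform laws\<close>

lemma std_normal_cdf_strict_mono:
  assumes "x < y"
  shows "cdf std_normal_distribution x < cdf std_normal_distribution y"
proof -
  interpret real_distribution std_normal_distribution by (rule real_dist_normal_dist)
  \<comment> \<open>On an interval of Gaussian measure 0 the density would vanish almost everywhere;
    as it is positive, the interval would be a Lebesgue null set.\<close>
  have "emeasure std_normal_distribution {x<..y} \<noteq> 0"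
  proof
    assume "emeasure std_normal_distribution {x<..y} = 0"
    then have "AE z in lborel. ennreal (std_normal_density z) * indicator {x<..y} z = 0"
      by (subst (asm) emeasure_density) (auto simp: nn_integral_0_iff_AE)
    then have "AE z in lborel. z \<notin> {x<..y}"
    proof eventually_elim
      case (elim z)
      then show ?case
        using normal_density_pos[of 1 0 z] by (auto simp: indicator_def simp del: normal_density_nonneg)
    qed
    then have "emeasure lborel {x<..y} = 0"
      by (subst (asm) AE_iff_measurable[of "{x<..y}"]) auto
    then show False using assms by simp
  qed
  then have "measure std_normal_distribution {x<..y} > 0"
    by (simp add: emeasure_eq_measure zero_less_measure_iff)
  then show ?thesis using cdf_diff_eq[OF assms] by simp
qed

lemma std_normal_cdf_continuous: "isCont (cdf std_normal_distribution) x"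
proof -
  interpret real_distribution std_normal_distribution by (rule real_dist_normal_dist)
  have "emeasure std_normal_distribution {x} = 0"
    by (subst emeasure_density) (auto intro!: nn_integral_0_iff_AE[THEN iffD2] AE_I'[of "{x}"])
  then show ?thesis by (simp add: isCont_cdf measure_def)
qed

lemma std_normal_cdf_range: "range (cdf std_normal_distribution) = {0<..<1}"
proof -
  interpret real_distribution std_normal_distribution by (rule real_dist_normal_dist)
  have "0 < cdf std_normal_distribution x" for x
    using cdf_nonneg[of "x - 1"] std_normal_cdf_strict_mono[of "x - 1" x] by simp
  moreover have "cdf std_normal_distribution x < 1" for x
    using cdf_bounded_prob[of "x + 1"] std_normal_cdf_strict_mono[of x "x + 1"] by simp
  moreover have "\<exists>x. cdf std_normal_distribution x = p" if p: "0 < p" "p < 1" for p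
  proof -
    have "\<forall>\<^sub>F x in at_bot. cdf std_normal_distribution x < p"
      using order_tendstoD(2)[OF cdf_lim_at_bot p(1)] .
    then obtain x where x: "cdf std_normal_distribution x < p"
      using eventually_happens trivial_limit_at_bot_linorder by blast
    have "\<forall>\<^sub>F x in at_top. p < cdf std_normal_distribution x"
      using order_tendstoD(1)[OF cdf_lim_at_top_prob p(2)] .
    then obtain y where y: "p < cdf std_normal_distribution y"
      using eventually_happens trivial_limit_at_top_linorder by blast
    have "x \<le> y"
      using x y std_normal_cdf_strict_mono[of y x] by (cases "x \<le> y") auto
    then show ?thesis
      using IVT[of "cdf std_normal_distribution" x p y] x y std_normal_cdf_continuous by auto
  qed
  ultimately show ?thesis by (auto simp: image_iff) metis
qed

lemma cdf_std_normal_quantile: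
  assumes "0 < p" "p < 1"
  shows "cdf std_normal_distribution (std_normal_quantile p) = p"
  unfolding std_normal_quantile_def using assms std_normal_cdf_range
  by (intro f_inv_into_f) auto

text \<open>An order duality between the quantile and the distribution function. It yields
  continuity through the order topology, and the law by comparing distribution functions.\<close>

lemma std_normal_quantile_less_iff:
  assumes "0 < p" "p < 1"
  shows "std_normal_quantile p < x \<longleftrightarrow> p < cdf std_normal_distribution x"
    and "x < std_normal_quantile p \<longleftrightarrow> cdf std_normal_distribution x < p"
  using std_normal_cdf_strict_mono[of "std_normal_quantile p" x]
    std_normal_cdf_strict_mono[of x "std_normal_quantile p"] cdf_std_normal_quantile[OF assms]
  by (cases x "std_normal_quantile p" rule: linorder_cases; simp)+

lemma isCont_std_normal_quantile:
  assumes "0 < p" "p < 1"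
  shows "isCont std_normal_quantile p"
  unfolding isCont_def
proof (rule order_tendstoI)
  have p01: "\<forall>\<^sub>F p' in at p. 0 < p' \<and> p' < 1"
    using assms by (intro eventually_conj order_tendstoD[OF tendsto_ident_at])
  fix x
  {
    assume "x < std_normal_quantile p"
    then have "\<forall>\<^sub>F p' in at p. cdf std_normal_distribution x < p'"
      using std_normal_quantile_less_iff(2)[OF assms] by (intro order_tendstoD[OF tendsto_ident_at]) auto
    with p01 show "\<forall>\<^sub>F p' in at p. x < std_normal_quantile p'"
      by eventually_elim (simp add: std_normal_quantile_less_iff(2))
  }
  {
    assume "std_normal_quantile p < x"
    then have "\<forall>\<^sub>F p' in at p. p' < cdf std_normal_distribution x"
      using std_normal_quantile_less_iff(1)[OF assms] by (intro order_tendstoD[OF tendsto_ident_at]) auto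
    with p01 show "\<forall>\<^sub>F p' in at p. std_normal_quantile p' < x"
      by eventually_elim (simp add: std_normal_quantile_less_iff(1))
  }
qed

text \<open>Off the open unit interval \<^const>\<open>std_normal_quantile\<close> is a choice from the empty predicate,
  hence constant there.\<close>

lemma borel_measurable_std_normal_quantile [measurable]:
  "std_normal_quantile \<in> borel_measurable borel"
proof -
  have out: "std_normal_quantile p = (SOME x. False)" if "p \<notin> {0<..<1}" for p
  proof -
    have "(\<lambda>x. cdf std_normal_distribution x = p) = (\<lambda>x. False)"
      using std_normal_cdf_range that by (metis rangeI)
    then show ?thesis by (simp add: std_normal_quantile_def inv_into_def)
  qed
  have "(\<lambda>p. if p \<in> {0<..<1} then std_normal_quantile p else (SOME x. False)) \<in> borel_measurable borel"
    by (intro borel_measurable_continuous_on_if continuous_at_imp_continuous_on ballI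
        isCont_std_normal_quantile continuous_on_const) auto
  also have "(\<lambda>p. if p \<in> {0<..<1} then std_normal_quantile p else (SOME x. False)) = std_normal_quantile"
    using out by auto
  finally show ?thesis .
qed

text \<open>Inverse transform sampling: off the null endpoints, the quantile at \<open>p\<close> is
  at most \<open>x\<close> exactly if \<open>p\<close> is at most \<open>F\<close>, an event of
  uniform probability \<open>F\<close>.\<close>

lemma distr_std_normal_quantile:
  "distr unit_uniform borel std_normal_quantile = std_normal_distribution"
proof (rule cdf_unique[OF _ real_dist_normal_dist])
  interpret U: prob_space unit_uniform by (rule prob_space_unit_uniform)
  have meas: "std_normal_quantile \<in> borel_measurable unit_uniform" by simp
  show "real_distribution (distr unit_uniform borel std_normal_quantile)"
    by (rule U.real_distribution_distr[OF meas])
  show "cdf (distr unit_uniform borel std_normal_quantile) = cdf std_normal_distribution"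
  proof
    fix x
    define F where "F = cdf std_normal_distribution x"
    have F: "0 < F" "F < 1" using std_normal_cdf_range by (auto simp: F_def)
    have "cdf (distr unit_uniform borel std_normal_quantile) x = measure unit_uniform {p. std_normal_quantile p \<le> x}"
      unfolding cdf_def2 by (subst measure_distr) (auto simp: vimage_def)
    also have "\<dots> = measure unit_uniform {..F}"
    proof (rule measure_eq_AE)
      show "AE p in unit_uniform. p \<in> {p. std_normal_quantile p \<le> x} \<longleftrightarrow> p \<in> {..F}"
        using AE_unit_uniform_interior
        by eventually_elim (auto simp: not_less[symmetric] std_normal_quantile_less_iff F_def)
    qed auto
    also have "\<dots> = F"
    proof -
      have "{0..1} \<inter> {..F} = {0..F}" using F by auto
      then show ?thesis using F by simp
    qed
    finally show "cdf (distr unit_uniform borel std_normal_quantile) x = cdf std_normal_distribution x"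
      by (simp add: F_def)
  qed
qed

section \<open>Shifts modulo 1 and coordinatewise maps of product measures\<close>

lemma borel_measurable_frac [measurable]: "(frac :: real \<Rightarrow> real) \<in> borel_measurable borel"
  unfolding frac_def[abs_def] by measurable

text \<open>Translation invariance on the circle. Cutting the unit interval where
  \<open>x + c\<close> passes 1 leaves two pieces, each moved by a plain translation, and their
  images \<open>{c..<1}\<close> and \<open>{0..<c}\<close> tile the interval again.\<close>

lemma distr_unit_uniform_shift:
  "distr unit_uniform borel (\<lambda>x. frac (x + u)) = unit_uniform"
proof (rule measure_eqI)
  fix A :: "real set" assume "A \<in> sets (distr unit_uniform borel (\<lambda>x. frac (x + u)))"
  then have A[measurable]: "A \<in> sets borel" by simp
  define c where "c = frac u"
  have c: "0 \<le> c" "c < 1" by (auto simp: c_def frac_lt_1)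
  have fc: "frac (x + u) = (if x + c < 1 then x + c else x + c - 1)" if "0 \<le> x" "x < 1" for x
    using that c by (simp add: c_def frac_add frac_eq[THEN iffD2])
  have "emeasure (distr unit_uniform borel (\<lambda>x. frac (x + u))) A =
      (\<integral>\<^sup>+x. indicator A (frac (x + u)) \<partial>unit_uniform)"
    by (subst nn_integral_indicator[symmetric]) (auto simp: nn_integral_distr simp del: nn_integral_indicator)
  also have "\<dots> = (\<integral>\<^sup>+x. indicator A (frac (x + u)) * indicator {0..1} x \<partial>lborel)"
    by (subst nn_integral_uniform_measure) (auto simp: divide_ennreal_def)
  \<comment> \<open>The translations carry a factor 1 to match
    \<open>nn_integral_real_affine\<close>. At the point 1 the two integrands may differ, hence the
    equality almost everywhere.\<close>
  also have "\<dots> = (\<integral>\<^sup>+x. (indicator (A \<inter> {c..<1}) (c + 1 * x) + indicator (A \<inter> {0..<c}) (c - 1 + 1 * x) :: ennreal) \<partial>lborel)"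
  proof (rule nn_integral_cong_AE)
    have "AE x in lborel. x \<noteq> (1::real)" by (rule AE_lborel_singleton)
    then show "AE x in lborel. (indicator A (frac (x + u)) * indicator {0..1} x :: ennreal) =
        indicator (A \<inter> {c..<1}) (c + 1 * x) + indicator (A \<inter> {0..<c}) (c - 1 + 1 * x)"
    proof eventually_elim
      case (elim x)
      show ?case
      proof (cases "0 \<le> x \<and> x < 1")
        case True
        then have *: "frac (x + u) = (if x + c < 1 then x + c else x + c - 1)" using fc by blast
        show ?thesis unfolding * using c True
          by (cases "x + c < 1") (simp_all add: indicator_def algebra_simps)
      next
        case False
        then show ?thesis using c elim by (auto simp: indicator_def)
      qed
    qed
  qed
  also have "\<dots> = (\<integral>\<^sup>+x. indicator (A \<inter> {c..<1}) (c + 1 * x) \<partial>lborel) +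
      (\<integral>\<^sup>+x. indicator (A \<inter> {0..<c}) (c - 1 + 1 * x) \<partial>lborel)"
    by (rule nn_integral_add) auto
  also have "\<dots> = emeasure lborel (A \<inter> {c..<1}) + emeasure lborel (A \<inter> {0..<c})"
    using nn_integral_real_affine[of "indicator (A \<inter> {c..<1})" 1 c]
      nn_integral_real_affine[of "indicator (A \<inter> {0..<c})" 1 "c - 1"] by simp
  also have "\<dots> = emeasure lborel ((A \<inter> {c..<1}) \<union> (A \<inter> {0..<c}))"
    by (rule plus_emeasure) auto
  also have "\<dots> = emeasure lborel ({0..1} \<inter> A)"
  proof (rule emeasure_eq_AE)
    have "AE x in lborel. x \<noteq> (1::real)" by (rule AE_lborel_singleton)
    then show "AE x in lborel. (x \<in> A \<inter> {c..<1} \<union> A \<inter> {0..<c}) = (x \<in> {0..1} \<inter> A)"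
      by eventually_elim (use c in auto)
  qed auto
  also have "\<dots> = emeasure unit_uniform A"
    by (simp add: divide_ennreal_def)
  finally show "emeasure (distr unit_uniform borel (\<lambda>x. frac (x + u))) A = emeasure unit_uniform A" .
qed simp

lemma distr_PiM_coordinatewise:
  assumes I: "finite I"
    and "\<And>i. i \<in> I \<Longrightarrow> prob_space (M i)"
    and f: "\<And>i. i \<in> I \<Longrightarrow> f i \<in> measurable (M i) (N i)"
  shows "distr (PiM I M) (PiM I N) (\<lambda>x. \<lambda>i\<in>I. f i (x i)) = PiM I (\<lambda>i. distr (M i) (N i) (f i))"
proof -
  \<comment> \<open>The product locale asks for a probability measure at every index, so both
    families are filled up outside \<open>I\<close> with point masses, which \<open>PiM I\<close>
    does not see.\<close>
  define M' where "M' i = (if i \<in> I then M i else return (count_space UNIV) undefined)" for i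
  define D where "D i = (if i \<in> I then distr (M i) (N i) (f i) else return (count_space UNIV) undefined)" for i
  interpret M': product_prob_space M'
    by (rule product_prob_spaceI) (auto simp: M'_def intro!: prob_space_return assms)
  interpret D: product_prob_space D
    by (rule product_prob_spaceI)
      (auto simp: D_def intro!: prob_space_return prob_space.prob_space_distr assms)
  have M_eq: "PiM I M = PiM I M'" by (rule PiM_cong) (auto simp: M'_def)
  have D_eq: "PiM I (\<lambda>i. distr (M i) (N i) (f i)) = PiM I D" by (rule PiM_cong) (auto simp: D_def)
  have f': "f i \<in> measurable (M' i) (N i)" if "i \<in> I" for i
    using f[OF that] that by (simp add: M'_def)
  have meas: "(\<lambda>x. \<lambda>i\<in>I. f i (x i)) \<in> measurable (PiM I M') (PiM I N)"
  proof (rule measurable_restrict)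
    fix i assume "i \<in> I"
    then show "(\<lambda>x. f i (x i)) \<in> measurable (PiM I M') (N i)"
      using measurable_compose[where g="f i", OF measurable_component_singleton[of i I M'] f'] by blast
  qed
  have "distr (PiM I M') (PiM I N) (\<lambda>x. \<lambda>i\<in>I. f i (x i)) = PiM I D"
  proof (rule D.PiM_eqI[OF I])
    show "sets (distr (PiM I M') (PiM I N) (\<lambda>x. \<lambda>i\<in>I. f i (x i))) = sets (PiM I D)"
      by (simp cong: sets_PiM_cong add: D_def)
  next
    fix A assume A: "\<And>i. i \<in> I \<Longrightarrow> A i \<in> sets (D i)"
    then have A': "\<And>i. i \<in> I \<Longrightarrow> A i \<in> sets (N i)" by (simp add: D_def)
    have "emeasure (distr (PiM I M') (PiM I N) (\<lambda>x. \<lambda>i\<in>I. f i (x i))) (Pi\<^sub>E I A) =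
        emeasure (PiM I M') (Pi\<^sub>E I (\<lambda>i. f i -` A i \<inter> space (M' i)))"
      by (subst emeasure_distr[OF meas])
        (rule sets_PiM_I_finite[OF I A'],
          auto intro!: arg_cong2[where f=emeasure] simp: space_PiM PiE_def Pi_def)
    also have "\<dots> = (\<Prod>i\<in>I. emeasure (M' i) (f i -` A i \<inter> space (M' i)))"
      using A' f' by (intro M'.emeasure_PiM I) (auto intro: measurable_sets)
    also have "\<dots> = (\<Prod>i\<in>I. emeasure (D i) (A i))"
      using A' f by (intro prod.cong refl) (auto simp: M'_def D_def emeasure_distr)
    finally show "emeasure (distr (PiM I M') (PiM I N) (\<lambda>x. \<lambda>i\<in>I. f i (x i))) (Pi\<^sub>E I A) =
        (\<Prod>i\<in>I. emeasure (D i) (A i))" .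
  qed
  then show ?thesis by (simp add: M_eq D_eq)
qed

lemma distr_unit_cube_shift:
  assumes "finite I"
  shows "distr (unit_cube I) (PiM I (\<lambda>_. borel)) (\<lambda>x. \<lambda>i\<in>I. frac (x i + u i)) = unit_cube I"
  by (subst distr_PiM_coordinatewise[OF assms prob_space_unit_uniform])
    (auto simp: distr_unit_uniform_shift)

text \<open>The planar density depends on x^2 + y^2 alone. Two one-dimensional affine substitutions
  replace a change of variables in the plane: first x = -y + sqrt 2 s for fixed y, then, after
  exchanging the integrals, y = (s - t) / sqrt 2 for fixed s. Their Jacobians sqrt 2 and 1 / sqrt 2
  cancel.\<close>

lemma nn_integral_std_normal_rotation:
  fixes F :: "real \<Rightarrow> real \<Rightarrow> ennreal"
  assumes [measurable]: "case_prod F \<in> borel_measurable (borel \<Otimes>\<^sub>M borel)"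
  shows "(\<integral>\<^sup>+y. \<integral>\<^sup>+x. F ((x + y) / sqrt 2) ((x - y) / sqrt 2) \<partial>std_normal_distribution \<partial>std_normal_distribution) =
    (\<integral>\<^sup>+y. \<integral>\<^sup>+x. F x y \<partial>std_normal_distribution \<partial>std_normal_distribution)"
proof -
  let ?p = "\<lambda>x. ennreal (std_normal_density x)"
  have Fm[measurable (raw)]: "(\<lambda>z. F (f z) (g z)) \<in> borel_measurable N"
    if [measurable]: "f \<in> borel_measurable N" "g \<in> borel_measurable N" for f g and N :: "'z measure"
  proof -
    have "(\<lambda>z. case_prod F (f z, g z)) \<in> borel_measurable N" by measurable
    then show ?thesis by simp
  qed
  have dens: "(\<integral>\<^sup>+y. \<integral>\<^sup>+x. G x y \<partial>std_normal_distribution \<partial>std_normal_distribution) =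
      (\<integral>\<^sup>+y. \<integral>\<^sup>+x. ?p y * (?p x * G x y) \<partial>lborel \<partial>lborel)"
    if [measurable]: "case_prod G \<in> borel_measurable (borel \<Otimes>\<^sub>M borel)" for G :: "real \<Rightarrow> real \<Rightarrow> ennreal"
  proof -
    have [measurable (raw)]: "(\<lambda>z. G (f z) (g z)) \<in> borel_measurable N"
      if [measurable]: "f \<in> borel_measurable N" "g \<in> borel_measurable N" for f g and N :: "'z measure"
    proof -
      have "(\<lambda>z. case_prod G (f z, g z)) \<in> borel_measurable N" by measurable
      then show ?thesis by simp
    qed
    have "(\<integral>\<^sup>+y. \<integral>\<^sup>+x. G x y \<partial>std_normal_distribution \<partial>std_normal_distribution) =
        (\<integral>\<^sup>+y. (\<integral>\<^sup>+x. ?p x * G x y \<partial>lborel) \<partial>std_normal_distribution)"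
      by (intro nn_integral_cong nn_integral_density) measurable
    also have "\<dots> = (\<integral>\<^sup>+y. ?p y * (\<integral>\<^sup>+x. ?p x * G x y \<partial>lborel) \<partial>lborel)"
      by (intro nn_integral_density) measurable
    also have "\<dots> = (\<integral>\<^sup>+y. \<integral>\<^sup>+x. ?p y * (?p x * G x y) \<partial>lborel \<partial>lborel)"
      by (intro nn_integral_cong nn_integral_cmult[symmetric]) measurable
    finally show ?thesis .
  qed
  have "(\<integral>\<^sup>+y. \<integral>\<^sup>+x. F ((x + y) / sqrt 2) ((x - y) / sqrt 2) \<partial>std_normal_distribution \<partial>std_normal_distribution) =
      (\<integral>\<^sup>+y. \<integral>\<^sup>+x. ?p y * (?p x * F ((x + y) / sqrt 2) ((x - y) / sqrt 2)) \<partial>lborel \<partial>lborel)"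
    by (rule dens) measurable
  also have "\<dots> = (\<integral>\<^sup>+y. ennreal (sqrt 2) * (\<integral>\<^sup>+s. ?p y * (?p (- y + sqrt 2 * s) * F s (s - sqrt 2 * y)) \<partial>lborel) \<partial>lborel)"
  proof (rule nn_integral_cong)
    fix y :: real
    have eq: "(- y + sqrt 2 * s + y) / sqrt 2 = s" "(- y + sqrt 2 * s - y) / sqrt 2 = s - sqrt 2 * y" for s
      by (auto simp: field_simps) (simp add: mult.assoc[symmetric])?
    show "(\<integral>\<^sup>+x. ?p y * (?p x * F ((x + y) / sqrt 2) ((x - y) / sqrt 2)) \<partial>lborel) =
        ennreal (sqrt 2) * (\<integral>\<^sup>+s. ?p y * (?p (- y + sqrt 2 * s) * F s (s - sqrt 2 * y)) \<partial>lborel)"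
      using nn_integral_real_affine[of "\<lambda>x. ?p y * (?p x * F ((x + y) / sqrt 2) ((x - y) / sqrt 2))" "sqrt 2" "- y"]
      unfolding eq by (simp del: minus_add_distrib)
  qed
  also have "\<dots> = (\<integral>\<^sup>+y. \<integral>\<^sup>+s. ennreal (sqrt 2) * (?p y * (?p (- y + sqrt 2 * s) * F s (s - sqrt 2 * y))) \<partial>lborel \<partial>lborel)"
    by (intro nn_integral_cong nn_integral_cmult[symmetric]) measurable
  also have "\<dots> = (\<integral>\<^sup>+s. \<integral>\<^sup>+y. ennreal (sqrt 2) * (?p y * (?p (- y + sqrt 2 * s) * F s (s - sqrt 2 * y))) \<partial>lborel \<partial>lborel)"
    by (rule lborel_pair.Fubini') measurable
  also have "\<dots> = (\<integral>\<^sup>+s. \<integral>\<^sup>+t. ?p t * (?p s * F s t) \<partial>lborel \<partial>lborel)"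
  proof (rule nn_integral_cong)
    fix s :: real
    have eq: "s / sqrt 2 + - (1 / sqrt 2) * t = (s - t) / sqrt 2"
      "s - sqrt 2 * ((s - t) / sqrt 2) = t"
      "- ((s - t) / sqrt 2) + sqrt 2 * s = (s + t) / sqrt 2" for t
      by (auto simp: field_simps)
    have pp: "?p ((s - t) / sqrt 2) * ?p ((s + t) / sqrt 2) = ?p t * ?p s" for t
    proof -
      have "((s - t) / sqrt 2)\<^sup>2 + ((s + t) / sqrt 2)\<^sup>2 = t\<^sup>2 + s\<^sup>2"
        by (simp add: power_divide power2_eq_square field_simps)
      then have "exp (- ((s - t) / sqrt 2)\<^sup>2 / 2) * exp (- ((s + t) / sqrt 2)\<^sup>2 / 2) = exp (- t\<^sup>2 / 2) * exp (- s\<^sup>2 / 2)"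
        unfolding exp_add[symmetric] by (intro arg_cong[where f=exp]) linarith
      then have "std_normal_density ((s - t) / sqrt 2) * std_normal_density ((s + t) / sqrt 2) =
          std_normal_density t * std_normal_density s"
        by (simp add: std_normal_density_def)
      then show ?thesis by (simp add: ennreal_mult[symmetric])
    qed
    have "(\<integral>\<^sup>+y. ennreal (sqrt 2) * (?p y * (?p (- y + sqrt 2 * s) * F s (s - sqrt 2 * y))) \<partial>lborel) =
        ennreal (1 / sqrt 2) * (\<integral>\<^sup>+t. ennreal (sqrt 2) * (?p ((s - t) / sqrt 2) * (?p ((s + t) / sqrt 2) * F s t)) \<partial>lborel)"
      using nn_integral_real_affine[of "\<lambda>y. ennreal (sqrt 2) * (?p y * (?p (- y + sqrt 2 * s) * F s (s - sqrt 2 * y)))"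
          "- (1 / sqrt 2)" "s / sqrt 2"]
      unfolding eq by simp
    also have "\<dots> = (\<integral>\<^sup>+t. ennreal (1 / sqrt 2) * (ennreal (sqrt 2) * (?p t * ?p s * F s t)) \<partial>lborel)"
      by (subst nn_integral_cmult[symmetric]) (auto simp: mult.assoc[symmetric] pp)
    also have "\<dots> = (\<integral>\<^sup>+t. ?p t * (?p s * F s t) \<partial>lborel)"
      by (simp add: mult.assoc[symmetric] ennreal_mult[symmetric])
    finally show "(\<integral>\<^sup>+y. ennreal (sqrt 2) * (?p y * (?p (- y + sqrt 2 * s) * F s (s - sqrt 2 * y))) \<partial>lborel) =
        (\<integral>\<^sup>+t. ?p t * (?p s * F s t) \<partial>lborel)" .
  qed
  also have "\<dots> = (\<integral>\<^sup>+t. \<integral>\<^sup>+s. ?p t * (?p s * F s t) \<partial>lborel \<partial>lborel)"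
    by (rule lborel_pair.Fubini') measurable
  also have "\<dots> = (\<integral>\<^sup>+y. \<integral>\<^sup>+x. F x y \<partial>std_normal_distribution \<partial>std_normal_distribution)"
    by (rule dens[symmetric]) measurable
  finally show ?thesis .
qed

section \<open>The Brownian bridge as a product of rotations\<close>

definition measure_preserving_map :: "'a measure \<Rightarrow> ('a \<Rightarrow> 'a) \<Rightarrow> bool" where
  "measure_preserving_map M f \<longleftrightarrow> f \<in> measurable M M \<and> distr M M f = M"

lemma measure_preserving_map_ident: "measure_preserving_map M (\<lambda>x. x)"
  by (simp add: measure_preserving_map_def)

lemma measure_preserving_map_comp:
  assumes "measure_preserving_map M f" "measure_preserving_map M g"
  shows "measure_preserving_map M (\<lambda>x. f (g x))"
proof -
  have f: "f \<in> measurable M M" "distr M M f = M" and g: "g \<in> measurable M M" "distr M M g = M"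
    using assms by (auto simp: measure_preserving_map_def)
  have "distr M M (f \<circ> g) = distr (distr M M g) M f"
    by (rule distr_distr[symmetric, OF f(1) g(1)])
  then show ?thesis
    using f g by (auto simp: measure_preserving_map_def comp_def intro: measurable_compose)
qed

text \<open>One midpoint refinement in normalised form: before, \<open>a\<close> holds the increment
  over an interval and \<open>b\<close> the fresh Gaussian; after, they hold the increments over its
  left and right half. The map is orthogonal and its own inverse, strictly speaking a
  reflection.\<close>

definition rotate45 :: "'i \<Rightarrow> 'i \<Rightarrow> ('i \<Rightarrow> real) \<Rightarrow> 'i \<Rightarrow> real" where
  "rotate45 a b y = y(b := (y a - y b) / sqrt 2, a := (y a + y b) / sqrt 2)"

text \<open>With \<open>a\<close> and \<open>b\<close> peeled off as the two innermost integrals,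
  the planar invariance applies for each fixed value of the other coordinates, whose laws may be
  arbitrary.\<close>

lemma measure_preserving_rotate45:
  assumes M: "\<And>i. prob_space (M i)" and sets_M: "\<And>i. sets (M i) = sets borel"
    and I: "finite I" "a \<in> I" "b \<in> I" "a \<noteq> b"
    and gauss: "M a = std_normal_distribution" "M b = std_normal_distribution"
  shows "measure_preserving_map (PiM I M) (rotate45 a b)"
proof -
  interpret product_prob_space M using M by (rule product_prob_spaceI)
  define J where "J = I - {a, b}"
  have J: "finite J" "b \<notin> J" "a \<notin> insert b J" and I_eq: "I = insert a (insert b J)"
    using I by (auto simp: J_def)
  have [measurable_cong]: "sets (M i) = sets borel" for i by (rule sets_M)
  have rot: "rotate45 a b \<in> measurable (PiM I M) (PiM I M)"
    unfolding rotate45_def[abs_def] using I by (intro measurable_fun_upd[where J="I"]) (auto intro!: measurable_fun_upd[where J="I"])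
  have "distr (PiM I M) (PiM I M) (rotate45 a b) = PiM I M"
  proof (rule measure_eqI)
    fix X assume "X \<in> sets (distr (PiM I M) (PiM I M) (rotate45 a b))"
    then have X[measurable]: "X \<in> sets (PiM I M)" by simp
    have iter: "(\<integral>\<^sup>+y. f y \<partial>PiM I M) =
        (\<integral>\<^sup>+x. \<integral>\<^sup>+t. \<integral>\<^sup>+s. f (x(b := t, a := s)) \<partial>std_normal_distribution \<partial>std_normal_distribution \<partial>PiM J M)"
      if f: "f \<in> borel_measurable (PiM I M)" for f :: "('a \<Rightarrow> real) \<Rightarrow> ennreal"
    proof -
      have f': "f \<in> borel_measurable (PiM (insert a (insert b J)) M)" using f by (simp add: I_eq)
      have "(\<lambda>x. \<integral>\<^sup>+s. f (x(a := s)) \<partial>M a) \<in> borel_measurable (PiM (insert b J) M)"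
      proof -
        have "(\<lambda>(x, s). f (x(a := s))) \<in> borel_measurable (PiM (insert b J) M \<Otimes>\<^sub>M M a)"
          using measurable_compose[OF measurable_add_dim f'] by (simp add: case_prod_beta')
        then show ?thesis by measurable
      qed
      then show ?thesis
        unfolding I_eq using J f'
        by (subst product_nn_integral_insert, simp, simp, simp)
          (subst product_nn_integral_insert, auto simp: gauss)
    qed
    have "emeasure (distr (PiM I M) (PiM I M) (rotate45 a b)) X =
        (\<integral>\<^sup>+y. indicator X (rotate45 a b y) \<partial>PiM I M)"
    proof -
      have "emeasure (distr (PiM I M) (PiM I M) (rotate45 a b)) X =
          (\<integral>\<^sup>+y. indicator (rotate45 a b -` X \<inter> space (PiM I M)) y \<partial>PiM I M)"
        by (simp only: emeasure_distr[OF rot X] nn_integral_indicator[OF measurable_sets[OF rot X]])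
      also have "\<dots> = (\<integral>\<^sup>+y. indicator X (rotate45 a b y) \<partial>PiM I M)"
        by (rule nn_integral_cong) (auto simp: indicator_def)
      finally show ?thesis .
    qed
    also have "\<dots> = (\<integral>\<^sup>+x. \<integral>\<^sup>+t. \<integral>\<^sup>+s. indicator X (rotate45 a b (x(b := t, a := s)))
        \<partial>std_normal_distribution \<partial>std_normal_distribution \<partial>PiM J M)"
      by (intro iter measurable_compose[OF rot borel_measurable_indicator[OF X]])
    also have "\<dots> = (\<integral>\<^sup>+x. \<integral>\<^sup>+t. \<integral>\<^sup>+s. indicator X (x(b := t, a := s))
        \<partial>std_normal_distribution \<partial>std_normal_distribution \<partial>PiM J M)"
    proof (rule nn_integral_cong)
      fix x assume x: "x \<in> space (PiM J M)"
      define F where "F s t = (indicator X (x(b := t, a := s)) :: ennreal)" for s t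
      have "(\<lambda>(s, t). x(b := t, a := s)) \<in> measurable (borel \<Otimes>\<^sub>M borel) (PiM I M)"
        unfolding case_prod_beta'
      proof (rule measurable_fun_upd[where J="insert b J"])
        show "(\<lambda>p. x(b := snd p)) \<in> measurable (borel \<Otimes>\<^sub>M borel) (PiM (insert b J) M)"
          by (rule measurable_fun_upd[where J=J]) (use x in measurable)
      qed (auto simp: I_eq)
      from measurable_compose[OF this borel_measurable_indicator[OF X]]
      have "case_prod F \<in> borel_measurable (borel \<Otimes>\<^sub>M borel)"
        by (simp add: F_def case_prod_beta')
      from nn_integral_std_normal_rotation[OF this]
      show "(\<integral>\<^sup>+t. \<integral>\<^sup>+s. indicator X (rotate45 a b (x(b := t, a := s)))
          \<partial>std_normal_distribution \<partial>std_normal_distribution) =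
        (\<integral>\<^sup>+t. \<integral>\<^sup>+s. indicator X (x(b := t, a := s)) \<partial>std_normal_distribution \<partial>std_normal_distribution)"
        using I(4) by (simp add: F_def rotate45_def fun_upd_twist)
    qed
    also have "\<dots> = emeasure (PiM I M) X"
      by (subst iter[symmetric]) auto
    finally show "emeasure (distr (PiM I M) (PiM I M) (rotate45 a b)) X = emeasure (PiM I M) X" .
  qed simp
  with rot show ?thesis by (simp add: measure_preserving_map_def)
qed

text \<open>\<open>bridge_slot l j\<close> is the coordinate that carries the normalised increment over the \<open>j\<close>-th
  interval of level \<open>l\<close> once the bridge is refined in place; coordinate 1 is left to the initial
  value, so that \<open>v k\<close> sits at coordinate \<open>k + 1\<close>.\<close>

primrec bridge_slot :: "nat \<Rightarrow> nat \<Rightarrow> nat" where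
  "bridge_slot 0 j = 2"
| "bridge_slot (Suc l) j = (if even j then bridge_slot l (j div 2) else 2 ^ l + j div 2 + 2)"

text \<open>\<open>bridge_value\<close> counts the intervals of a round from 1 and feeds
  \<open>v (2 ^ l + i)\<close> to the \<open>i\<close>-th. With \<open>k = i - 1\<close> and one
  more place for the initial value, this input sits at coordinate
  \<open>2 ^ l + k + 2\<close>.\<close>

primrec rotate_level :: "nat \<Rightarrow> nat \<Rightarrow> (nat \<Rightarrow> real) \<Rightarrow> nat \<Rightarrow> real" where
  "rotate_level l 0 y = y"
| "rotate_level l (Suc k) y = rotate45 (bridge_slot l k) (2 ^ l + k + 2) (rotate_level l k y)"

text \<open>The synthesis direction of the Haar wavelet transform, carried out in place: the bridge
  inputs are the coefficients, and the outcome at level \<open>l\<close> consists of the normalised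
  path increments of that level.\<close>

primrec haar_transform :: "nat \<Rightarrow> (nat \<Rightarrow> real) \<Rightarrow> nat \<Rightarrow> real" where
  "haar_transform 0 y = y"
| "haar_transform (Suc l) y = rotate_level l (2 ^ l) (haar_transform l y)"

section \<open>Slots and sweeps of the Haar transform\<close>

lemma bridge_slot_bounds:
  assumes "j < 2 ^ l"
  shows "2 \<le> bridge_slot l j" "bridge_slot l j < 2 ^ l + 2"
  using assms
proof (induction l arbitrary: j)
  case (Suc l)
  {
    case 1
    then have "j div 2 < 2 ^ l" by auto
    then show ?case using Suc.IH by simp
  next
    case 2
    then have "j div 2 < 2 ^ l" by auto
    then show ?case using Suc.IH(2)[of "j div 2"] by auto
  }
qed auto

text \<open>Even children inherit a slot below \<open>2 ^ l + 2\<close>, odd children receive a new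
  one from there on. The slot thus reveals the parity, and then, by induction or by its value, the
  half index.\<close>

lemma bridge_slot_inj: "inj_on (bridge_slot l) {..<2 ^ l}"
proof (induction l)
  case (Suc l)
  show ?case
  proof (rule inj_onI)
    fix i j assume ij: "i \<in> {..<2 ^ Suc l}" "j \<in> {..<2 ^ Suc l}"
      and eq: "bridge_slot (Suc l) i = bridge_slot (Suc l) j"
    have half: "i div 2 < 2 ^ l" "j div 2 < 2 ^ l" using ij by auto
    note b = bridge_slot_bounds[OF half(1)] bridge_slot_bounds[OF half(2)]
    have "even i = even j \<and> i div 2 = j div 2"
      using eq b inj_onD[OF Suc.IH, of "i div 2" "j div 2"] half by (auto split: if_splits)
    then show "i = j" by (metis bit_eq_rec)
  qed
qed (auto simp: inj_on_def)

lemma bridge_slot_bij: "bij_betw (bridge_slot l) {..<2 ^ l} {2..<2 ^ l + 2}"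
  unfolding bij_betw_def
proof
  show "bridge_slot l ` {..<2 ^ l} = {2..<2 ^ l + 2}"
  proof (rule card_subset_eq)
    show "bridge_slot l ` {..<2 ^ l} \<subseteq> {2..<2 ^ l + 2}"
      using bridge_slot_bounds[of _ l] by (intro image_subsetI) (simp del: add_2_eq_Suc')
  qed (simp_all add: card_image[OF bridge_slot_inj])
qed (rule bridge_slot_inj)

lemma rotate_level_other:
  assumes "i \<notin> bridge_slot l ` {..<k}" "i < 2 ^ l + 2 \<or> 2 ^ l + k + 2 \<le> i"
  shows "rotate_level l k y i = y i"
  using assms by (induction k) (auto simp: rotate45_def lessThan_Suc)

text \<open>The coordinate pairs of one level are disjoint, so each rotation still reads the values
  from before the sweep.\<close>

lemma rotate_level_slot:
  assumes "k \<le> 2 ^ l" "j < k"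
  shows "rotate_level l k y (bridge_slot l j) = (y (bridge_slot l j) + y (2 ^ l + j + 2)) / sqrt 2 \<and>
    rotate_level l k y (2 ^ l + j + 2) = (y (bridge_slot l j) - y (2 ^ l + j + 2)) / sqrt 2"
  using assms
proof (induction k)
  case (Suc k)
  have sk: "bridge_slot l k < 2 ^ l + 2" using bridge_slot_bounds(2) Suc.prems by simp
  show ?case
  proof (cases "j = k")
    case True
    have "bridge_slot l k \<notin> bridge_slot l ` {..<k}"
      using inj_on_image_mem_iff[OF bridge_slot_inj, of k l "{..<k}"] Suc.prems by auto
    then have "rotate_level l k y (bridge_slot l k) = y (bridge_slot l k)"
      using sk by (intro rotate_level_other) auto
    moreover have "2 ^ l + k + 2 \<notin> bridge_slot l ` {..<k}"
    proof
      assume "2 ^ l + k + 2 \<in> bridge_slot l ` {..<k}"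
      then obtain i where "i < k" "2 ^ l + k + 2 = bridge_slot l i" by auto
      then show False using bridge_slot_bounds(2)[of i l] Suc.prems by simp
    qed
    then have "rotate_level l k y (2 ^ l + k + 2) = y (2 ^ l + k + 2)"
      by (intro rotate_level_other) auto
    ultimately show ?thesis using True sk by (auto simp: rotate45_def)
  next
    case False
    then have jk: "j < k" "k \<le> 2 ^ l" using Suc.prems by auto
    have "bridge_slot l j \<noteq> bridge_slot l k"
      using inj_onD[OF bridge_slot_inj, of l j k] False Suc.prems jk by auto
    moreover have "bridge_slot l j < 2 ^ l + 2" using bridge_slot_bounds(2) jk by simp
    ultimately show ?thesis using Suc.IH[OF jk(2,1)] jk sk by (auto simp: rotate45_def)
  qed
qed simp

lemma haar_transform_later:
  assumes "2 ^ l + 2 \<le> i"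
  shows "haar_transform l y i = y i"
  using assms
proof (induction l)
  case (Suc l)
  have "i \<notin> bridge_slot l ` {..<2 ^ l}" using bridge_slot_bounds(2) Suc.prems by fastforce
  then show ?case using Suc by (simp add: rotate_level_other)
qed simp

lemma haar_transform_one: "haar_transform l y (Suc 0) = y (Suc 0)"
proof (induction l)
  case (Suc l)
  have "Suc 0 \<notin> bridge_slot l ` {..<2 ^ l}" using bridge_slot_bounds(1) by fastforce
  then show ?case using Suc by (simp add: rotate_level_other)
qed simp

text \<open>If an interval of length r has normalised increment \<delta>, the midpoint rule with
  input v gives the halves sqrt r / 2 * (\<delta> + v) and sqrt r / 2 * (\<delta> - v). Divided by
  the new scale sqrt (r / 2) these are (\<delta> + v) / sqrt 2 and (\<delta> - v) / sqrt 2, which is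
  one \<open>rotate45\<close>.\<close>

lemma bridge_value_increment:
  assumes "T > 0" "j < 2 ^ l"
  shows "bridge_value T (\<lambda>k. y (k + 1)) l (Suc j) - bridge_value T (\<lambda>k. y (k + 1)) l j =
    sqrt (T / 2 ^ l) * haar_transform l y (bridge_slot l j)"
  using assms(2)
proof (induction l arbitrary: j)
  case 0
  then show ?case by (simp add: numeral_2_eq_2)
next
  case (Suc l)
  define i where "i = j div 2"
  have i: "i < 2 ^ l" using Suc.prems by (auto simp: i_def)
  let ?w = "bridge_value T (\<lambda>k. y (k + 1)) l"
  let ?\<delta> = "haar_transform l y (bridge_slot l i)" and ?v = "y (2 ^ l + i + 2)"
  have IH: "?w (Suc i) - ?w i = sqrt (T / 2 ^ l) * ?\<delta>" by (rule Suc.IH[OF i])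
  have later: "haar_transform l y (2 ^ l + i + 2) = ?v" by (rule haar_transform_later) simp
  have node: "dyadic_node T l (Suc i) - dyadic_node T l i = T / 2 ^ l"
    by (simp add: dyadic_node_def field_simps)
  have mid: "bridge_value T (\<lambda>k. y (k + 1)) (Suc l) (Suc (2 * i)) =
      1 / 2 * (?w i + ?w (Suc i)) + 1 / 2 * sqrt (T / 2 ^ l) * ?v"
    by (simp add: Let_def node)
  have scale: "sqrt (T / 2 ^ Suc l) / sqrt 2 = sqrt (T / 2 ^ l) / 2"
  proof -
    have "sqrt (T / 2 ^ Suc l) / sqrt 2 = sqrt ((T / 2 ^ l) / 4)"
      unfolding real_sqrt_divide[symmetric] by simp
    then show ?thesis by (simp only: real_sqrt_divide real_sqrt_four)
  qed
  have rot: "haar_transform (Suc l) y (bridge_slot l i) = (?\<delta> + ?v) / sqrt 2"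
    "haar_transform (Suc l) y (2 ^ l + i + 2) = (?\<delta> - ?v) / sqrt 2"
    using rotate_level_slot[of "2 ^ l" l i "haar_transform l y"] i later by auto
  consider "j = 2 * i" | "j = Suc (2 * i)" unfolding i_def by (metis odd_two_times_div_two_succ even_two_times_div_two Suc_eq_plus1)
  then show ?case
  proof cases
    case 1
    have "bridge_value T (\<lambda>k. y (k + 1)) (Suc l) (Suc j) - bridge_value T (\<lambda>k. y (k + 1)) (Suc l) j =
        sqrt (T / 2 ^ l) / 2 * (?\<delta> + ?v)"
      unfolding 1 mid using IH by (simp add: field_simps)
    also have "\<dots> = sqrt (T / 2 ^ Suc l) * haar_transform (Suc l) y (bridge_slot l i)"
      unfolding rot scale[symmetric] by simp
    finally show ?thesis using 1 by simp
  next
    case 2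
    have e: "bridge_value T (\<lambda>k. y (k + 1)) (Suc l) (Suc (Suc (2 * i))) = ?w (Suc i)" by simp
    have "bridge_value T (\<lambda>k. y (k + 1)) (Suc l) (Suc j) - bridge_value T (\<lambda>k. y (k + 1)) (Suc l) j =
        sqrt (T / 2 ^ l) / 2 * (?\<delta> - ?v)"
      unfolding 2 mid e using IH by (simp add: field_simps)
    also have "\<dots> = sqrt (T / 2 ^ Suc l) * haar_transform (Suc l) y (2 ^ l + i + 2)"
      unfolding rot scale[symmetric] by simp
    finally show ?thesis using 2 by simp
  qed
qed

text \<open>All slots are at least 2, so the rotations meet Gaussian coordinates, while coordinate 1
  keeps the law of the initial value.\<close>

lemma measure_preserving_haar_transform:
  assumes M: "\<And>i. prob_space (M i)" "\<And>i. sets (M i) = sets borel"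
    and gauss: "\<And>i. 2 \<le> i \<Longrightarrow> M i = std_normal_distribution" and "l \<le> d"
  shows "measure_preserving_map (PiM {1..2 ^ d + 1} M) (haar_transform l)"
  using assms(4)
proof (induction l)
  case 0
  have "haar_transform 0 = (\<lambda>y. y)" by (rule ext) simp
  then show ?case using measure_preserving_map_ident by metis
next
  case (Suc l)
  have "2 ^ Suc l \<le> (2 :: nat) ^ d" by (rule power_increasing) (use Suc.prems in auto)
  \<comment> \<open>The largest coordinate touched at level \<open>l\<close> is
    \<open>2 ^ l + 2 ^ l + 1\<close>, so this keeps the sweep inside the index set.\<close>
  then have d: "2 ^ l + 2 ^ l \<le> (2 :: nat) ^ d" by simp
  have "measure_preserving_map (PiM {1..2 ^ d + 1} M) (rotate_level l k)" if "k \<le> 2 ^ l" for k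
    using that
  proof (induction k)
    case (Suc k)
    have eq: "rotate_level l (Suc k) = (\<lambda>y. rotate45 (bridge_slot l k) (2 ^ l + k + 2) (rotate_level l k y))"
      by (rule ext) simp
    have "measure_preserving_map (PiM {1..2 ^ d + 1} M) (rotate45 (bridge_slot l k) (2 ^ l + k + 2))"
      using bridge_slot_bounds[of k l] Suc.prems d
      by (intro measure_preserving_rotate45 M gauss) auto
    from measure_preserving_map_comp[OF this Suc.IH] Suc.prems show ?case unfolding eq by simp
  next
    case 0
    have "rotate_level l 0 = (\<lambda>y. y)" by (rule ext) simp
    then show ?case using measure_preserving_map_ident by metis
  qed
  moreover have "haar_transform (Suc l) = (\<lambda>y. rotate_level l (2 ^ l) (haar_transform l y))"
    by (rule ext) simp
  ultimately show ?case
    using measure_preserving_map_comp[where f="rotate_level l (2 ^ l)" and g="haar_transform l"] Suc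
    by simp
qed

lemma tendsto_haar_transform:
  assumes "\<And>i. ((\<lambda>n. y n i) \<longlongrightarrow> z i) F"
  shows "((\<lambda>n. haar_transform l (y n) i) \<longlongrightarrow> haar_transform l z i) F"
proof (induction l arbitrary: i)
  case (Suc l)
  have "((\<lambda>n. rotate_level l k (haar_transform l (y n)) i) \<longlongrightarrow> rotate_level l k (haar_transform l z) i) F" for k i
  proof (induction k arbitrary: i)
    case 0
    then show ?case using Suc by simp
  next
    case (Suc k)
    show ?case by (auto simp: rotate45_def intro!: tendsto_intros Suc)
  qed
  then show ?case by simp
qed (simp add: assms)

section \<open>Particle averages\<close>

text \<open>At \<open>P = 0\<close> the value is 0 by the convention for division, which explains
  the sign condition in \<open>average_le_const\<close> and the positivity in
  \<open>average_const\<close>.\<close>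

definition average :: "nat \<Rightarrow> (nat \<Rightarrow> real) \<Rightarrow> real" where
  "average P f = 1 / real P * (\<Sum>j=1..P. f j)"

lemma average_mono: "(\<And>j. f j \<le> g j) \<Longrightarrow> average P f \<le> average P g"
  unfolding average_def by (intro mult_left_mono sum_mono) auto

lemma average_add: "average P (\<lambda>j. f j + g j) = average P f + average P g"
  by (simp add: average_def sum.distrib algebra_simps)

lemma average_diff: "average P (\<lambda>j. f j - g j) = average P f - average P g"
  by (simp add: average_def sum_subtractf algebra_simps)

lemma average_cmult: "average P (\<lambda>j. c * f j) = c * average P f"
  by (simp add: average_def sum_distrib_left[symmetric])

lemma average_const: "P > 0 \<Longrightarrow> average P (\<lambda>j. c) = c"
  by (simp add: average_def)

lemma average_nonneg: "(\<And>j. 0 \<le> f j) \<Longrightarrow> 0 \<le> average P f"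
  unfolding average_def by (intro mult_nonneg_nonneg sum_nonneg) auto

lemma average_le_const: "0 \<le> c \<Longrightarrow> (\<And>j. f j \<le> c) \<Longrightarrow> average P f \<le> c"
  by (cases "P = 0") (auto simp: average_def divide_le_eq mult.commute
      intro: order.trans[OF sum_bounded_above[where K=c]])

lemma abs_average_le: "\<bar>average P f\<bar> \<le> average P (\<lambda>j. \<bar>f j\<bar>)"
  unfolding average_def abs_mult by (intro mult_mono sum_abs) auto

text \<open>The form in which A1 and A3 enter the estimates. Measuring distances in the plane by the
  sum norm keeps state and interaction term apart in every bound.\<close>

locale lipschitz_coefficients =
  fixes a \<kappa> :: "real \<times> real \<Rightarrow> real" and A La K Lk :: real
  assumes a_bound: "\<bar>a p\<bar> \<le> A"
    and a_lipschitz: "\<bar>a (x, v) - a (x', v')\<bar> \<le> La * (\<bar>x - x'\<bar> + \<bar>v - v'\<bar>)"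
    and \<kappa>_bound: "\<bar>\<kappa> p\<bar> \<le> K"
    and \<kappa>_lipschitz: "\<bar>\<kappa> (x, v) - \<kappa> (x', v')\<bar> \<le> Lk * (\<bar>x - x'\<bar> + \<bar>v - v'\<bar>)"
begin

lemma A_nonneg: "0 \<le> A"
  using a_bound[of "(0, 0)"] by linarith

lemma K_nonneg: "0 \<le> K"
  using \<kappa>_bound[of "(0, 0)"] by linarith

lemma La_nonneg: "0 \<le> La"
  using a_lipschitz[of 1 0 0 0] by simp

lemma Lk_nonneg: "0 \<le> Lk"
  using \<kappa>_lipschitz[of 1 0 0 0] by simp

lemma continuous_\<kappa>: "continuous_on UNIV (\<lambda>v. \<kappa> (x, v))"
proof (rule lipschitz_on_continuous_on)
  show "Lk-lipschitz_on UNIV (\<lambda>v. \<kappa> (x, v))"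
    using \<kappa>_lipschitz[of x _ x] Lk_nonneg by (auto simp: lipschitz_on_def dist_real_def)
qed

lemma integrable_\<kappa>:
  assumes "prob_space N" and [measurable]: "E \<in> borel_measurable N"
  shows "integrable N (\<lambda>\<omega>. \<kappa> (x, E \<omega>))"
proof -
  interpret N: prob_space N by fact
  show ?thesis
    by (rule N.integrable_const_bound[where B=K])
      (auto simp: \<kappa>_bound intro: borel_measurable_continuous_on[OF continuous_\<kappa>])
qed

lemma mean_\<kappa>_bound:
  assumes "prob_space N" and [measurable]: "E \<in> borel_measurable N"
  shows "\<bar>\<integral>\<omega>. \<kappa> (x, E \<omega>) \<partial>N\<bar> \<le> K"
proof -
  interpret N: prob_space N by fact
  have "\<bar>\<integral>\<omega>. \<kappa> (x, E \<omega>) \<partial>N\<bar> \<le> (\<integral>\<omega>. \<bar>\<kappa> (x, E \<omega>)\<bar> \<partial>N)"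
    by (rule integral_abs_bound)
  also have "\<dots> \<le> (\<integral>\<omega>. K \<partial>N)"
    using integrable_\<kappa>[OF assms, of x] by (intro integral_mono) (auto simp: \<kappa>_bound)
  finally show ?thesis by (simp add: N.prob_space)
qed

text \<open>A coupling bound in the place of a distance between laws: integrability is asked of the
  difference, and \<open>E\<close> and \<open>E'\<close> themselves may lack a first moment.\<close>

lemma mean_\<kappa>_lipschitz:
  assumes "prob_space N" and E: "E \<in> borel_measurable N" "E' \<in> borel_measurable N"
    and D: "integrable N (\<lambda>\<omega>. E \<omega> - E' \<omega>)"
  shows "\<bar>(\<integral>\<omega>. \<kappa> (x, E \<omega>) \<partial>N) - (\<integral>\<omega>. \<kappa> (x', E' \<omega>) \<partial>N)\<bar> \<le> Lk * (\<bar>x - x'\<bar> + (\<integral>\<omega>. \<bar>E \<omega> - E' \<omega>\<bar> \<partial>N))"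
proof -
  interpret N: prob_space N by fact
  note int = integrable_\<kappa>[OF assms(1) E(1), of x] integrable_\<kappa>[OF assms(1) E(2), of x']
  have "\<bar>(\<integral>\<omega>. \<kappa> (x, E \<omega>) \<partial>N) - (\<integral>\<omega>. \<kappa> (x', E' \<omega>) \<partial>N)\<bar> = \<bar>\<integral>\<omega>. \<kappa> (x, E \<omega>) - \<kappa> (x', E' \<omega>) \<partial>N\<bar>"
    using int by simp
  also have "\<dots> \<le> (\<integral>\<omega>. \<bar>\<kappa> (x, E \<omega>) - \<kappa> (x', E' \<omega>)\<bar> \<partial>N)"
    by (rule integral_abs_bound)
  also have "\<dots> \<le> (\<integral>\<omega>. Lk * (\<bar>x - x'\<bar> + \<bar>E \<omega> - E' \<omega>\<bar>) \<partial>N)"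
    using int D by (intro integral_mono) (auto intro: \<kappa>_lipschitz)
  also have "\<dots> = Lk * (\<bar>x - x'\<bar> + (\<integral>\<omega>. \<bar>E \<omega> - E' \<omega>\<bar> \<partial>N))"
    using D by (simp add: N.prob_space)
  finally show ?thesis .
qed

lemma drift_lipschitz:
  assumes "prob_space N" and E: "E \<in> borel_measurable N" "E' \<in> borel_measurable N"
    and D: "integrable N (\<lambda>\<omega>. E \<omega> - E' \<omega>)"
  shows "\<bar>a (x, \<integral>\<omega>. \<kappa> (x, E \<omega>) \<partial>N) - a (x', \<integral>\<omega>. \<kappa> (x', E' \<omega>) \<partial>N)\<bar>
    \<le> La * (1 + Lk) * \<bar>x - x'\<bar> + La * Lk * (\<integral>\<omega>. \<bar>E \<omega> - E' \<omega>\<bar> \<partial>N)"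
proof -
  have "\<bar>a (x, \<integral>\<omega>. \<kappa> (x, E \<omega>) \<partial>N) - a (x', \<integral>\<omega>. \<kappa> (x', E' \<omega>) \<partial>N)\<bar> \<le>
      La * (\<bar>x - x'\<bar> + Lk * (\<bar>x - x'\<bar> + (\<integral>\<omega>. \<bar>E \<omega> - E' \<omega>\<bar> \<partial>N)))"
    by (intro order.trans[OF a_lipschitz] mult_left_mono add_left_mono mean_\<kappa>_lipschitz assms La_nonneg)
  then show ?thesis by (simp add: algebra_simps)
qed

lemma continuous_drift:
  assumes "prob_space N" and E: "E \<in> borel_measurable N"
  shows "continuous_on UNIV (\<lambda>x. a (x, \<integral>\<omega>. \<kappa> (x, E \<omega>) \<partial>N))"
proof (rule lipschitz_on_continuous_on)
  show "(La * (1 + Lk))-lipschitz_on UNIV (\<lambda>x. a (x, \<integral>\<omega>. \<kappa> (x, E \<omega>) \<partial>N))"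
    using drift_lipschitz[OF assms(1) E E] La_nonneg Lk_nonneg
    by (auto simp: lipschitz_on_def dist_real_def)
qed

text \<open>The kernel error \<open>G P x\<close> tends to 0 for fixed \<open>x\<close>, but here
  \<open>x\<close> runs through the particles. As \<open>G P\<close> is Lipschitz in
  \<open>x\<close> with a constant independent of \<open>P\<close>, a finite net makes the
  convergence uniform on a compact interval; outside, \<open>G\<close> is at most 2 K, and weak
  convergence bounds the share of particles there.\<close>

lemma average_kernel_tendsto_zero:
  assumes N: "prob_space N" and E[measurable]: "E \<in> borel_measurable N"
    and weak: "\<And>f. continuous_on UNIV f \<Longrightarrow> bounded (range f) \<Longrightarrow>
      (\<lambda>P. average P (\<lambda>j. f (y j))) \<longlonglongrightarrow> (\<integral>\<omega>. f (E \<omega>) \<partial>N)"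
  shows "(\<lambda>P. average P (\<lambda>p. \<bar>average P (\<lambda>j. \<kappa> (y p, y j)) - (\<integral>\<omega>. \<kappa> (y p, E \<omega>) \<partial>N)\<bar>)) \<longlonglongrightarrow> 0"
proof -
  interpret N: prob_space N by fact
  define G where "G P x = \<bar>average P (\<lambda>j. \<kappa> (x, y j)) - (\<integral>\<omega>. \<kappa> (x, E \<omega>) \<partial>N)\<bar>" for P x
  have G_lim: "(\<lambda>P. G P x) \<longlonglongrightarrow> 0" for x
  proof -
    have "bounded (range (\<lambda>v. \<kappa> (x, v)))"
      using \<kappa>_bound by (auto simp: bounded_iff)
    from tendsto_rabs_zero[OF LIM_zero[OF weak[OF continuous_\<kappa> this]]] show ?thesis
      unfolding G_def .
  qed
  have avg_le: "\<bar>average P (\<lambda>j. \<kappa> (x, y j))\<bar> \<le> K" for P x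
    by (rule order.trans[OF abs_average_le average_le_const]) (auto simp: K_nonneg \<kappa>_bound)
  have G_le: "G P x \<le> 2 * K" for P x
    using avg_le[of P x] mean_\<kappa>_bound[OF N E, of x] unfolding G_def by linarith
  have G_lip: "G P x \<le> G P x' + 2 * Lk * \<bar>x - x'\<bar>" for P x x'
  proof -
    have "\<bar>average P (\<lambda>j. \<kappa> (x, y j)) - average P (\<lambda>j. \<kappa> (x', y j))\<bar> \<le> Lk * \<bar>x - x'\<bar>"
      unfolding average_diff[symmetric]
      using \<kappa>_lipschitz[of x _ x'] Lk_nonneg
      by (intro order.trans[OF abs_average_le average_le_const]) (auto, metis add.right_neutral abs_zero diff_self)
    moreover have "\<bar>(\<integral>\<omega>. \<kappa> (x, E \<omega>) \<partial>N) - (\<integral>\<omega>. \<kappa> (x', E \<omega>) \<partial>N)\<bar> \<le> Lk * \<bar>x - x'\<bar>"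
      using mean_\<kappa>_lipschitz[OF N E E, of x x'] by simp
    ultimately show ?thesis unfolding G_def by linarith
  qed
  \<comment> \<open>A continuous majorant of the indicator of distance more than
    \<open>R + 1\<close> from 0 that vanishes up to distance \<open>R\<close>; being continuous and
    bounded, it is a legitimate test function.\<close>
  define cut where "cut R z = min 1 (max 0 (\<bar>z\<bar> - real R))" for R :: nat and z :: real
  have cut_cont: "continuous_on UNIV (cut R)" for R
    unfolding cut_def by (intro continuous_intros)
  have cut01: "0 \<le> cut R z" "cut R z \<le> 1" for R z by (auto simp: cut_def)
  have cut_lim: "(\<lambda>R. \<integral>\<omega>. cut R (E \<omega>) \<partial>N) \<longlonglongrightarrow> (\<integral>\<omega>. 0 \<partial>N)"
  proof (rule integral_dominated_convergence[where w="\<lambda>_. 1"])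
    show "AE \<omega> in N. (\<lambda>R. cut R (E \<omega>)) \<longlonglongrightarrow> 0"
    proof (rule AE_I2, rule tendsto_eventually)
      fix \<omega>
      obtain R :: nat where "\<bar>E \<omega>\<bar> \<le> real R" using real_arch_simple by blast
      then show "\<forall>\<^sub>F R in sequentially. cut R (E \<omega>) = 0"
        by (auto simp: cut_def eventually_sequentially intro!: exI[of _ R])
    qed
    show "(\<lambda>\<omega>. cut R (E \<omega>)) \<in> borel_measurable N" for R
      by (rule borel_measurable_continuous_on[OF cut_cont E])
  qed (use cut01 in auto)
  show ?thesis
    unfolding G_def[symmetric]
  proof (rule LIMSEQ_I)
    fix r :: real assume r: "0 < r"
    \<comment> \<open>The final bound is 2 \<epsilon> + 2 K \<epsilon>: one \<epsilon> for the error
      at the net point, one for the distance to it, and 2 K for each particle outside, their share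
      measured by \<open>cut\<close> being below \<epsilon>. The last factor 1/2 makes the
      inequality strict.\<close>
    define \<epsilon> where "\<epsilon> = r / (2 + 2 * K) / 2"
    have \<epsilon>: "\<epsilon> > 0" "(2 + 2 * K) * \<epsilon> < r"
    proof -
      have K': "2 + 2 * K > 0" using K_nonneg by linarith
      then show "\<epsilon> > 0" using r by (simp add: \<epsilon>_def)
      have "c * (r / c / 2) = r / 2" if "c > 0" for c :: real using that by simp
      then have "(2 + 2 * K) * \<epsilon> = r / 2" using K' unfolding \<epsilon>_def .
      then show "(2 + 2 * K) * \<epsilon> < r" using r by linarith
    qed
    from cut_lim \<epsilon>(1) have "\<forall>\<^sub>F R in sequentially. (\<integral>\<omega>. cut R (E \<omega>) \<partial>N) < \<epsilon>"
      by (intro order_tendstoD(2)) auto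
    then obtain R where R: "(\<integral>\<omega>. cut R (E \<omega>) \<partial>N) < \<epsilon>"
      by (auto simp: eventually_sequentially)
    \<comment> \<open>Moving to the net point costs at most 2 Lk \<eta>; the added 1 avoids a
      division by 0.\<close>
    define \<eta> where "\<eta> = \<epsilon> / (2 * Lk + 1)"
    have \<eta>: "\<eta> > 0" "2 * Lk * \<eta> \<le> \<epsilon>"
      using \<epsilon>(1) Lk_nonneg by (auto simp: \<eta>_def field_simps)
    have "compact {- (real R + 1)..real R + 1}" by (rule compact_Icc)
    then obtain S where S: "finite S" "{- (real R + 1)..real R + 1} \<subseteq> (\<Union>x\<in>S. ball x \<eta>)"
      using \<eta>(1) unfolding compact_eq_totally_bounded by blast
    have "bounded (range (cut R))"
      using cut01 by (auto simp: bounded_iff intro!: exI[of _ 1])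
    from order_tendstoD(2)[OF weak[OF cut_cont this] R]
    have ev1: "\<forall>\<^sub>F P in sequentially. average P (\<lambda>j. cut R (y j)) < \<epsilon>" .
    have ev2: "\<forall>\<^sub>F P in sequentially. \<forall>x\<in>S. G P x < \<epsilon>"
      using S(1) order_tendstoD(2)[OF G_lim \<epsilon>(1)] by (simp add: eventually_ball_finite)
    have "\<forall>\<^sub>F P in sequentially. norm (average P (\<lambda>p. G P (y p)) - 0) < r"
      using ev1 ev2 eventually_gt_at_top[of 0]
    proof eventually_elim
      case (elim P)
      have "G P (y p) \<le> 2 * \<epsilon> + 2 * K * cut R (y p)" for p
      proof (cases "\<bar>y p\<bar> \<le> real R + 1")
        case True
        then have "y p \<in> {- (real R + 1)..real R + 1}" by auto
        then obtain x where x: "x \<in> S" "\<bar>y p - x\<bar> < \<eta>"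
          using S(2) by (auto simp: dist_real_def abs_minus_commute)
        have "G P (y p) \<le> G P x + 2 * Lk * \<bar>y p - x\<bar>" by (rule G_lip)
        also have "\<dots> \<le> \<epsilon> + 2 * Lk * \<eta>"
          using x elim Lk_nonneg by (intro add_mono mult_left_mono) (auto simp: less_imp_le)
        also have "\<dots> \<le> 2 * \<epsilon>" using \<eta> by simp
        also have "\<dots> \<le> 2 * \<epsilon> + 2 * K * cut R (y p)" using K_nonneg cut01 by simp
        finally show ?thesis .
      next
        case False
        then have "cut R (y p) = 1" by (auto simp: cut_def)
        then show ?thesis using G_le[of P "y p"] \<epsilon>(1) by simp
      qed
      then have "average P (\<lambda>p. G P (y p)) \<le> average P (\<lambda>p. 2 * \<epsilon> + 2 * K * cut R (y p))"
        by (rule average_mono)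
      also have "\<dots> = 2 * \<epsilon> + 2 * K * average P (\<lambda>p. cut R (y p))"
        using elim by (simp add: average_add average_cmult average_const)
      also have "\<dots> \<le> 2 * \<epsilon> + 2 * K * \<epsilon>"
        using elim K_nonneg by (intro add_left_mono mult_left_mono) auto
      also have "\<dots> < r" using \<epsilon>(2) by (simp add: algebra_simps)
      finally show ?case
        using average_nonneg[of "\<lambda>p. G P (y p)" P] by (simp add: G_def)
    qed
    then show "\<exists>no. \<forall>P\<ge>no. norm (average P (\<lambda>p. G P (y p)) - 0) < r"
      by (auto simp: eventually_sequentially)
  qed
qed

text \<open>The interaction error splits in two: replacing the particles by their limits costs
  \<open>Lk\<close> times the own plus the average deviation, and the rest is the kernel error at
  \<open>y p\<close>. Averaging over \<open>p\<close> turns the own deviation into the average one,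
  whence the factor 1 + 2 Lk. The noise is common and cancels.\<close>

lemma particle_step_tendsto_zero:
  assumes N: "prob_space N" and E: "E \<in> borel_measurable N"
    and weak: "\<And>f. continuous_on UNIV f \<Longrightarrow> bounded (range f) \<Longrightarrow>
      (\<lambda>P. average P (\<lambda>j. f (y j))) \<longlonglongrightarrow> (\<integral>\<omega>. f (E \<omega>) \<partial>N)"
    and X: "(\<lambda>P. average P (\<lambda>p. \<bar>X P p - y p\<bar>)) \<longlonglongrightarrow> 0"
    and h: "0 \<le> h"
  shows "(\<lambda>P. average P (\<lambda>p. \<bar>(X P p + a (X P p, average P (\<lambda>j. \<kappa> (X P p, X P j))) * h + \<eta> p)
      - (y p + a (y p, \<integral>\<omega>. \<kappa> (y p, E \<omega>) \<partial>N) * h + \<eta> p)\<bar>)) \<longlonglongrightarrow> 0" (is "(\<lambda>P. average P (?D P)) \<longlonglongrightarrow> 0")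
proof -
  define G where "G P p = \<bar>average P (\<lambda>j. \<kappa> (y p, y j)) - (\<integral>\<omega>. \<kappa> (y p, E \<omega>) \<partial>N)\<bar>" for P p
  define e where "e P p = \<bar>X P p - y p\<bar>" for P p
  have step: "?D P p \<le> e P p + h * (La * (e P p + (Lk * (e P p + average P (e P)) + G P p)))"
    if P: "P > 0" for P p
  proof -
    have "\<bar>average P (\<lambda>j. \<kappa> (X P p, X P j)) - average P (\<lambda>j. \<kappa> (y p, y j))\<bar> \<le>
        average P (\<lambda>j. \<bar>\<kappa> (X P p, X P j) - \<kappa> (y p, y j)\<bar>)"
      unfolding average_diff[symmetric] by (rule abs_average_le)
    also have "\<dots> \<le> average P (\<lambda>j. Lk * (e P p + e P j))"
      unfolding e_def by (intro average_mono \<kappa>_lipschitz)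
    also have "\<dots> = Lk * (e P p + average P (e P))"
      using P by (simp add: average_cmult average_add average_const)
    finally have "\<bar>average P (\<lambda>j. \<kappa> (X P p, X P j)) - (\<integral>\<omega>. \<kappa> (y p, E \<omega>) \<partial>N)\<bar> \<le>
        Lk * (e P p + average P (e P)) + G P p"
      unfolding G_def by linarith
    then have a: "\<bar>a (X P p, average P (\<lambda>j. \<kappa> (X P p, X P j))) - a (y p, \<integral>\<omega>. \<kappa> (y p, E \<omega>) \<partial>N)\<bar> \<le>
        La * (e P p + (Lk * (e P p + average P (e P)) + G P p))" (is "\<bar>?a1 - ?a2\<bar> \<le> ?b")
      using La_nonneg unfolding e_def
      by (intro order.trans[OF a_lipschitz] mult_left_mono add_left_mono) auto
    have "?D P p = \<bar>(X P p - y p) + h * (?a1 - ?a2)\<bar>" by (simp add: algebra_simps)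
    also have "\<dots> \<le> \<bar>X P p - y p\<bar> + h * \<bar>?a1 - ?a2\<bar>"
      using abs_triangle_ineq[of "X P p - y p" "h * (?a1 - ?a2)"] h by (simp add: abs_mult)
    also have "\<dots> \<le> e P p + h * ?b"
      using a h unfolding e_def by (intro add_left_mono mult_left_mono)
    finally show ?thesis .
  qed
  have avg: "average P (?D P) \<le>
      (1 + h * La * (1 + 2 * Lk)) * average P (e P) + h * La * average P (G P)" if P: "P > 0" for P
  proof -
    have "average P (?D P) \<le> average P (\<lambda>p. (1 + h * La * (1 + Lk)) * e P p + (h * La * Lk * average P (e P) + h * La * G P p))"
      using step[OF P] by (intro average_mono) (simp add: algebra_simps)
    also have "\<dots> = (1 + h * La * (1 + 2 * Lk)) * average P (e P) + h * La * average P (G P)"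
      using P by (simp add: average_add average_cmult average_const algebra_simps)
    finally show ?thesis .
  qed
  have "(\<lambda>P. average P (G P)) \<longlonglongrightarrow> 0"
    unfolding G_def by (rule average_kernel_tendsto_zero[OF N E weak])
  moreover have "(\<lambda>P. average P (e P)) \<longlonglongrightarrow> 0"
    unfolding e_def by (rule X)
  ultimately have "(\<lambda>P. (1 + h * La * (1 + 2 * Lk)) * average P (e P) + h * La * average P (G P)) \<longlonglongrightarrow>
      (1 + h * La * (1 + 2 * Lk)) * 0 + h * La * 0"
    by (intro tendsto_intros)
  then have "(\<lambda>P. (1 + h * La * (1 + 2 * Lk)) * average P (e P) + h * La * average P (G P)) \<longlonglongrightarrow> 0"
    by simp
  then show ?thesis
  proof (rule Lim_null_comparison[rotated])
    show "\<forall>\<^sub>F P in sequentially. norm (average P (?D P)) \<le>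
        (1 + h * La * (1 + 2 * Lk)) * average P (e P) + h * La * average P (G P)"
      using eventually_gt_at_top[of 0]
    proof eventually_elim
      case (elim P)
      have "0 \<le> average P (?D P)" by (rule average_nonneg) simp
      then show ?case using avg[OF elim] by simp
    qed
  qed
qed

end

text \<open>The probability space, the initial value and the noise are parameters because the
  recursion is run twice: on the space of the solution, driven by \<open>W\<close>, and on the input
  space, driven by the coordinates. \<open>mean_field_euler_transfer\<close> identifies the
  two.\<close>

primrec mean_field_euler ::
    "(real \<times> real \<Rightarrow> real) \<Rightarrow> (real \<times> real \<Rightarrow> real) \<Rightarrow> real \<Rightarrow> 'a measure \<Rightarrow> ('a \<Rightarrow> real) \<Rightarrow>
     (nat \<Rightarrow> 'a \<Rightarrow> real) \<Rightarrow> nat \<Rightarrow> 'a \<Rightarrow> real" where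
  "mean_field_euler a \<kappa> h N x\<^sub>0 \<eta> 0 \<omega> = x\<^sub>0 \<omega>"
| "mean_field_euler a \<kappa> h N x\<^sub>0 \<eta> (Suc n) \<omega> =
     (let E = mean_field_euler a \<kappa> h N x\<^sub>0 \<eta> n in
        E \<omega> + a (E \<omega>, \<integral>\<omega>'. \<kappa> (E \<omega>, E \<omega>') \<partial>N) * h + \<eta> n \<omega>)"

context lipschitz_coefficients
begin

lemma borel_measurable_mean_field_euler:
  assumes N: "prob_space N" and x0: "x\<^sub>0 \<in> borel_measurable N"
    and \<eta>: "\<And>k. k < n \<Longrightarrow> \<eta> k \<in> borel_measurable N"
  shows "mean_field_euler a \<kappa> h N x\<^sub>0 \<eta> n \<in> borel_measurable N"
  using \<eta>
proof (induction n)
  case 0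
  have "mean_field_euler a \<kappa> h N x\<^sub>0 \<eta> 0 = x\<^sub>0" by (rule ext) simp
  then show ?case using x0 by simp
next
  case (Suc n)
  define E where "E = mean_field_euler a \<kappa> h N x\<^sub>0 \<eta> n"
  have E[measurable]: "E \<in> borel_measurable N" unfolding E_def using Suc by simp
  have [measurable]: "\<eta> n \<in> borel_measurable N" using Suc by simp
  have [measurable]: "(\<lambda>\<omega>. a (E \<omega>, \<integral>\<omega>'. \<kappa> (E \<omega>, E \<omega>') \<partial>N)) \<in> borel_measurable N"
    by (rule borel_measurable_continuous_on[OF continuous_drift[OF N E] E])
  have "mean_field_euler a \<kappa> h N x\<^sub>0 \<eta> (Suc n) =
      (\<lambda>\<omega>. E \<omega> + a (E \<omega>, \<integral>\<omega>'. \<kappa> (E \<omega>, E \<omega>') \<partial>N) * h + \<eta> n \<omega>)"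
    by (rule ext) (simp add: E_def Let_def)
  then show ?case by simp
qed

text \<open>The law inside the drift belongs to \<open>N\<close> and does not move with the
  evaluation point, so each step is a fixed continuous function of the previous state plus the
  noise.\<close>

lemma tendsto_mean_field_euler:
  assumes N: "prob_space N" and x0: "x\<^sub>0 \<in> borel_measurable N"
    and \<eta>: "\<And>k. k < n \<Longrightarrow> \<eta> k \<in> borel_measurable N"
    and x0_lim: "((\<lambda>i. x\<^sub>0 (y i)) \<longlongrightarrow> x\<^sub>0 z) F"
    and \<eta>_lim: "\<And>k. k < n \<Longrightarrow> ((\<lambda>i. \<eta> k (y i)) \<longlongrightarrow> \<eta> k z) F"
  shows "((\<lambda>i. mean_field_euler a \<kappa> h N x\<^sub>0 \<eta> n (y i)) \<longlongrightarrow> mean_field_euler a \<kappa> h N x\<^sub>0 \<eta> n z) F"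
  using \<eta> \<eta>_lim
proof (induction n)
  case (Suc n)
  define E where "E = mean_field_euler a \<kappa> h N x\<^sub>0 \<eta> n"
  have E: "E \<in> borel_measurable N" unfolding E_def
    by (rule borel_measurable_mean_field_euler[OF N x0]) (use Suc in auto)
  have lim: "((\<lambda>i. E (y i)) \<longlongrightarrow> E z) F" unfolding E_def using Suc by simp
  have "((\<lambda>i. a (E (y i), \<integral>\<omega>'. \<kappa> (E (y i), E \<omega>') \<partial>N)) \<longlongrightarrow> a (E z, \<integral>\<omega>'. \<kappa> (E z, E \<omega>') \<partial>N)) F"
    by (rule continuous_on_tendsto_compose[OF continuous_drift[OF N E] lim]) auto
  moreover have "((\<lambda>i. \<eta> n (y i)) \<longlongrightarrow> \<eta> n z) F" using Suc by simp
  ultimately show ?case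
    using lim by (simp add: E_def[symmetric] Let_def tendsto_intros)
qed (simp add: x0_lim)

text \<open>A deterministic statement about one input sequence \<open>y\<close>. Weak convergence is
  assumed at all times up to \<open>n\<close>, since the kernel error of each step involves the
  empirical measure at the time of that step.\<close>

lemma particle_system_tendsto:
  assumes N: "prob_space N" and x0: "x\<^sub>0 \<in> borel_measurable N"
    and \<eta>: "\<And>k. k < n \<Longrightarrow> \<eta> k \<in> borel_measurable N"
    and h: "0 \<le> h"
    and weak: "\<And>k f. k \<le> n \<Longrightarrow> continuous_on UNIV f \<Longrightarrow> bounded (range f) \<Longrightarrow>
      (\<lambda>P. average P (\<lambda>j. f (mean_field_euler a \<kappa> h N x\<^sub>0 \<eta> k (y j)))) \<longlonglongrightarrow>
        (\<integral>\<omega>. f (mean_field_euler a \<kappa> h N x\<^sub>0 \<eta> k \<omega>) \<partial>N)"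
    and X0: "\<And>P p. X P 0 p = x\<^sub>0 (y p)"
    and X_Suc: "\<And>P k p. k < n \<Longrightarrow> X P (Suc k) p =
      X P k p + a (X P k p, average P (\<lambda>j. \<kappa> (X P k p, X P k j))) * h + \<eta> k (y p)"
    and g: "bounded (range g)" "Lg-lipschitz_on UNIV g"
  shows "(\<lambda>P. average P (\<lambda>p. g (X P n p))) \<longlonglongrightarrow>
    (\<integral>\<omega>. g (mean_field_euler a \<kappa> h N x\<^sub>0 \<eta> n \<omega>) \<partial>N)"
proof -
  let ?E = "mean_field_euler a \<kappa> h N x\<^sub>0 \<eta>"
  have X: "(\<lambda>P. average P (\<lambda>p. \<bar>X P k p - ?E k (y p)\<bar>)) \<longlonglongrightarrow> 0" if "k \<le> n" for k
    using that
  proof (induction k)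
    case 0
    then show ?case by (simp add: X0 average_def)
  next
    case (Suc k)
    then have k: "k < n" by simp
    have E: "?E k \<in> borel_measurable N"
      by (rule borel_measurable_mean_field_euler[OF N x0]) (use \<eta> k in auto)
    have "(\<lambda>P. average P (\<lambda>p. \<bar>(X P k p + a (X P k p, average P (\<lambda>j. \<kappa> (X P k p, X P k j))) * h + \<eta> k (y p))
      - (?E k (y p) + a (?E k (y p), \<integral>\<omega>. \<kappa> (?E k (y p), ?E k \<omega>) \<partial>N) * h + \<eta> k (y p))\<bar>)) \<longlonglongrightarrow> 0"
      by (rule particle_step_tendsto_zero[OF N E _ _ h]) (use k weak Suc in auto)
    then show ?case by (simp add: X_Suc[OF k] Let_def)
  qed
  have Lg: "\<bar>g x - g x'\<bar> \<le> Lg * \<bar>x - x'\<bar>" for x x'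
    using lipschitz_onD[OF g(2), of x x'] by (simp add: dist_real_def)
  have "(\<lambda>P. Lg * average P (\<lambda>p. \<bar>X P n p - ?E n (y p)\<bar>)) \<longlonglongrightarrow> Lg * 0"
    by (intro tendsto_intros X) simp
  then have "(\<lambda>P. average P (\<lambda>p. g (X P n p)) - average P (\<lambda>p. g (?E n (y p)))) \<longlonglongrightarrow> 0"
    unfolding mult_zero_right
  proof (rule Lim_null_comparison[OF always_eventually, rotated], intro allI)
    fix P
    have "\<bar>average P (\<lambda>p. g (X P n p)) - average P (\<lambda>p. g (?E n (y p)))\<bar> \<le>
        average P (\<lambda>p. \<bar>g (X P n p) - g (?E n (y p))\<bar>)"
      unfolding average_diff[symmetric] by (rule abs_average_le)
    also have "\<dots> \<le> average P (\<lambda>p. Lg * \<bar>X P n p - ?E n (y p)\<bar>)"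
      by (intro average_mono Lg)
    finally show "norm (average P (\<lambda>p. g (X P n p)) - average P (\<lambda>p. g (?E n (y p)))) \<le>
        Lg * average P (\<lambda>p. \<bar>X P n p - ?E n (y p)\<bar>)"
      by (simp add: average_cmult)
  qed
  from tendsto_add[OF this weak[OF order.refl lipschitz_on_continuous_on[OF g(2)] g(1)]]
  show ?thesis by simp
qed

end

section \<open>Strong error of the mean-field Euler scheme\<close>

text \<open>The uniform grid makes the sample times the same for all paths, so that expectations can
  later be taken term by term.\<close>

lemma left_riemann_sum_tendsto:
  fixes f :: "real \<Rightarrow> real"
  assumes ab: "a \<le> b" and f: "continuous_on {a..b} f"
  shows "(\<lambda>k. \<Sum>i<Suc k. (b - a) / Suc k * f (a + real i * ((b - a) / Suc k))) \<longlonglongrightarrow> integral {a..b} f"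
proof (rule LIMSEQ_I)
  fix r :: real assume r: "0 < r"
  define \<epsilon> where "\<epsilon> = r / (b - a + 1)"
  have \<epsilon>: "\<epsilon> > 0" "\<epsilon> * (b - a) < r" using r ab by (auto simp: \<epsilon>_def field_simps)
  have "uniformly_continuous_on {a..b} f"
    by (rule compact_uniformly_continuous[OF f compact_Icc])
  then obtain \<delta> where \<delta>: "\<delta> > 0"
    "\<And>x y. x \<in> {a..b} \<Longrightarrow> y \<in> {a..b} \<Longrightarrow> \<bar>y - x\<bar> < \<delta> \<Longrightarrow> \<bar>f y - f x\<bar> < \<epsilon>"
    unfolding uniformly_continuous_on_def dist_real_def using \<epsilon>(1) by metis
  have "(\<lambda>k. (b - a) * (1 / real (Suc k))) \<longlonglongrightarrow> (b - a) * 0"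
    by (intro tendsto_intros LIMSEQ_Suc[OF lim_1_over_n])
  then have ev: "\<forall>\<^sub>F k in sequentially. (b - a) / Suc k < \<delta>"
    using \<delta>(1) by (intro order_tendstoD(2)) auto
  have "norm ((\<Sum>i<Suc k. (b - a) / Suc k * f (a + real i * ((b - a) / Suc k))) - integral {a..b} f) < r"
    if k: "(b - a) / Suc k < \<delta>" for k
  proof -
    define h where "h = (b - a) / Suc k"
    define x where "x i = a + real i * h" for i :: nat
    have h: "0 \<le> h" "h < \<delta>" "real (Suc k) * h = b - a" using ab k by (auto simp: h_def)
    have x_le: "x i \<le> b" if "i \<le> Suc k" for i
    proof -
      have "real i * h \<le> real (Suc k) * h" using that h(1) by (intro mult_right_mono) auto
      then show ?thesis using h(3) by (simp add: x_def)
    qed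
    have x_ge: "a \<le> x i" for i using h(1) by (simp add: x_def)
    have x_Suc: "x (Suc i) = x i + h" for i by (simp add: x_def algebra_simps)
    have sub: "continuous_on {p..q} f" if "a \<le> p" "q \<le> b" for p q
      by (rule continuous_on_subset[OF f]) (use that in auto)
    have split: "integral {a..x n} f = (\<Sum>i<n. integral {x i..x (Suc i)} f)" if "n \<le> Suc k" for n
      using that
    proof (induction n)
      case (Suc n)
      have "integral {a..x n} f + integral {x n..x (Suc n)} f = integral {a..x (Suc n)} f"
        by (intro Henstock_Kurzweil_Integration.integral_combine integrable_continuous_real sub)
          (use x_ge x_le[OF Suc.prems] x_Suc h(1) in auto)
      then show ?case using Suc by simp
    qed (simp add: x_def)
    have cell: "\<bar>h * f (x i) - integral {x i..x (Suc i)} f\<bar> \<le> \<epsilon> * h" if i: "i < Suc k" for i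
    proof -
      have xi: "x i \<le> x (Suc i)" "x (Suc i) \<le> b" "x (Suc i) - x i = h"
        using x_Suc h(1) x_le[of "Suc i"] i by auto
      note c = sub[OF x_ge xi(2)]
      have "integral {x i..x (Suc i)} (\<lambda>s. f s - f (x i)) = integral {x i..x (Suc i)} f - h * f (x i)"
        using xi by (subst Henstock_Kurzweil_Integration.integral_diff) (auto intro: integrable_continuous_real[OF c])
      moreover have "norm (integral {x i..x (Suc i)} (\<lambda>s. f s - f (x i))) \<le> \<epsilon> * (x (Suc i) - x i)"
      proof (rule integral_bound[OF xi(1)])
        show "continuous_on {x i..x (Suc i)} (\<lambda>s. f s - f (x i))" by (intro continuous_intros c)
        show "norm (f s - f (x i)) \<le> \<epsilon>" if "s \<in> {x i..x (Suc i)}" for s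
          using \<delta>(2)[of "x i" s] that xi x_ge[of i] h(2) by auto
      qed
      ultimately show ?thesis using xi by auto
    qed
    have "(\<Sum>i<Suc k. h * f (x i)) - integral {a..b} f =
        (\<Sum>i<Suc k. h * f (x i) - integral {x i..x (Suc i)} f)"
      using split[OF order.refl] h(3) by (simp add: sum_subtractf x_def del: sum.lessThan_Suc)
    also have "\<bar>\<dots>\<bar> \<le> (\<Sum>i<Suc k. \<epsilon> * h)"
      by (intro order.trans[OF sum_abs] sum_mono cell) auto
    also have "\<dots> = \<epsilon> * (real (Suc k) * h)"
      by (simp only: sum_constant card_lessThan mult.left_commute)
    also have "\<dots> < r" using h(3) \<epsilon>(2) by simp
    finally show ?thesis unfolding h_def[symmetric] x_def by simp
  qed
  with ev show "\<exists>no. \<forall>k\<ge>no. norm ((\<Sum>i<Suc k. (b - a) / Suc k * f (a + real i * ((b - a) / Suc k))) - integral {a..b} f) < r"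
    by (auto simp: eventually_sequentially)
qed

text \<open>Riemann sums stand in for the exchange of expectation and time integral, so no joint
  measurability in time and chance is needed.\<close>

lemma expectation_abs_time_integral_le:
  fixes F :: "real \<Rightarrow> 'a \<Rightarrow> real"
  assumes "prob_space M" and t: "t \<le> t'"
    and cont: "AE \<omega> in M. continuous_on {t..t'} (\<lambda>s. F s \<omega>)"
    and F: "\<And>s. s \<in> {t..t'} \<Longrightarrow> F s \<in> borel_measurable M"
    and B: "\<And>s \<omega>. \<bar>F s \<omega>\<bar> \<le> B"
    and C: "\<And>s. s \<in> {t..t'} \<Longrightarrow> (\<integral>\<omega>. \<bar>F s \<omega>\<bar> \<partial>M) \<le> C"
    and G[measurable]: "G \<in> borel_measurable M"
    and eq: "AE \<omega> in M. G \<omega> = integral {t..t'} (\<lambda>s. F s \<omega>)"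
  shows "(\<integral>\<omega>. \<bar>G \<omega>\<bar> \<partial>M) \<le> C * (t' - t)"
proof -
  interpret prob_space M by fact
  define x where "x k i = t + real i * ((t' - t) / Suc k)" for k i :: nat
  define S where "S k \<omega> = (\<Sum>i<Suc k. (t' - t) / Suc k * F (x k i) \<omega>)" for k \<omega>
  have x: "x k i \<in> {t..t'}" if "i < Suc k" for k i
  proof -
    have "real i * ((t' - t) / Suc k) \<le> real (Suc k) * ((t' - t) / Suc k)"
      using that t by (intro mult_right_mono) auto
    then show ?thesis using t by (simp add: x_def)
  qed
  have Fx[measurable]: "F (x k i) \<in> borel_measurable M" if "i < Suc k" for k i
    using F x that by blast
  have S_le: "\<bar>S k \<omega>\<bar> \<le> (\<Sum>i<Suc k. (t' - t) / Suc k * \<bar>F (x k i) \<omega>\<bar>)" for k \<omega>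
    unfolding S_def using t by (intro order.trans[OF sum_abs] sum_mono) (simp add: abs_mult)
  have const: "(\<Sum>i<Suc k. (t' - t) / Suc k * c) = c * (t' - t)" for k :: nat and c :: real
    by (simp del: sum.lessThan_Suc)
  have int: "integrable M (\<lambda>\<omega>. (t' - t) / Suc k * \<bar>F (x k i) \<omega>\<bar>)" if "i < Suc k" for k i
    using Fx[OF that] by (intro integrable_mult_right integrable_abs integrable_const_bound[where B=B]) (auto simp: B)
  \<comment> \<open>The sums converge almost surely and are bounded by B (t' - t), so their mean
    absolute values converge too. It remains to bound each finite sum, where expectation and
    summation commute.\<close>
  have lim: "(\<lambda>k. \<integral>\<omega>. \<bar>S k \<omega>\<bar> \<partial>M) \<longlonglongrightarrow> (\<integral>\<omega>. \<bar>G \<omega>\<bar> \<partial>M)"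
  proof (rule integral_dominated_convergence[where w="\<lambda>_. B * (t' - t)"])
    show "AE \<omega> in M. (\<lambda>k. \<bar>S k \<omega>\<bar>) \<longlonglongrightarrow> \<bar>G \<omega>\<bar>"
      using cont eq
    proof eventually_elim
      case (elim \<omega>)
      then show ?case
        using tendsto_rabs[OF left_riemann_sum_tendsto[OF t elim(1)]] by (simp add: S_def x_def)
    qed
    show "AE \<omega> in M. norm \<bar>S k \<omega>\<bar> \<le> B * (t' - t)" for k
    proof (rule AE_I2)
      fix \<omega>
      have "\<bar>S k \<omega>\<bar> \<le> (\<Sum>i<Suc k. (t' - t) / Suc k * B)"
        using t by (intro order.trans[OF S_le] sum_mono mult_left_mono B) auto
      then show "norm \<bar>S k \<omega>\<bar> \<le> B * (t' - t)" unfolding const by simp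
    qed
    show "(\<lambda>\<omega>. \<bar>S k \<omega>\<bar>) \<in> borel_measurable M" for k
      unfolding S_def by (intro borel_measurable_abs borel_measurable_sum borel_measurable_times
          borel_measurable_const Fx) auto
  qed auto
  have "(\<integral>\<omega>. \<bar>S k \<omega>\<bar> \<partial>M) \<le> C * (t' - t)" for k
  proof -
    have "(\<integral>\<omega>. \<bar>S k \<omega>\<bar> \<partial>M) \<le> (\<integral>\<omega>. (\<Sum>i<Suc k. (t' - t) / Suc k * \<bar>F (x k i) \<omega>\<bar>) \<partial>M)"
      using t by (intro integral_mono' S_le Bochner_Integration.integrable_sum int sum_nonneg) auto
    also have "\<dots> = (\<Sum>i<Suc k. (t' - t) / Suc k * (\<integral>\<omega>. \<bar>F (x k i) \<omega>\<bar> \<partial>M))"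
      by (subst Bochner_Integration.integral_sum[OF int])
        (auto simp del: sum.lessThan_Suc)
    also have "\<dots> \<le> (\<Sum>i<Suc k. (t' - t) / Suc k * C)"
      using t by (intro sum_mono mult_left_mono C x) auto
    finally show ?thesis unfolding const .
  qed
  then show ?thesis by (intro LIMSEQ_le_const2[OF lim]) auto
qed

text \<open>A centred Gaussian with standard deviation v has mean absolute value v sqrt (2 / pi),
  here rounded up to v. The case \<open>s = t\<close> stands apart because
  \<open>wiener_process\<close> prescribes a density for \<open>s < t\<close>.\<close>

lemma wiener_process_increment_abs:
  assumes W: "wiener_process M W" and st: "0 \<le> s" "s \<le> t"
  shows "integrable M (\<lambda>\<omega>. \<bar>W t \<omega> - W s \<omega>\<bar>)" "(\<integral>\<omega>. \<bar>W t \<omega> - W s \<omega>\<bar> \<partial>M) \<le> sqrt (t - s)"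
proof -
  interpret prob_space M using W by (simp add: wiener_process_def)
  have "integrable M (\<lambda>\<omega>. \<bar>W t \<omega> - W s \<omega>\<bar>) \<and> (\<integral>\<omega>. \<bar>W t \<omega> - W s \<omega>\<bar> \<partial>M) \<le> sqrt (t - s)"
  proof (cases "s = t")
    case False
    then have lt: "s < t" using st by simp
    define v where "v = sqrt (t - s)"
    have v: "v > 0" using lt by (simp add: v_def)
    have D: "distributed M lborel (\<lambda>\<omega>. W t \<omega> - W s \<omega>) (\<lambda>x. ennreal (normal_density 0 v x))"
      using W st(1) lt by (simp add: wiener_process_def v_def)
    have mom: "has_bochner_integral lborel (\<lambda>x. normal_density 0 v x * \<bar>x\<bar>) (v * sqrt (2 / pi))"
      using normal_moment_abs_odd[OF v, of 0 0] by simp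
    have "integrable M (\<lambda>\<omega>. \<bar>W t \<omega> - W s \<omega>\<bar>)"
      using distributed_integrable[OF D, of abs] integrable.intros[OF mom] by simp
    moreover have "(\<integral>\<omega>. \<bar>W t \<omega> - W s \<omega>\<bar> \<partial>M) = v * sqrt (2 / pi)"
      using distributed_integral[OF D, of abs] has_bochner_integral_integral_eq[OF mom] by simp
    moreover have "v * sqrt (2 / pi) \<le> v * 1"
      using v pi_ge_two by (intro mult_left_mono) (auto simp: real_sqrt_le_1_iff)
    ultimately show ?thesis by (simp add: v_def)
  qed simp
  then show "integrable M (\<lambda>\<omega>. \<bar>W t \<omega> - W s \<omega>\<bar>)"
    "(\<integral>\<omega>. \<bar>W t \<omega> - W s \<omega>\<bar> \<partial>M) \<le> sqrt (t - s)" by auto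
qed

text \<open>Every generator, including the null sets of the augmentation, belongs to
  \<open>sets M\<close>, so adaptedness implies measurability on \<open>M\<close>.\<close>

lemma measurable_augmented_filtration:
  assumes W: "wiener_process M W" and \<xi>: "\<xi> \<in> borel_measurable M" and "0 \<le> t"
    and Z: "Z \<in> borel_measurable (augmented_filtration M \<xi> W t)"
  shows "Z \<in> borel_measurable M"
proof -
  let ?G = "{\<xi> -` A \<inter> space M | A. A \<in> sets borel} \<union>
      {W s -` A \<inter> space M | s A. s \<in> {0..t} \<and> A \<in> sets borel} \<union> null_sets M"
  have G: "?G \<subseteq> sets M"
    using W \<xi> by (auto simp: wiener_process_def intro: measurable_sets)
  have "sets (augmented_filtration M \<xi> W t) = sigma_sets (space M) ?G"
    unfolding augmented_filtration_def
    by (rule sets_measure_of, rule order.trans[OF G sets.space_closed])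
  then have "sets (augmented_filtration M \<xi> W t) \<subseteq> sets M"
    using sets.sigma_sets_subset[OF G] by simp
  moreover have "space (augmented_filtration M \<xi> W t) = space M"
    unfolding augmented_filtration_def by (rule space_measure_of_conv)
  ultimately show ?thesis using Z by (auto simp: measurable_def)
qed

lemma tendsto_lipschitz_pair:
  fixes f :: "real \<times> real \<Rightarrow> real"
  assumes f: "\<And>x v x' v'. \<bar>f (x, v) - f (x', v')\<bar> \<le> L * (\<bar>x - x'\<bar> + \<bar>v - v'\<bar>)"
    and "(p \<longlongrightarrow> x) F" "(q \<longlongrightarrow> v) F"
  shows "((\<lambda>i. f (p i, q i)) \<longlongrightarrow> f (x, v)) F"
proof (rule LIM_zero_cancel, rule Lim_null_comparison[OF always_eventually], intro allI)
  show "norm (f (p i, q i) - f (x, v)) \<le> L * (\<bar>p i - x\<bar> + \<bar>q i - v\<bar>)" for i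
    using f by simp
  have "((\<lambda>i. L * (\<bar>p i - x\<bar> + \<bar>q i - v\<bar>)) \<longlongrightarrow> L * (\<bar>x - x\<bar> + \<bar>v - v\<bar>)) F"
    by (intro tendsto_intros assms)
  then show "((\<lambda>i. L * (\<bar>p i - x\<bar> + \<bar>q i - v\<bar>)) \<longlongrightarrow> 0) F" by simp
qed

lemma borel_measurable_lipschitz_pair:
  fixes f :: "real \<times> real \<Rightarrow> real"
  assumes f: "\<And>x v x' v'. \<bar>f (x, v) - f (x', v')\<bar> \<le> L * (\<bar>x - x'\<bar> + \<bar>v - v'\<bar>)"
    and [measurable]: "p \<in> borel_measurable M" "q \<in> borel_measurable M"
  shows "(\<lambda>x. f (p x, q x)) \<in> borel_measurable M"
proof (rule borel_measurable_continuous_on[where f=f and g="\<lambda>x. (p x, q x)"])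
  show "continuous_on UNIV f"
  proof (rule continuous_on_sequentiallyI)
    fix u :: "nat \<Rightarrow> real \<times> real" and s assume u: "u \<longlonglongrightarrow> s"
    show "(\<lambda>n. f (u n)) \<longlonglongrightarrow> f s"
      using tendsto_lipschitz_pair[OF f tendsto_fst[OF u] tendsto_snd[OF u]] by simp
  qed
qed measurable

context lipschitz_coefficients
begin

section \<open>The solution and the error of one Euler step\<close>

context
  fixes M :: "'a measure" and T \<sigma> :: real and \<xi> :: "'a \<Rightarrow> real" and W Z :: "real \<Rightarrow> 'a \<Rightarrow> real"
  assumes W: "wiener_process M W" and \<xi>: "\<xi> \<in> borel_measurable M" and T: "0 < T"
    and Z: "mckean_vlasov_strong_solution M a \<kappa> \<sigma> T \<xi> W Z"
begin

interpretation prob_space M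
  using W by (simp add: wiener_process_def)

lemma Z_measurable: "t \<in> {0..T} \<Longrightarrow> Z t \<in> borel_measurable M"
  using Z measurable_augmented_filtration[OF W \<xi>, of t "Z t"]
  by (simp add: mckean_vlasov_strong_solution_def)

lemma W_measurable: "0 \<le> t \<Longrightarrow> W t \<in> borel_measurable M"
  using W by (simp add: wiener_process_def)

text \<open>Two scenarios are involved: the state follows the given \<omega>, while the law is an
  average over \<omega>'. Continuity of the law in time comes from the almost surely continuous
  paths of \<omega>' by dominated convergence.\<close>

lemma drift_path_continuous:
  assumes "continuous_on {0..T} (\<lambda>t. Z t \<omega>)"
  shows "continuous_on {0..T} (\<lambda>s. a (Z s \<omega>, \<integral>\<omega>'. \<kappa> (Z s \<omega>, Z s \<omega>') \<partial>M))"
proof (rule continuous_on_sequentiallyI)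
  fix u :: "nat \<Rightarrow> real" and s assume u: "\<forall>n. u n \<in> {0..T}" "s \<in> {0..T}" "u \<longlonglongrightarrow> s"
  have lim: "(\<lambda>n. Z (u n) \<omega>) \<longlonglongrightarrow> Z s \<omega>"
    if "continuous_on {0..T} (\<lambda>t. Z t \<omega>)" for \<omega>
    using continuous_on_tendsto_compose[OF that u(3,2)] u(1) by simp
  have "(\<lambda>n. \<integral>\<omega>'. \<kappa> (Z (u n) \<omega>, Z (u n) \<omega>') \<partial>M) \<longlonglongrightarrow> (\<integral>\<omega>'. \<kappa> (Z s \<omega>, Z s \<omega>') \<partial>M)"
  proof (rule integral_dominated_convergence[where w="\<lambda>_. K"])
    have "AE \<omega>' in M. continuous_on {0..T} (\<lambda>t. Z t \<omega>')"
      using Z by (simp add: mckean_vlasov_strong_solution_def)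
    then show "AE \<omega>' in M. (\<lambda>n. \<kappa> (Z (u n) \<omega>, Z (u n) \<omega>')) \<longlonglongrightarrow> \<kappa> (Z s \<omega>, Z s \<omega>')"
      by eventually_elim (intro tendsto_lipschitz_pair[OF \<kappa>_lipschitz] lim assms)
    show "(\<lambda>\<omega>'. \<kappa> (Z (u n) \<omega>, Z (u n) \<omega>')) \<in> borel_measurable M" for n
      using u(1) by (intro borel_measurable_continuous_on[OF continuous_\<kappa>] Z_measurable) auto
    show "(\<lambda>\<omega>'. \<kappa> (Z s \<omega>, Z s \<omega>')) \<in> borel_measurable M"
      using u(2) by (intro borel_measurable_continuous_on[OF continuous_\<kappa>] Z_measurable) auto
  qed (auto simp: \<kappa>_bound)
  then show "(\<lambda>n. a (Z (u n) \<omega>, \<integral>\<omega>'. \<kappa> (Z (u n) \<omega>, Z (u n) \<omega>') \<partial>M)) \<longlonglongrightarrow>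
      a (Z s \<omega>, \<integral>\<omega>'. \<kappa> (Z s \<omega>, Z s \<omega>') \<partial>M)"
    by (intro tendsto_lipschitz_pair[OF a_lipschitz] lim assms)
qed

text \<open>The equation in the form used from here on: over arbitrary subintervals, with the gauge
  integral of a continuous function, and with the law pulled back to \<open>M\<close>.
  \<open>W 0 = 0\<close> gives the initial value.\<close>

lemma AE_solution:
  "AE \<omega> in M. continuous_on {0..T} (\<lambda>s. a (Z s \<omega>, \<integral>\<omega>'. \<kappa> (Z s \<omega>, Z s \<omega>') \<partial>M)) \<and>
    Z 0 \<omega> = \<xi> \<omega> \<and>
    (\<forall>t\<in>{0..T}. \<forall>t'\<in>{t..T}. Z t' \<omega> - Z t \<omega> =
      integral {t..t'} (\<lambda>s. a (Z s \<omega>, \<integral>\<omega>'. \<kappa> (Z s \<omega>, Z s \<omega>') \<partial>M)) + \<sigma> * (W t' \<omega> - W t \<omega>))"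
proof -
  have "AE \<omega> in M. continuous_on {0..T} (\<lambda>t. Z t \<omega>)"
    using Z by (simp add: mckean_vlasov_strong_solution_def)
  moreover have "AE \<omega> in M. \<forall>t\<in>{0..T}.
        Z t \<omega> = \<xi> \<omega>
          + (LBINT s:{0..t}. a (Z s \<omega>, \<integral>z. \<kappa> (Z s \<omega>, z) \<partial>distr M borel (Z s)))
          + \<sigma> * W t \<omega>"
    using Z by (simp add: mckean_vlasov_strong_solution_def)
  moreover have "AE \<omega> in M. W 0 \<omega> = 0" using W by (simp add: wiener_process_def)
  ultimately show ?thesis
  proof eventually_elim
    case (elim \<omega>)
    define b where "b s = a (Z s \<omega>, \<integral>\<omega>'. \<kappa> (Z s \<omega>, Z s \<omega>') \<partial>M)" for s
    have b: "continuous_on {0..T} b"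
      unfolding b_def by (rule drift_path_continuous[OF elim(1)])
    have bsub: "continuous_on {p..q} b" if "0 \<le> p" "q \<le> T" for p q
      by (rule continuous_on_subset[OF b]) (use that in auto)
    have sol: "Z t \<omega> = \<xi> \<omega> + integral {0..t} b + \<sigma> * W t \<omega>" if t: "t \<in> {0..T}" for t
    proof -
      have "(LBINT s:{0..t}. a (Z s \<omega>, \<integral>z. \<kappa> (Z s \<omega>, z) \<partial>distr M borel (Z s))) = (LBINT s:{0..t}. b s)"
      proof (rule set_lebesgue_integral_cong)
        show "\<forall>s. s \<in> {0..t} \<longrightarrow> a (Z s \<omega>, \<integral>z. \<kappa> (Z s \<omega>, z) \<partial>distr M borel (Z s)) = b s"
          using t unfolding b_def
          by (auto simp: integral_distr[OF Z_measurable borel_measurable_continuous_onI[OF continuous_\<kappa>]])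
      qed simp
      also have "\<dots> = integral {0..t} b"
        using t by (intro set_borel_integral_eq_integral(2) borel_integrable_atLeastAtMost' bsub) auto
      finally show ?thesis using elim(2) t by simp
    qed
    have "Z t' \<omega> - Z t \<omega> = integral {t..t'} b + \<sigma> * (W t' \<omega> - W t \<omega>)"
      if t: "t \<in> {0..T}" "t' \<in> {t..T}" for t t'
    proof -
      have "integral {0..t} b + integral {t..t'} b = integral {0..t'} b"
        by (intro Henstock_Kurzweil_Integration.integral_combine integrable_continuous_real bsub)
          (use t in auto)
      then show ?thesis using sol[of t] sol[of t'] t by (simp add: algebra_simps)
    qed
    moreover have "Z 0 \<omega> = \<xi> \<omega>" using sol[of 0] elim(3) T by simp
    ultimately show ?case using b unfolding b_def by blast
  qed
qed

lemma Z_increment: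
  assumes t: "0 \<le> t" "t \<le> t'" "t' \<le> T"
  shows "integrable M (\<lambda>\<omega>. Z t' \<omega> - Z t \<omega>)"
    "(\<integral>\<omega>. \<bar>Z t' \<omega> - Z t \<omega>\<bar> \<partial>M) \<le> A * (t' - t) + \<bar>\<sigma>\<bar> * sqrt (t' - t)"
proof -
  have [measurable]: "Z t \<in> borel_measurable M" "Z t' \<in> borel_measurable M"
    using t by (auto intro: Z_measurable)
  have Wint: "integrable M (\<lambda>\<omega>. A * (t' - t) + \<bar>\<sigma>\<bar> * \<bar>W t' \<omega> - W t \<omega>\<bar>)"
    using wiener_process_increment_abs(1)[OF W t(1,2)] by simp
  have bound: "AE \<omega> in M. \<bar>Z t' \<omega> - Z t \<omega>\<bar> \<le> A * (t' - t) + \<bar>\<sigma>\<bar> * \<bar>W t' \<omega> - W t \<omega>\<bar>"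
    using AE_solution
  proof eventually_elim
    case (elim \<omega>)
    define b where "b s = a (Z s \<omega>, \<integral>\<omega>'. \<kappa> (Z s \<omega>, Z s \<omega>') \<partial>M)" for s
    have "continuous_on {t..t'} b"
      using elim t unfolding b_def by (auto intro: continuous_on_subset)
    then have "norm (integral {t..t'} b) \<le> A * (t' - t)"
      by (intro integral_bound t) (auto simp: b_def a_bound)
    moreover have "Z t' \<omega> - Z t \<omega> = integral {t..t'} b + \<sigma> * (W t' \<omega> - W t \<omega>)"
      using elim t unfolding b_def by auto
    ultimately show ?case
      using abs_triangle_ineq[of "integral {t..t'} b" "\<sigma> * (W t' \<omega> - W t \<omega>)"] by (simp add: abs_mult)
  qed
  show int: "integrable M (\<lambda>\<omega>. Z t' \<omega> - Z t \<omega>)"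
    by (rule Bochner_Integration.integrable_bound[OF Wint]) (use bound in \<open>auto elim!: eventually_mono\<close>)
  have "(\<integral>\<omega>. \<bar>Z t' \<omega> - Z t \<omega>\<bar> \<partial>M) \<le> (\<integral>\<omega>. A * (t' - t) + \<bar>\<sigma>\<bar> * \<bar>W t' \<omega> - W t \<omega>\<bar> \<partial>M)"
    by (rule integral_mono_AE) (use int Wint bound in auto)
  also have "\<dots> = A * (t' - t) + \<bar>\<sigma>\<bar> * (\<integral>\<omega>. \<bar>W t' \<omega> - W t \<omega>\<bar> \<partial>M)"
    using wiener_process_increment_abs(1)[OF W t(1,2)] by (simp add: prob_space)
  also have "\<dots> \<le> A * (t' - t) + \<bar>\<sigma>\<bar> * sqrt (t' - t)"
    by (intro add_left_mono mult_left_mono wiener_process_increment_abs(2)[OF W t(1,2)]) auto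
  finally show "(\<integral>\<omega>. \<bar>Z t' \<omega> - Z t \<omega>\<bar> \<partial>M) \<le> A * (t' - t) + \<bar>\<sigma>\<bar> * sqrt (t' - t)" .
qed

text \<open>The additive noise cancels in the difference of solution and scheme, which is therefore
  integrable although the solution itself need not be.\<close>

lemma mean_field_euler_error_step:
  fixes X :: "'a \<Rightarrow> real"
  assumes t: "0 \<le> t" "0 \<le> h" "t + h \<le> T"
    and X[measurable]: "X \<in> borel_measurable M" and int: "integrable M (\<lambda>\<omega>. Z t \<omega> - X \<omega>)"
  defines "X' \<equiv> \<lambda>\<omega>. X \<omega> + a (X \<omega>, \<integral>\<omega>'. \<kappa> (X \<omega>, X \<omega>') \<partial>M) * h + \<sigma> * (W (t + h) \<omega> - W t \<omega>)"
  shows "integrable M (\<lambda>\<omega>. Z (t + h) \<omega> - X' \<omega>)"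
    "(\<integral>\<omega>. \<bar>Z (t + h) \<omega> - X' \<omega>\<bar> \<partial>M) \<le> (\<integral>\<omega>. \<bar>Z t \<omega> - X \<omega>\<bar> \<partial>M) +
      La * (1 + 2 * Lk) * h * ((\<integral>\<omega>. \<bar>Z t \<omega> - X \<omega>\<bar> \<partial>M) + (A * h + \<bar>\<sigma>\<bar> * sqrt h))"
proof -
  define bX where "bX \<omega> = a (X \<omega>, \<integral>\<omega>'. \<kappa> (X \<omega>, X \<omega>') \<partial>M)" for \<omega>
  define F where "F s \<omega> = a (Z s \<omega>, \<integral>\<omega>'. \<kappa> (Z s \<omega>, Z s \<omega>') \<partial>M) - bX \<omega>" for s \<omega>
  \<comment> \<open>The change of the error over one step. Solution and scheme have the same
    Brownian increment, so what remains is the time integral of the drift difference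
    \<open>F\<close>, with \<open>bX\<close> frozen at the start of the step.\<close>
  define G where "G \<omega> = (Z (t + h) \<omega> - X' \<omega>) - (Z t \<omega> - X \<omega>)" for \<omega>
  define e where "e = (\<integral>\<omega>. \<bar>Z t \<omega> - X \<omega>\<bar> \<partial>M)"
  define \<rho> where "\<rho> = A * h + \<bar>\<sigma>\<bar> * sqrt h"
  note P = prob_space_axioms
  have [measurable]: "Z t \<in> borel_measurable M" "Z (t + h) \<in> borel_measurable M"
    "W t \<in> borel_measurable M" "W (t + h) \<in> borel_measurable M"
    using t by (auto intro: Z_measurable W_measurable)
  have bX[measurable]: "bX \<in> borel_measurable M"
    unfolding bX_def by (rule borel_measurable_continuous_on[OF continuous_drift[OF P X] X])
  have G_eq: "AE \<omega> in M. G \<omega> = integral {t..t + h} (\<lambda>s. F s \<omega>)"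
    and F_cont: "AE \<omega> in M. continuous_on {t..t + h} (\<lambda>s. F s \<omega>)"
  proof -
    have "AE \<omega> in M. G \<omega> = integral {t..t + h} (\<lambda>s. F s \<omega>) \<and> continuous_on {t..t + h} (\<lambda>s. F s \<omega>)"
      using AE_solution
    proof eventually_elim
      case (elim \<omega>)
      define b where "b s = a (Z s \<omega>, \<integral>\<omega>'. \<kappa> (Z s \<omega>, Z s \<omega>') \<partial>M)" for s
      have b: "continuous_on {t..t + h} b"
        using elim t unfolding b_def by (auto intro: continuous_on_subset)
      have "integral {t..t + h} (\<lambda>s. b s - bX \<omega>) = integral {t..t + h} b - bX \<omega> * h"
        using t by (subst Henstock_Kurzweil_Integration.integral_diff)
          (auto intro: integrable_continuous_real[OF b])
      moreover have "Z (t + h) \<omega> - Z t \<omega> = integral {t..t + h} b + \<sigma> * (W (t + h) \<omega> - W t \<omega>)"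
        using elim t unfolding b_def by auto
      ultimately have "G \<omega> = integral {t..t + h} (\<lambda>s. b s - bX \<omega>)"
        by (simp add: G_def X'_def bX_def[symmetric])
      moreover have "continuous_on {t..t + h} (\<lambda>s. b s - bX \<omega>)" by (intro continuous_intros b)
      ultimately show ?case by (simp add: F_def b_def)
    qed
    then show "AE \<omega> in M. G \<omega> = integral {t..t + h} (\<lambda>s. F s \<omega>)"
      "AE \<omega> in M. continuous_on {t..t + h} (\<lambda>s. F s \<omega>)" by auto
  qed
  have F_meas: "F s \<in> borel_measurable M" if "s \<in> {t..t + h}" for s
  proof -
    have Zs: "Z s \<in> borel_measurable M" using that t by (intro Z_measurable) auto
    have [measurable]: "(\<lambda>\<omega>. a (Z s \<omega>, \<integral>\<omega>'. \<kappa> (Z s \<omega>, Z s \<omega>') \<partial>M)) \<in> borel_measurable M"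
      by (rule borel_measurable_continuous_on[OF continuous_drift[OF P Zs] Zs])
    show ?thesis unfolding F_def by measurable
  qed
  have F_bound: "\<bar>F s \<omega>\<bar> \<le> 2 * A" for s \<omega>
  proof -
    have "\<bar>a p - a q\<bar> \<le> 2 * A" for p q using a_bound[of p] a_bound[of q] by linarith
    then show ?thesis unfolding F_def bX_def .
  qed
  have F_exp: "(\<integral>\<omega>. \<bar>F s \<omega>\<bar> \<partial>M) \<le> La * (1 + 2 * Lk) * (e + \<rho>)" if s: "s \<in> {t..t + h}" for s
  proof -
    have Zs[measurable]: "Z s \<in> borel_measurable M" using s t by (intro Z_measurable) auto
    note inc = Z_increment[of t s]
    have inc1: "integrable M (\<lambda>\<omega>. Z s \<omega> - Z t \<omega>)" using inc(1) s t by auto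
    have "A * (s - t) + \<bar>\<sigma>\<bar> * sqrt (s - t) \<le> \<rho>"
      unfolding \<rho>_def using s A_nonneg by (intro add_mono mult_left_mono) auto
    then have inc2: "(\<integral>\<omega>. \<bar>Z s \<omega> - Z t \<omega>\<bar> \<partial>M) \<le> \<rho>" using inc(2) s t by fastforce
    have D: "integrable M (\<lambda>\<omega>. Z s \<omega> - X \<omega>)"
      using Bochner_Integration.integrable_add[OF inc1 int] by simp
    have "(\<integral>\<omega>. \<bar>Z s \<omega> - X \<omega>\<bar> \<partial>M) \<le> (\<integral>\<omega>. \<bar>Z s \<omega> - Z t \<omega>\<bar> + \<bar>Z t \<omega> - X \<omega>\<bar> \<partial>M)"
      using D inc1 int by (intro integral_mono) auto
    also have "\<dots> \<le> e + \<rho>"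
      using inc1 inc2 int by (simp add: e_def)
    finally have D_le: "(\<integral>\<omega>. \<bar>Z s \<omega> - X \<omega>\<bar> \<partial>M) \<le> e + \<rho>" .
    have "(\<integral>\<omega>. \<bar>F s \<omega>\<bar> \<partial>M) \<le> (\<integral>\<omega>. La * (1 + Lk) * \<bar>Z s \<omega> - X \<omega>\<bar> +
        La * Lk * (\<integral>\<omega>. \<bar>Z s \<omega> - X \<omega>\<bar> \<partial>M) \<partial>M)"
    proof (rule integral_mono)
      show "integrable M (\<lambda>\<omega>. \<bar>F s \<omega>\<bar>)"
        using F_meas[OF s] by (intro integrable_abs integrable_const_bound[where B="2 * A"]) (auto simp: F_bound)
      show "\<bar>F s \<omega>\<bar> \<le> La * (1 + Lk) * \<bar>Z s \<omega> - X \<omega>\<bar> + La * Lk * (\<integral>\<omega>. \<bar>Z s \<omega> - X \<omega>\<bar> \<partial>M)" for \<omega>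
        unfolding F_def bX_def by (rule drift_lipschitz[OF P Zs X D])
    qed (use D in auto)
    also have "\<dots> = La * (1 + 2 * Lk) * (\<integral>\<omega>. \<bar>Z s \<omega> - X \<omega>\<bar> \<partial>M)"
      using D by (simp add: prob_space algebra_simps)
    also have "\<dots> \<le> La * (1 + 2 * Lk) * (e + \<rho>)"
      using La_nonneg Lk_nonneg by (intro mult_left_mono D_le) auto
    finally show ?thesis .
  qed
  have G_meas[measurable]: "G \<in> borel_measurable M"
    unfolding G_def X'_def bX_def[symmetric] by measurable
  have "(\<integral>\<omega>. \<bar>G \<omega>\<bar> \<partial>M) \<le> La * (1 + 2 * Lk) * (e + \<rho>) * (t + h - t)"
    using t by (intro expectation_abs_time_integral_le[OF P _ F_cont F_meas F_bound F_exp G_meas G_eq]) auto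
  then have G_exp: "(\<integral>\<omega>. \<bar>G \<omega>\<bar> \<partial>M) \<le> La * (1 + 2 * Lk) * h * (e + \<rho>)"
    by (simp add: mult_ac)
  have G_int: "integrable M G"
  proof (rule integrable_const_bound[where B="2 * A * h"])
    show "AE \<omega> in M. norm (G \<omega>) \<le> 2 * A * h"
      using G_eq F_cont
    proof eventually_elim
      case (elim \<omega>)
      have "norm (integral {t..t + h} (\<lambda>s. F s \<omega>)) \<le> 2 * A * (t + h - t)"
        using t elim by (intro integral_bound) (auto simp: F_bound)
      then show ?case using elim by simp
    qed
  qed simp
  have eq: "Z (t + h) \<omega> - X' \<omega> = G \<omega> + (Z t \<omega> - X \<omega>)" for \<omega> by (simp add: G_def)
  show "integrable M (\<lambda>\<omega>. Z (t + h) \<omega> - X' \<omega>)"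
    unfolding eq using G_int int by simp
  have "(\<integral>\<omega>. \<bar>Z (t + h) \<omega> - X' \<omega>\<bar> \<partial>M) \<le> (\<integral>\<omega>. \<bar>G \<omega>\<bar> + \<bar>Z t \<omega> - X \<omega>\<bar> \<partial>M)"
    unfolding eq using G_int int by (intro integral_mono) auto
  also have "\<dots> = (\<integral>\<omega>. \<bar>G \<omega>\<bar> \<partial>M) + e"
    using G_int int by (simp add: e_def)
  finally show "(\<integral>\<omega>. \<bar>Z (t + h) \<omega> - X' \<omega>\<bar> \<partial>M) \<le> (\<integral>\<omega>. \<bar>Z t \<omega> - X \<omega>\<bar> \<partial>M) +
      La * (1 + 2 * Lk) * h * ((\<integral>\<omega>. \<bar>Z t \<omega> - X \<omega>\<bar> \<partial>M) + (A * h + \<bar>\<sigma>\<bar> * sqrt h))"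
    using G_exp by (simp add: e_def \<rho>_def)
qed

abbreviation driven_euler :: "real \<Rightarrow> nat \<Rightarrow> 'a \<Rightarrow> real" where
  "driven_euler h \<equiv> mean_field_euler a \<kappa> h M \<xi> (\<lambda>k \<omega>. \<sigma> * (W (real (Suc k) * h) \<omega> - W (real k * h) \<omega>))"

lemma driven_euler_measurable:
  assumes "0 < h"
  shows "driven_euler h k \<in> borel_measurable M"
proof (intro borel_measurable_mean_field_euler prob_space_axioms \<xi>)
  fix j :: nat
  have [measurable]: "W (real (Suc j) * h) \<in> borel_measurable M" "W (real j * h) \<in> borel_measurable M"
    using assms by (auto intro!: W_measurable)
  show "(\<lambda>\<omega>. \<sigma> * (W (real (Suc j) * h) \<omega> - W (real j * h) \<omega>)) \<in> borel_measurable M"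
    by measurable
qed

text \<open>Discrete Gronwall: with C = La (1 + 2 Lk) and \<rho> = A h + |\<sigma>| sqrt h, the
  recursion e' = (1 + C h) e + C h \<rho> started at 0 is solved exactly by \<rho> ((1 + C h)^n -
  1).\<close>

lemma driven_euler_error:
  assumes h: "0 < h" "real n * h \<le> T"
  shows "integrable M (\<lambda>\<omega>. Z (real n * h) \<omega> - driven_euler h n \<omega>) \<and>
    (\<integral>\<omega>. \<bar>Z (real n * h) \<omega> - driven_euler h n \<omega>\<bar> \<partial>M) \<le>
      (A * h + \<bar>\<sigma>\<bar> * sqrt h) * ((1 + La * (1 + 2 * Lk) * h) ^ n - 1)"
proof -
  define E where "E = driven_euler h"
  define C where "C = La * (1 + 2 * Lk)"
  define \<rho> where "\<rho> = A * h + \<bar>\<sigma>\<bar> * sqrt h"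
  have C: "0 \<le> C" using La_nonneg Lk_nonneg by (simp add: C_def)
  have E_meas: "E k \<in> borel_measurable M" for k
    unfolding E_def by (rule driven_euler_measurable[OF h(1)])
  have "integrable M (\<lambda>\<omega>. Z (real k * h) \<omega> - E k \<omega>) \<and>
      (\<integral>\<omega>. \<bar>Z (real k * h) \<omega> - E k \<omega>\<bar> \<partial>M) \<le> \<rho> * ((1 + C * h) ^ k - 1)" if "k \<le> n" for k
    using that
  proof (induction k)
    case 0
    have z: "AE \<omega> in M. Z 0 \<omega> - \<xi> \<omega> = 0" using AE_solution by eventually_elim auto
    have [measurable]: "Z 0 \<in> borel_measurable M" "\<xi> \<in> borel_measurable M"
      using T \<xi> by (auto intro: Z_measurable)
    have "integrable M (\<lambda>\<omega>. Z 0 \<omega> - \<xi> \<omega>)"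
      by (subst integrable_cong_AE[OF _ _ z]) auto
    moreover have "(\<integral>\<omega>. \<bar>Z 0 \<omega> - \<xi> \<omega>\<bar> \<partial>M) = (\<integral>\<omega>. 0 \<partial>M)"
      by (rule integral_cong_AE) (use z in \<open>auto elim: eventually_mono\<close>)
    ultimately show ?case by (simp add: E_def)
  next
    case (Suc k)
    have "real (Suc k) * h \<le> real n * h" using Suc.prems h(1) by (intro mult_right_mono) auto
    then have t: "0 \<le> real k * h" "0 \<le> h" "real k * h + h \<le> T" using h by (auto simp: algebra_simps)
    have IH: "integrable M (\<lambda>\<omega>. Z (real k * h) \<omega> - E k \<omega>)"
      "(\<integral>\<omega>. \<bar>Z (real k * h) \<omega> - E k \<omega>\<bar> \<partial>M) \<le> \<rho> * ((1 + C * h) ^ k - 1)"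
      using Suc by auto
    have Suc_eq: "real (Suc k) * h = real k * h + h" by (simp add: algebra_simps)
    have E_Suc: "E (Suc k) = (\<lambda>\<omega>. E k \<omega> + a (E k \<omega>, \<integral>\<omega>'. \<kappa> (E k \<omega>, E k \<omega>') \<partial>M) * h +
        \<sigma> * (W (real k * h + h) \<omega> - W (real k * h) \<omega>))"
      unfolding E_def Suc_eq[symmetric] by (rule ext) (simp add: Let_def)
    note step = mean_field_euler_error_step[OF t E_meas IH(1)]
    have "(\<integral>\<omega>. \<bar>Z (real (Suc k) * h) \<omega> - E (Suc k) \<omega>\<bar> \<partial>M) \<le>
        (1 + C * h) * (\<integral>\<omega>. \<bar>Z (real k * h) \<omega> - E k \<omega>\<bar> \<partial>M) + C * h * \<rho>"
      using step(2) unfolding Suc_eq E_Suc C_def \<rho>_def by (simp add: algebra_simps)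
    also have "\<dots> \<le> (1 + C * h) * (\<rho> * ((1 + C * h) ^ k - 1)) + C * h * \<rho>"
      using C h by (intro add_right_mono mult_left_mono IH) auto
    also have "\<dots> = \<rho> * ((1 + C * h) ^ Suc k - 1)" by (simp add: algebra_simps)
    finally show ?case using step(1) unfolding Suc_eq E_Suc by simp
  qed
  from this[of n] show ?thesis by (simp add: E_def C_def \<rho>_def)
qed

lemma driven_euler_strong_error:
  assumes h: "0 < h" "real n * h = T"
  shows "(\<integral>\<omega>. \<bar>Z T \<omega> - driven_euler h n \<omega>\<bar> \<partial>M) \<le>
    (A * h + \<bar>\<sigma>\<bar> * sqrt h) * exp (La * (1 + 2 * Lk) * T)"
proof -
  define C where "C = La * (1 + 2 * Lk)"
  have C: "0 \<le> C" using La_nonneg Lk_nonneg by (simp add: C_def)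
  have "(1 + C * h) ^ n \<le> exp (C * h) ^ n"
    using C h by (intro power_mono exp_ge_add_one_self) auto
  also have "\<dots> = exp (C * T)"
    by (simp add: exp_of_nat_mult[symmetric] h(2)[symmetric] mult_ac)
  finally have "(A * h + \<bar>\<sigma>\<bar> * sqrt h) * ((1 + C * h) ^ n - 1) \<le> (A * h + \<bar>\<sigma>\<bar> * sqrt h) * exp (C * T)"
    using A_nonneg h(1) by (intro mult_left_mono) auto
  then show ?thesis
    using driven_euler_error[of h n] h by (auto simp: C_def)
qed

end

end

section \<open>Laws of the inputs\<close>

lemma C1_bounded_lipschitz:
  assumes "C1_bounded f"
  obtains B L where "\<And>p. \<bar>f p\<bar> \<le> B"
    and "\<And>x v x' v'. \<bar>f (x, v) - f (x', v')\<bar> \<le> L * (\<bar>x - x'\<bar> + \<bar>v - v'\<bar>)"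
proof -
  obtain f' :: "real \<times> real \<Rightarrow> (real \<times> real) \<Rightarrow>\<^sub>L real" where b: "bounded (range f)"
    and f': "\<And>p. (f has_derivative blinfun_apply (f' p)) (at p)" and b': "bounded (range f')"
    using assms unfolding C1_bounded_def by blast
  obtain B where B: "\<And>p. \<bar>f p\<bar> \<le> B"
    using b unfolding bounded_iff by auto
  obtain L where L: "\<And>p. norm (f' p) \<le> L"
    using b' unfolding bounded_iff by auto
  have L0: "0 \<le> L" using norm_ge_zero[of "f' 0"] L[of 0] by linarith
  have lip: "\<bar>f p - f q\<bar> \<le> L * norm (p - q)" for p q
    using differentiable_bound[of UNIV f "\<lambda>p. blinfun_apply (f' p)" L p q] f' L
    by (simp add: norm_blinfun.rep_eq[symmetric])
  show thesis
  proof (rule that[OF B])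
    fix x v x' v'
    have "norm ((x, v) - (x', v')) \<le> \<bar>x - x'\<bar> + \<bar>v - v'\<bar>"
      using norm_Pair_le[of "x - x'" "v - v'"] by simp
    with lip[of "(x, v)" "(x', v')"] L0
    show "\<bar>f (x, v) - f (x', v')\<bar> \<le> L * (\<bar>x - x'\<bar> + \<bar>v - v'\<bar>)"
      by (meson mult_left_mono order.trans)
  qed
qed

lemma bounded_partials_lipschitz:
  assumes "bounded_with_C0_bounded_partials f"
  obtains B L where "\<And>p. \<bar>f p\<bar> \<le> B"
    and "\<And>x v x' v'. \<bar>f (x, v) - f (x', v')\<bar> \<le> L * (\<bar>x - x'\<bar> + \<bar>v - v'\<bar>)"
proof -
  obtain f1 f2 :: "real \<times> real \<Rightarrow> real" where b: "bounded (range f)"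
    and f1: "\<And>x y. ((\<lambda>x'. f (x', y)) has_real_derivative f1 (x, y)) (at x)"
    and f2: "\<And>x y. ((\<lambda>y'. f (x, y')) has_real_derivative f2 (x, y)) (at y)"
    and b1: "bounded (range f1)" and b2: "bounded (range f2)"
    using assms unfolding bounded_with_C0_bounded_partials_def by blast
  obtain B where B: "\<And>p. \<bar>f p\<bar> \<le> B"
    using b unfolding bounded_iff by auto
  obtain L1 where L1: "\<And>p. \<bar>f1 p\<bar> \<le> L1"
    using b1 unfolding bounded_iff by auto
  obtain L2 where L2: "\<And>p. \<bar>f2 p\<bar> \<le> L2"
    using b2 unfolding bounded_iff by auto
  show thesis
  proof (rule that[OF B])
    fix x v x' v'
    have "\<bar>f (x, v) - f (x', v)\<bar> \<le> L1 * \<bar>x - x'\<bar>"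
      using field_differentiable_bound[of UNIV "\<lambda>x. f (x, v)" "\<lambda>x. f1 (x, v)" L1 x x'] f1 L1 by simp
    moreover have "\<bar>f (x', v) - f (x', v')\<bar> \<le> L2 * \<bar>v - v'\<bar>"
      using field_differentiable_bound[of UNIV "\<lambda>v. f (x', v)" "\<lambda>v. f2 (x', v)" L2 v v'] f2 L2 by simp
    moreover have "L1 * \<bar>x - x'\<bar> \<le> max L1 L2 * \<bar>x - x'\<bar>" "L2 * \<bar>v - v'\<bar> \<le> max L1 L2 * \<bar>v - v'\<bar>"
      by (intro mult_right_mono, auto)+
    ultimately show "\<bar>f (x, v) - f (x', v')\<bar> \<le> max L1 L2 * (\<bar>x - x'\<bar> + \<bar>v - v'\<bar>)"
      unfolding distrib_left by linarith
  qed
qed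

text \<open>The joint law of the initial value, at coordinate 1, and of the normalised increments,
  equally that of the bridge inputs before the Haar transform.\<close>

definition input_law :: "real measure \<Rightarrow> nat \<Rightarrow> (nat \<Rightarrow> real) measure" where
  "input_law \<mu> d = PiM {1..2 ^ d + 1} (\<lambda>i. if i = 1 then \<mu> else std_normal_distribution)"

text \<open>Clamping the argument extends \<open>H\<close>, continuous on the unit interval, to a
  continuous function on the line without changing it at points of the cube.\<close>

definition cube_input :: "(real \<Rightarrow> real) \<Rightarrow> nat \<Rightarrow> (nat \<Rightarrow> real) \<Rightarrow> nat \<Rightarrow> real" where
  "cube_input H d x = haar_transform d
     (\<lambda>i\<in>{1..2 ^ d + 1}. if i = 1 then H (max 0 (min 1 (x i))) else std_normal_quantile (x i))"

lemma prob_space_input_law: "prob_space \<mu> \<Longrightarrow> prob_space (input_law \<mu> d)"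
  unfolding input_law_def
  by (intro prob_space_PiM) (auto simp: prob_space_normal_density)

lemma sets_input_law: "sets \<mu> = sets borel \<Longrightarrow> sets (input_law \<mu> d) = sets (PiM {1..2 ^ d + 1} (\<lambda>_. borel))"
  unfolding input_law_def by (intro sets_PiM_cong) auto

lemma borel_measurable_input_component:
  assumes "sets \<mu> = sets borel" "i \<in> {1..2 ^ d + 1}"
  shows "(\<lambda>y. y i) \<in> borel_measurable (input_law \<mu> d)"
  using assms(2) by (subst measurable_cong_sets[OF sets_input_law[OF assms(1)] refl]) measurable

section \<open>The map from the unit cube to the input law\<close>

lemma continuous_clamped:
  assumes "continuous_on {0..1} H"
  shows "continuous_on UNIV (\<lambda>x::real. H (max 0 (min 1 x)))"
  by (rule continuous_on_compose2[OF assms]) (auto intro!: continuous_intros)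

lemma distr_clamped:
  fixes H :: "real \<Rightarrow> real"
  assumes H: "continuous_on {0..1} H"
  shows "distr unit_uniform borel (\<lambda>x. H (max 0 (min 1 x))) = distr (restrict_space lborel {0..1}) borel H"
proof (rule measure_eqI)
  have m[measurable]: "(\<lambda>x. H (max 0 (min 1 x))) \<in> borel_measurable borel"
    by (rule borel_measurable_continuous_onI[OF continuous_clamped[OF H]])
  have "H \<in> borel_measurable (restrict_space borel {0..1})"
    by (rule borel_measurable_continuous_on_restrict[OF H])
  then have mH: "H \<in> measurable (restrict_space lborel {0..1}) borel"
    by (subst measurable_cong_sets[OF sets_restrict_space_cong[OF sets_lborel] refl])
  fix A :: "real set" assume "A \<in> sets (distr unit_uniform borel (\<lambda>x. H (max 0 (min 1 x))))"
  then have A[measurable]: "A \<in> sets borel" by simp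
  have pre: "(\<lambda>x. H (max 0 (min 1 x))) -` A \<in> sets borel"
    using measurable_sets[OF m A] by simp
  have "emeasure (distr unit_uniform borel (\<lambda>x. H (max 0 (min 1 x)))) A =
      emeasure lborel ({0..1} \<inter> (\<lambda>x. H (max 0 (min 1 x))) -` A)"
    using pre by (subst emeasure_distr) (auto simp: divide_ennreal_def)
  also have "{0..1} \<inter> (\<lambda>x. H (max 0 (min 1 x))) -` A = H -` A \<inter> {0..1}"
    by (auto simp: max_def min_def)
  also have "emeasure lborel \<dots> = emeasure (restrict_space lborel {0..1}) (H -` A \<inter> {0..1})"
    by (rule emeasure_restrict_space[symmetric]) auto
  also have "\<dots> = emeasure (distr (restrict_space lborel {0..1}) borel H) A"
    by (subst emeasure_distr[OF mH A]) (simp add: space_restrict_space)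
  finally show "emeasure (distr unit_uniform borel (\<lambda>x. H (max 0 (min 1 x)))) A =
      emeasure (distr (restrict_space lborel {0..1}) borel H) A" .
qed simp

text \<open>Inverse transform sampling in each coordinate produces the product law, and the Haar
  transform preserves it: the bridge construction has the exact Brownian law at the nodes.\<close>

lemma cube_input_law:
  assumes H: "continuous_on {0..1} H"
    and \<mu>: "\<mu> = distr (restrict_space lborel {0..1}) borel H"
  shows "cube_input H d \<in> measurable (unit_cube {1..2 ^ d + 1}) (input_law \<mu> d)"
    "distr (unit_cube {1..2 ^ d + 1}) (input_law \<mu> d) (cube_input H d) = input_law \<mu> d"
proof -
  let ?I = "{1..2 ^ d + 1} :: nat set"
  define f where "f i = (if i = 1 then (\<lambda>x. H (max 0 (min 1 x))) else std_normal_quantile)" for i :: nat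
  define raw where "raw x = (\<lambda>i\<in>?I. f i (x i))" for x :: "nat \<Rightarrow> real"
  define N where "N i = (if i = 1 then \<mu> else std_normal_distribution)" for i :: nat
  have m: "(\<lambda>x. H (max 0 (min 1 x))) \<in> borel_measurable borel"
    by (rule borel_measurable_continuous_onI[OF continuous_clamped[OF H]])
  have f: "f i \<in> borel_measurable unit_uniform" for i
    using m by (simp add: f_def)
  have N: "distr unit_uniform borel (f i) = N i" for i
    by (simp add: N_def f_def \<mu> distr_clamped[OF H] distr_std_normal_quantile)
  have prob_N: "prob_space (N i)" for i
    unfolding N[symmetric] by (rule prob_space.prob_space_distr[OF prob_space_unit_uniform f])
  have sets_N: "sets (N i) = sets borel" for i
    unfolding N[symmetric] by simp
  have law: "PiM ?I N = input_law \<mu> d"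
    unfolding input_law_def N_def by simp
  have sets_law: "sets (PiM ?I N) = sets (PiM ?I (\<lambda>_. borel))"
    by (intro sets_PiM_cong) (auto simp: sets_N)
  have raw_m: "raw \<in> measurable (unit_cube ?I) (PiM ?I N)"
  proof -
    have "raw \<in> measurable (unit_cube ?I) (PiM ?I (\<lambda>_. borel))"
      unfolding raw_def
    proof (rule measurable_restrict)
      fix i assume "i \<in> ?I"
      then show "(\<lambda>x. f i (x i)) \<in> measurable (unit_cube ?I) borel"
        using measurable_compose[where g="f i", OF measurable_component_singleton[of i ?I "\<lambda>_. unit_uniform"] f] by blast
    qed
    then show ?thesis by (subst measurable_cong_sets[OF refl sets_law])
  qed
  have "distr (unit_cube ?I) (PiM ?I N) raw = distr (unit_cube ?I) (PiM ?I (\<lambda>_. borel)) raw"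
    by (rule distr_cong[OF refl sets_law refl])
  also have "\<dots> = PiM ?I N"
    unfolding raw_def by (subst distr_PiM_coordinatewise[OF _ prob_space_unit_uniform f]) (auto simp: N)
  finally have raw: "distr (unit_cube ?I) (PiM ?I N) raw = PiM ?I N" .
  have "measure_preserving_map (PiM ?I N) (haar_transform d)"
    by (rule measure_preserving_haar_transform[OF prob_N sets_N]) (auto simp: N_def)
  then have haar: "haar_transform d \<in> measurable (PiM ?I N) (PiM ?I N)"
    "distr (PiM ?I N) (PiM ?I N) (haar_transform d) = PiM ?I N"
    by (auto simp: measure_preserving_map_def)
  have "raw x = (\<lambda>i\<in>?I. if i = 1 then H (max 0 (min 1 (x i))) else std_normal_quantile (x i))" for x
    unfolding raw_def f_def by (rule restrict_ext) simp
  then have eq: "cube_input H d = haar_transform d \<circ> raw"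
    unfolding cube_input_def[abs_def] comp_def by metis
  show "cube_input H d \<in> measurable (unit_cube ?I) (input_law \<mu> d)"
    unfolding eq law[symmetric] by (rule measurable_comp[OF raw_m haar(1)])
  show "distr (unit_cube ?I) (input_law \<mu> d) (cube_input H d) = input_law \<mu> d"
    unfolding eq law[symmetric] distr_distr[OF haar(1) raw_m, symmetric] raw by (rule haar(2))
qed

lemma tendsto_frac:
  fixes x :: real
  assumes "(f \<longlongrightarrow> x) F" "x \<notin> \<int>"
  shows "((\<lambda>i. frac (f i)) \<longlongrightarrow> frac x) F"
  using isCont_tendsto_compose[OF continuous_frac[OF assms(2)] assms(1)] .

text \<open>Continuity is claimed at interior points, where the quantile is continuous; the
  approximating points may lie anywhere.\<close>

lemma tendsto_cube_input:
  assumes H: "continuous_on {0..1} H"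
    and x: "\<And>i. i \<in> {1..2 ^ d + 1} \<Longrightarrow> 0 < x i \<and> x i < 1"
    and lim: "\<And>i. i \<in> {1..2 ^ d + 1} \<Longrightarrow> ((\<lambda>n. y n i) \<longlongrightarrow> x i) F"
  shows "((\<lambda>n. cube_input H d (y n) i) \<longlongrightarrow> cube_input H d x i) F"
  unfolding cube_input_def
proof (rule tendsto_haar_transform)
  fix j
  show "((\<lambda>n. (\<lambda>i\<in>{1..2 ^ d + 1}. if i = 1 then H (max 0 (min 1 (y n i))) else std_normal_quantile (y n i)) j) \<longlongrightarrow>
      (\<lambda>i\<in>{1..2 ^ d + 1}. if i = 1 then H (max 0 (min 1 (x i))) else std_normal_quantile (x i)) j) F"
  proof (cases "j \<in> {1..2 ^ d + 1}")
    case True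
    have "((\<lambda>n. H (max 0 (min 1 (y n j)))) \<longlongrightarrow> H (max 0 (min 1 (x j)))) F"
      by (rule continuous_on_tendsto_compose[OF continuous_clamped[OF H] lim[OF True]]) auto
    moreover have "((\<lambda>n. std_normal_quantile (y n j)) \<longlongrightarrow> std_normal_quantile (x j)) F"
      using isCont_tendsto_compose[OF isCont_std_normal_quantile lim[OF True]] x[OF True] by blast
    ultimately show ?thesis using True by (cases "j = 1") simp_all
  next
    case False
    then show ?thesis by (simp add: restrict_def del: atLeastAtMost_iff)
  qed
qed

text \<open>The scheme contains its own law, so agreement along \<phi> is more than a substitution:
  at each step the interaction integrals agree because \<phi> maps \<open>M\<close> to
  \<open>N\<close>.\<close>

lemma (in lipschitz_coefficients) mean_field_euler_transfer:
  assumes N: "prob_space N" and \<phi>: "\<phi> \<in> measurable M N" "distr M N \<phi> = N"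
    and x0: "x\<^sub>0 \<in> borel_measurable N" and \<eta>: "\<And>k. k < n \<Longrightarrow> \<eta> k \<in> borel_measurable N"
    and x0': "\<And>\<omega>. \<omega> \<in> space M \<Longrightarrow> x\<^sub>0' \<omega> = x\<^sub>0 (\<phi> \<omega>)"
    and \<eta>': "\<And>k \<omega>. k < n \<Longrightarrow> \<omega> \<in> space M \<Longrightarrow> \<eta>' k \<omega> = \<eta> k (\<phi> \<omega>)"
    and \<omega>: "\<omega> \<in> space M"
  shows "mean_field_euler a \<kappa> h M x\<^sub>0' \<eta>' n \<omega> = mean_field_euler a \<kappa> h N x\<^sub>0 \<eta> n (\<phi> \<omega>)"
  using \<eta> \<eta>' \<omega>
proof (induction n arbitrary: \<omega>)
  case (Suc n)
  define E where "E = mean_field_euler a \<kappa> h N x\<^sub>0 \<eta> n"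
  define E' where "E' = mean_field_euler a \<kappa> h M x\<^sub>0' \<eta>' n"
  have E: "E \<in> borel_measurable N"
    unfolding E_def by (rule borel_measurable_mean_field_euler[OF N x0]) (use Suc in auto)
  have E': "E' \<omega>' = E (\<phi> \<omega>')" if "\<omega>' \<in> space M" for \<omega>'
    unfolding E_def E'_def using Suc that by auto
  have "(\<integral>\<omega>'. \<kappa> (E' \<omega>, E' \<omega>') \<partial>M) = (\<integral>\<omega>'. \<kappa> (E (\<phi> \<omega>), E (\<phi> \<omega>')) \<partial>M)"
    by (rule Bochner_Integration.integral_cong) (auto simp: E' Suc.prems)
  also have "\<dots> = (\<integral>y. \<kappa> (E (\<phi> \<omega>), E y) \<partial>distr M N \<phi>)"
    by (rule integral_distr[OF \<phi>(1), symmetric])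
      (rule borel_measurable_continuous_on[OF continuous_\<kappa> E])
  finally have "(\<integral>\<omega>'. \<kappa> (E' \<omega>, E' \<omega>') \<partial>M) = (\<integral>y. \<kappa> (E (\<phi> \<omega>), E y) \<partial>N)"
    by (simp add: \<phi>(2))
  then show ?case
    using E'[of \<omega>] Suc.prems by (simp add: E_def[symmetric] E'_def[symmetric] Let_def)
qed (simp add: x0')

text \<open>The increments of \<open>W\<close> are stored where the bridge leaves its own, so that
  both sources of noise are read at \<open>bridge_slot d k\<close>.\<close>

definition wiener_input ::
    "('a \<Rightarrow> real) \<Rightarrow> (real \<Rightarrow> 'a \<Rightarrow> real) \<Rightarrow> real \<Rightarrow> nat \<Rightarrow> 'a \<Rightarrow> nat \<Rightarrow> real" where
  "wiener_input \<xi> W h d \<omega> = (\<lambda>i\<in>{1..2 ^ d + 1}. if i = 1 then \<xi> \<omega>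
     else let j = the_inv_into {..<2 ^ d} (bridge_slot d) i in
       (W (real (Suc j) * h) \<omega> - W (real j * h) \<omega>) / sqrt h)"

lemma wiener_input_slot:
  assumes "j < 2 ^ d"
  shows "wiener_input \<xi> W h d \<omega> (bridge_slot d j) = (W (real (Suc j) * h) \<omega> - W (real j * h) \<omega>) / sqrt h"
proof -
  have "the_inv_into {..<2 ^ d} (bridge_slot d) (bridge_slot d j) = j"
    by (rule the_inv_into_f_f[OF bridge_slot_inj]) (use assms in simp)
  then show ?thesis
    using bridge_slot_bounds[OF assms] by (auto simp: wiener_input_def Let_def)
qed

text \<open>On a rectangle, the probability factors first into initial value and path, then into the
  increments; the slot bijection turns the product over time steps into one over
  coordinates.\<close>

lemma wiener_input_law:
  assumes W: "wiener_process M W" and \<xi>: "\<xi> \<in> borel_measurable M"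
    and indep: "prob_space.indep_set M {\<xi> -` A \<inter> space M | A. A \<in> sets borel}
         {(\<lambda>\<omega>. \<lambda>t\<in>{0..}. W t \<omega>) -` B \<inter> space M | B. B \<in> sets (PiM {0..} (\<lambda>_. borel))}"
    and h: "0 < h"
  shows "wiener_input \<xi> W h d \<in> measurable M (input_law (distr M borel \<xi>) d)"
    "distr M (input_law (distr M borel \<xi>) d) (wiener_input \<xi> W h d) = input_law (distr M borel \<xi>) d"
proof -
  interpret prob_space M using W by (simp add: wiener_process_def)
  let ?I = "{1..2 ^ d + 1} :: nat set"
  define N where "N i = (if i = 1 then distr M borel \<xi> else std_normal_distribution)" for i :: nat
  define D where "D j \<omega> = (W (real (Suc j) * h) \<omega> - W (real j * h) \<omega>) / sqrt h" for j :: nat and \<omega>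
  have law: "PiM ?I N = input_law (distr M borel \<xi>) d"
    unfolding input_law_def N_def by simp
  have prob_N: "prob_space (N i)" for i
    using prob_space_distr[OF \<xi>] by (simp add: N_def prob_space_normal_density)
  have sets_N: "sets (N i) = sets borel" for i by (simp add: N_def)
  interpret N: product_prob_space N by (rule product_prob_spaceI[OF prob_N])
  have W_meas[measurable]: "W t \<in> borel_measurable M" if "0 \<le> t" for t
    using W that by (simp add: wiener_process_def)
  have D_meas[measurable]: "D j \<in> borel_measurable M" for j
    unfolding D_def using h by (intro borel_measurable_divide borel_measurable_diff W_meas) auto
  have D_law: "distr M borel (D j) = std_normal_distribution" for j
  proof -
    have pos: "0 \<le> real j * h" "real j * h < real (Suc j) * h" using h by auto
    have diff: "real (Suc j) * h - real j * h = h" by (simp add: algebra_simps)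
    have "distributed M lborel (\<lambda>\<omega>. W (real (Suc j) * h) \<omega> - W (real j * h) \<omega>)
        (\<lambda>x. ennreal (normal_density 0 (sqrt (real (Suc j) * h - real j * h)) x))"
      using W pos unfolding wiener_process_def by blast
    then have "distributed M lborel (\<lambda>\<omega>. W (real (Suc j) * h) \<omega> - W (real j * h) \<omega>)
        (normal_density 0 (sqrt h))" unfolding diff .
    then have "distributed M lborel (\<lambda>\<omega>. (W (real (Suc j) * h) \<omega> - W (real j * h) \<omega> - 0) / sqrt h)
        std_normal_density"
      using normal_standard_normal_convert[of "sqrt h" "\<lambda>\<omega>. W (real (Suc j) * h) \<omega> - W (real j * h) \<omega>" 0] h
      by simp
    then have "distr M lborel (D j) = std_normal_distribution"
      unfolding D_def[abs_def] by (simp add: distributed_def)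
    moreover have "distr M lborel (D j) = distr M borel (D j)" by (rule distr_cong) auto
    ultimately show ?thesis by simp
  qed
  have meas: "wiener_input \<xi> W h d \<in> measurable M (PiM ?I N)"
  proof -
    have "wiener_input \<xi> W h d \<in> measurable M (PiM ?I (\<lambda>_. borel))"
      unfolding wiener_input_def[abs_def] Let_def D_def[symmetric] using \<xi> D_meas
      by (intro measurable_restrict) auto
    moreover have "sets (PiM ?I N) = sets (PiM ?I (\<lambda>_. borel))"
      by (intro sets_PiM_cong) (auto simp: sets_N)
    ultimately show ?thesis using measurable_cong_sets[OF refl] by blast
  qed
  have "distr M (PiM ?I N) (wiener_input \<xi> W h d) = PiM ?I N"
  proof (rule N.PiM_eqI)
    fix A assume "\<And>i. i \<in> ?I \<Longrightarrow> A i \<in> sets (N i)"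
    then have A: "\<And>i. i \<in> ?I \<Longrightarrow> A i \<in> sets borel" by (simp add: sets_N)
    have slot: "bridge_slot d j \<in> ?I" if "j < 2 ^ d" for j
      using bridge_slot_bounds[OF that] by auto
    define path where "path \<omega> = (\<lambda>t\<in>{0..}. W t \<omega>)" for \<omega>
    \<comment> \<open>Independence is given between \<xi> and the whole path, so the event on the
      increments is written as a measurable set of paths.\<close>
    define B where "B = {f \<in> space (PiM {0::real..} (\<lambda>_. borel)).
        \<forall>j\<in>{..<2 ^ d}. (f (real (Suc j) * h) - f (real j * h)) / sqrt h \<in> A (bridge_slot d j)}"
    have B: "B \<in> sets (PiM {0::real..} (\<lambda>_. borel :: real measure))"
      unfolding B_def
    proof (rule sets.sets_Collect_finite_All[OF _ finite_lessThan])
      fix j :: nat assume j: "j \<in> {..<2 ^ d}"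
      have [measurable]: "(\<lambda>f. f (real (Suc j) * h)) \<in> borel_measurable (PiM {0::real..} (\<lambda>_. borel :: real measure))"
        "(\<lambda>f. f (real j * h)) \<in> borel_measurable (PiM {0::real..} (\<lambda>_. borel :: real measure))"
        using h by (auto intro!: measurable_component_singleton)
      have [measurable]: "A (bridge_slot d j) \<in> sets borel" using A slot j by blast
      show "{f \<in> space (PiM {0::real..} (\<lambda>_. borel)).
          (f (real (Suc j) * h) - f (real j * h)) / sqrt h \<in> A (bridge_slot d j)} \<in> sets (PiM {0::real..} (\<lambda>_. borel))"
        by measurable
    qed
    have path: "path -` B \<inter> space M = {\<omega> \<in> space M. \<forall>j<2 ^ d. D j \<omega> \<in> A (bridge_slot d j)}"
      using h by (auto simp: B_def path_def D_def space_PiM)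
    \<comment> \<open>\<open>wiener_process\<close> states independence for the increments before
      normalisation, so the sets are rescaled instead.\<close>
    define A' where "A' j = {x. x / sqrt h \<in> A (bridge_slot d j)}" for j
    have iv: "indep_vars (\<lambda>_. borel) (\<lambda>j \<omega>. W (real (Suc j) * h) \<omega> - W (real j * h) \<omega>) {..<2 ^ d}"
    proof -
      have all: "\<forall>n (t :: nat \<Rightarrow> real). 0 \<le> t 0 \<and> (\<forall>i<n. t i \<le> t (Suc i)) \<longrightarrow>
          indep_vars (\<lambda>_. borel) (\<lambda>i \<omega>. W (t (Suc i)) \<omega> - W (t i) \<omega>) {..<n}"
        using W unfolding wiener_process_def by (elim conjE)
      show ?thesis
        by (rule mp[OF spec[OF spec[OF all, of "2 ^ d"], of "\<lambda>i. real i * h"]]) (use h in auto)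
    qed
    have A': "A' j \<in> sets borel" if "j < 2 ^ d" for j
    proof -
      have [measurable]: "A (bridge_slot d j) \<in> sets borel" using A slot that by blast
      show ?thesis unfolding A'_def by measurable
    qed
    have "prob (\<Inter>j\<in>{..<2 ^ d}. (\<lambda>\<omega>. W (real (Suc j) * h) \<omega> - W (real j * h) \<omega>) -` A' j \<inter> space M) =
        (\<Prod>j\<in>{..<2 ^ d}. prob ((\<lambda>\<omega>. W (real (Suc j) * h) \<omega> - W (real j * h) \<omega>) -` A' j \<inter> space M))"
      by (rule indep_varsD_finite[OF iv]) (auto simp: A' lessThan_empty_iff)
    also have "(\<Inter>j\<in>{..<2 ^ d}. (\<lambda>\<omega>. W (real (Suc j) * h) \<omega> - W (real j * h) \<omega>) -` A' j \<inter> space M) =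
        {\<omega> \<in> space M. \<forall>j<2 ^ d. D j \<omega> \<in> A (bridge_slot d j)}"
      by (auto simp: A'_def D_def lessThan_empty_iff)
    also have "(\<Prod>j\<in>{..<2 ^ d}. prob ((\<lambda>\<omega>. W (real (Suc j) * h) \<omega> - W (real j * h) \<omega>) -` A' j \<inter> space M)) =
        (\<Prod>j\<in>{..<2 ^ d}. measure (N (bridge_slot d j)) (A (bridge_slot d j)))"
    proof (rule prod.cong[OF refl])
      fix j :: nat assume "j \<in> {..<2 ^ d}"
      then have j: "j < 2 ^ d" by simp
      have "prob ((\<lambda>\<omega>. W (real (Suc j) * h) \<omega> - W (real j * h) \<omega>) -` A' j \<inter> space M) =
          prob (D j -` A (bridge_slot d j) \<inter> space M)"
        by (rule arg_cong[where f=prob]) (auto simp: A'_def D_def)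
      also have "\<dots> = measure (distr M borel (D j)) (A (bridge_slot d j))"
        by (rule measure_distr[symmetric]) (use A slot[OF j] in auto)
      also have "\<dots> = measure (N (bridge_slot d j)) (A (bridge_slot d j))"
        using bridge_slot_bounds(1)[OF j] by (simp add: D_law N_def)
      finally show "prob ((\<lambda>\<omega>. W (real (Suc j) * h) \<omega> - W (real j * h) \<omega>) -` A' j \<inter> space M) =
          measure (N (bridge_slot d j)) (A (bridge_slot d j))" .
    qed
    also have "\<dots> = (\<Prod>i\<in>{2..<2 ^ d + 2}. measure (N i) (A i))"
      by (rule prod.reindex_bij_betw[OF bridge_slot_bij])
    finally have inc: "prob (path -` B \<inter> space M) = (\<Prod>i\<in>{2..<2 ^ d + 2}. measure (N i) (A i))"
      unfolding path .
    have I_eq: "?I = insert 1 {2..<2 ^ d + 2}" by auto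
    have "wiener_input \<xi> W h d -` Pi\<^sub>E ?I A \<inter> space M = (\<xi> -` A 1 \<inter> space M) \<inter> (path -` B \<inter> space M)"
    proof -
      have "wiener_input \<xi> W h d \<omega> \<in> Pi\<^sub>E ?I A \<longleftrightarrow> \<xi> \<omega> \<in> A 1 \<and> (\<forall>j<2 ^ d. D j \<omega> \<in> A (bridge_slot d j))" for \<omega>
      proof -
        have "wiener_input \<xi> W h d \<omega> \<in> Pi\<^sub>E ?I A \<longleftrightarrow> (\<forall>i\<in>?I. wiener_input \<xi> W h d \<omega> i \<in> A i)"
          by (auto simp: PiE_iff wiener_input_def)
        also have "\<dots> \<longleftrightarrow> \<xi> \<omega> \<in> A 1 \<and> (\<forall>i\<in>bridge_slot d ` {..<2 ^ d}. wiener_input \<xi> W h d \<omega> i \<in> A i)"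
          unfolding bij_betw_imp_surj_on[OF bridge_slot_bij] I_eq by (simp add: wiener_input_def)
        also have "\<dots> \<longleftrightarrow> \<xi> \<omega> \<in> A 1 \<and> (\<forall>j<2 ^ d. D j \<omega> \<in> A (bridge_slot d j))"
          by (auto simp: wiener_input_slot D_def)
        finally show ?thesis .
      qed
      then show ?thesis unfolding path by auto
    qed
    then have "prob (wiener_input \<xi> W h d -` Pi\<^sub>E ?I A \<inter> space M) =
        prob (\<xi> -` A 1 \<inter> space M) * prob (path -` B \<inter> space M)"
      using indep_setD[OF indep, of "\<xi> -` A 1 \<inter> space M" "path -` B \<inter> space M"] A[of 1] B
      unfolding path_def[abs_def] by auto
    also have "prob (\<xi> -` A 1 \<inter> space M) = measure (N 1) (A 1)"
      unfolding N_def by (simp, rule measure_distr[symmetric]) (use A[of 1] \<xi> in auto)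
    also have "measure (N 1) (A 1) * prob (path -` B \<inter> space M) = (\<Prod>i\<in>?I. measure (N i) (A i))"
      unfolding inc I_eq by (subst prod.insert) auto
    finally have "emeasure M (wiener_input \<xi> W h d -` Pi\<^sub>E ?I A \<inter> space M) = ennreal (\<Prod>i\<in>?I. measure (N i) (A i))"
      by (simp add: emeasure_eq_measure)
    also have "\<dots> = (\<Prod>i\<in>?I. emeasure (N i) (A i))"
      by (simp only: N.M.emeasure_eq_measure prod_ennreal[OF measure_nonneg])
    finally show "emeasure (distr M (PiM ?I N) (wiener_input \<xi> W h d)) (Pi\<^sub>E ?I A) = (\<Prod>i\<in>?I. emeasure (N i) (A i))"
      by (subst emeasure_distr[OF meas]) (auto intro!: sets_PiM_I_finite simp: sets_N A)
  qed auto
  then show "wiener_input \<xi> W h d \<in> measurable M (input_law (distr M borel \<xi>) d)"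
    "distr M (input_law (distr M borel \<xi>) d) (wiener_input \<xi> W h d) = input_law (distr M borel \<xi>) d"
    using meas unfolding law by auto
qed

section \<open>Convergence of the particle scheme\<close>

text \<open>\<open>H\<close> fills coordinate 1, which no slot addresses, so the identity holds for
  any \<open>H\<close>.\<close>

lemma coupled_path_increment:
  assumes T: "0 < T" and k: "k < 2 ^ d"
  shows "coupled_path T d \<zeta> u p (dyadic_node T d (Suc k)) - coupled_path T d \<zeta> u p (dyadic_node T d k) =
    sqrt (T / 2 ^ d) * cube_input H d (\<lambda>i\<in>{1..2 ^ d + 1}. frac (\<zeta> p i + u i)) (bridge_slot d k)"
proof -
  define y where "y = (\<lambda>i\<in>{1..2 ^ d + 1}. if i = 1 then H (max 0 (min 1 (frac (\<zeta> p i + u i))))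
    else std_normal_quantile (frac (\<zeta> p i + u i)))"
  define v where "v k = std_normal_quantile (frac (\<zeta> p (k + 1) + u (k + 1)))" for k
  \<comment> \<open>At a node the interpolation weight is 0, so the value at \<open>Suc j\<close>,
    which lies beyond the path when \<open>j = 2 ^ d\<close>, drops out.\<close>
  have node: "coupled_path T d \<zeta> u p (dyadic_node T d j) = bridge_value T v d j" for j
    using T by (simp add: coupled_path_def bridge_path_def dyadic_node_def Let_def v_def[abs_def])
  \<comment> \<open>\<open>y\<close> is undefined outside its index set, so it must be checked that
    the bridge up to level \<open>d\<close> reads \<open>v\<close> at the places 1 to
    \<open>2 ^ d\<close> alone.\<close>
  have cong: "bridge_value T v l j = bridge_value T (\<lambda>k. y (k + 1)) l j" if "l \<le> d" "j \<le> 2 ^ l" for l j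
    using that
  proof (induction l arbitrary: j)
    case 0
    then show ?case by (auto simp: v_def y_def)
  next
    case (Suc l)
    show ?case
    proof (cases "even j")
      case True
      then show ?thesis using Suc by auto
    next
      case False
      define i where "i = (j + 1) div 2"
      have i: "0 < i" "i \<le> 2 ^ l" using Suc.prems False by (auto simp: i_def elim!: oddE)
      have "2 ^ Suc l \<le> (2 :: nat) ^ d" by (rule power_increasing) (use Suc.prems in auto)
      then have "2 ^ l + i + 1 \<in> {1..2 ^ d + 1}" "2 ^ l + i + 1 \<noteq> 1" using i by auto
      then have "v (2 ^ l + i) = y (2 ^ l + i + 1)" by (simp add: v_def y_def)
      moreover have "bridge_value T v l (i - 1) = bridge_value T (\<lambda>k. y (k + 1)) l (i - 1)"
        "bridge_value T v l i = bridge_value T (\<lambda>k. y (k + 1)) l i"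
        using Suc i by auto
      ultimately show ?thesis using False by (simp only: bridge_value.simps if_False Let_def i_def[symmetric])
    qed
  qed
  have "cube_input H d (\<lambda>i\<in>{1..2 ^ d + 1}. frac (\<zeta> p i + u i)) = haar_transform d y"
    unfolding cube_input_def y_def by (rule arg_cong[where f="haar_transform d"]) (auto intro: restrict_ext)
  then show ?thesis
    unfolding node using cong[of d] k bridge_value_increment[OF T k, of y] by simp
qed

lemma coupled_initial_eq:
  "coupled_initial H \<zeta> u p = cube_input H d (\<lambda>i\<in>{1..2 ^ d + 1}. frac (\<zeta> p i + u i)) 1"
proof -
  have "0 \<le> frac (\<zeta> p 1 + u 1)" "frac (\<zeta> p 1 + u 1) \<le> 1"
    using frac_ge_0 frac_lt_1 less_imp_le by blast+
  then show ?thesis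
    by (simp add: coupled_initial_def cube_input_def haar_transform_one)
qed

lemma measurable_cube_input:
  assumes H: "continuous_on {0..1} H"
    and \<mu>: "\<mu> = distr (restrict_space lborel {0..1}) borel H"
  shows "(\<lambda>x. cube_input H d (\<lambda>i\<in>{1..2 ^ d + 1}. frac (x i + u i))) \<in>
    measurable (PiM {1..2 ^ d + 1} (\<lambda>_. borel)) (input_law \<mu> d)"
proof (rule measurable_compose[where f="\<lambda>x. \<lambda>i\<in>{1..2 ^ d + 1}. frac (x i + u i)" and g="cube_input H d"])
  show "(\<lambda>x. \<lambda>i\<in>{1..2 ^ d + 1}. frac (x i + u i)) \<in>
      measurable (PiM {1..2 ^ d + 1} (\<lambda>_. borel)) (PiM {1..2 ^ d + 1} (\<lambda>_. borel))"
    by measurable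
  show "cube_input H d \<in> measurable (PiM {1..2 ^ d + 1} (\<lambda>_. borel)) (input_law \<mu> d)"
    using cube_input_law(1)[OF H \<mu>] by (subst (asm) measurable_cong_sets[OF sets_unit_cube refl])
qed

definition particle_input ::
    "(real \<Rightarrow> real) \<Rightarrow> (nat \<Rightarrow> nat \<Rightarrow> real) \<Rightarrow> nat \<Rightarrow> (nat \<Rightarrow> real) \<Rightarrow> nat \<Rightarrow> nat \<Rightarrow> real" where
  "particle_input H \<zeta> d u p = cube_input H d (\<lambda>i\<in>{1..2 ^ d + 1}. frac (\<zeta> p i + u i))"

definition limit_noise :: "real \<Rightarrow> real \<Rightarrow> nat \<Rightarrow> nat \<Rightarrow> (nat \<Rightarrow> real) \<Rightarrow> real" where
  "limit_noise T \<sigma> d k y = \<sigma> * (sqrt (T / 2 ^ d) * y (bridge_slot d k))"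

context lipschitz_coefficients
begin

definition limit_euler ::
    "real \<Rightarrow> real \<Rightarrow> real measure \<Rightarrow> nat \<Rightarrow> nat \<Rightarrow> (nat \<Rightarrow> real) \<Rightarrow> real" where
  "limit_euler T \<sigma> \<mu> d =
     mean_field_euler a \<kappa> (T / 2 ^ d) (input_law \<mu> d) (\<lambda>y. y 1) (limit_noise T \<sigma> d)"

context
  fixes T \<sigma> :: real and H :: "real \<Rightarrow> real" and \<zeta> :: "nat \<Rightarrow> nat \<Rightarrow> real" and \<mu> :: "real measure" and d :: nat
  assumes T: "0 < T" and H: "continuous_on {0..1} H"
    and \<mu>: "\<mu> = distr (restrict_space lborel {0..1}) borel H"
    and \<zeta>: "low_discrepancy \<zeta>"
begin

section \<open>The limit scheme on the input space, for one dissection\<close>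

lemma \<mu>_prob: "prob_space \<mu>"
proof -
  have "distr unit_uniform borel (\<lambda>x. H (max 0 (min 1 x))) = \<mu>"
    unfolding \<mu> by (rule distr_clamped[OF H])
  moreover have "(\<lambda>x. H (max 0 (min 1 x))) \<in> borel_measurable unit_uniform"
    using borel_measurable_continuous_onI[OF continuous_clamped[OF H]] by simp
  ultimately show ?thesis using prob_space.prob_space_distr[OF prob_space_unit_uniform] by metis
qed

lemma law_prob: "prob_space (input_law \<mu> d)"
  by (rule prob_space_input_law[OF \<mu>_prob])

lemma sets_\<mu>: "sets \<mu> = sets borel"
  by (simp add: \<mu>)

lemma initial_measurable: "(\<lambda>y. y 1) \<in> borel_measurable (input_law \<mu> d)"
  by (rule borel_measurable_input_component[OF sets_\<mu>]) simp

lemma limit_noise_measurable: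
  assumes "k < 2 ^ d"
  shows "limit_noise T \<sigma> d k \<in> borel_measurable (input_law \<mu> d)"
proof -
  have "bridge_slot d k \<in> {1..2 ^ d + 1}" using bridge_slot_bounds[OF assms] by auto
  then have [measurable]: "(\<lambda>y. y (bridge_slot d k)) \<in> borel_measurable (input_law \<mu> d)"
    by (rule borel_measurable_input_component[OF sets_\<mu>])
  show ?thesis unfolding limit_noise_def[abs_def] by measurable
qed

lemma limit_euler_measurable: "k \<le> 2 ^ d \<Longrightarrow> limit_euler T \<sigma> \<mu> d k \<in> borel_measurable (input_law \<mu> d)"
  unfolding limit_euler_def
  by (rule borel_measurable_mean_field_euler[OF law_prob initial_measurable limit_noise_measurable]) auto

lemma AE_frac_shift: "AE t in unit_uniform. 0 < frac (t + u) \<and> frac (t + u) < 1"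
proof -
  have "AE t in distr unit_uniform borel (\<lambda>x. frac (x + u)). 0 < t \<and> t < 1"
    unfolding distr_unit_uniform_shift by (rule AE_unit_uniform_interior)
  then show ?thesis by (subst (asm) AE_distr_iff) auto
qed

text \<open>With \<open>u\<close> fixed, the shift becomes part of the integrand, so A4 applies to
  the points of \<zeta> as they are. The limit is freed of \<open>u\<close> by the shift invariance
  of the uniform law and then moved to the input law by \<open>cube_input_law\<close>.\<close>

lemma limit_euler_weak:
  assumes k: "k \<le> 2 ^ d" and f: "continuous_on UNIV f" "bounded (range f)"
  shows "(\<lambda>P. average P (\<lambda>j. f (limit_euler T \<sigma> \<mu> d k (particle_input H \<zeta> d u j)))) \<longlonglongrightarrow>
    (\<integral>y. f (limit_euler T \<sigma> \<mu> d k y) \<partial>input_law \<mu> d)"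
proof -
  define shift where "shift x = (\<lambda>i\<in>{1..2 ^ d + 1}. frac (x i + u i))" for x :: "nat \<Rightarrow> real"
  define h where "h x = f (limit_euler T \<sigma> \<mu> d k (cube_input H d (shift x)))" for x
  obtain B where B: "\<And>x. \<bar>f x\<bar> \<le> B" using f(2) unfolding bounded_iff by auto
  have fE: "(\<lambda>y. f (limit_euler T \<sigma> \<mu> d k y)) \<in> borel_measurable (input_law \<mu> d)"
    by (rule borel_measurable_continuous_on[OF f(1) limit_euler_measurable[OF k]])
  have h_meas: "h \<in> borel_measurable (PiM {1..2 ^ d + 1} (\<lambda>_. borel))"
    unfolding h_def shift_def by (rule measurable_compose[OF measurable_cube_input[OF H \<mu>] fE])
  have "has_riemann_integral_cube {1..2 ^ d + 1} h (\<integral>x. h x \<partial>unit_cube {1..2 ^ d + 1})"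
  proof (rule has_riemann_integral_cubeI[OF _ h_meas])
    show "\<bar>h x\<bar> \<le> B" for x by (simp add: h_def B)
    have "AE x in unit_cube {1..2 ^ d + 1}. \<forall>i\<in>{1..2 ^ d + 1}. 0 < frac (x i + u i) \<and> frac (x i + u i) < 1"
      by (rule AE_unit_cube_component[OF _ AE_frac_shift]) simp
    then show "AE x in unit_cube {1..2 ^ d + 1}. \<forall>y. (\<forall>k. y k \<in> PiE {1..2 ^ d + 1} (\<lambda>_. {0..1})) \<and>
        (\<forall>i\<in>{1..2 ^ d + 1}. (\<lambda>k. y k i) \<longlonglongrightarrow> x i) \<longrightarrow> (\<lambda>k. h (y k)) \<longlonglongrightarrow> h x"
    proof eventually_elim
      case (elim x)
      show ?case
      proof (intro allI impI)
        fix y :: "nat \<Rightarrow> nat \<Rightarrow> real"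
        assume "(\<forall>k. y k \<in> PiE {1..2 ^ d + 1} (\<lambda>_. {0..1})) \<and> (\<forall>i\<in>{1..2 ^ d + 1}. (\<lambda>k. y k i) \<longlonglongrightarrow> x i)"
        then have y: "\<And>i. i \<in> {1..2 ^ d + 1} \<Longrightarrow> (\<lambda>k. y k i) \<longlonglongrightarrow> x i" by blast
        have "(\<lambda>n. shift (y n) i) \<longlonglongrightarrow> shift x i" if i: "i \<in> {1..2 ^ d + 1}" for i
        proof -
          \<comment> \<open>The fractional part jumps exactly at the integers, where it is 0, and
            almost every point avoids this value.\<close>
          have "x i + u i \<notin> \<int>" using elim i frac_eq_0_iff by force
          then have "(\<lambda>n. frac (y n i + u i)) \<longlonglongrightarrow> frac (x i + u i)"
            by (intro tendsto_frac tendsto_intros y i)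
          then show ?thesis using i by (simp add: shift_def)
        qed
        then have c: "(\<lambda>n. cube_input H d (shift (y n)) i) \<longlonglongrightarrow> cube_input H d (shift x) i" for i
          using elim by (intro tendsto_cube_input[OF H]) (auto simp: shift_def)
        have "(\<lambda>n. limit_euler T \<sigma> \<mu> d k (cube_input H d (shift (y n)))) \<longlonglongrightarrow> limit_euler T \<sigma> \<mu> d k (cube_input H d (shift x))"
          unfolding limit_euler_def
        proof (rule tendsto_mean_field_euler[OF law_prob initial_measurable limit_noise_measurable])
          show "(\<lambda>n. limit_noise T \<sigma> d j (cube_input H d (shift (y n)))) \<longlonglongrightarrow>
              limit_noise T \<sigma> d j (cube_input H d (shift x))" for j
            unfolding limit_noise_def by (intro tendsto_intros c)
        qed (use k c in auto)
        then show "(\<lambda>n. h (y n)) \<longlonglongrightarrow> h x"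
          unfolding h_def by (rule continuous_on_tendsto_compose[OF f(1)]) auto
      qed
    qed
  qed simp
  moreover have "finite {1..2 ^ d + 1 :: nat}" "{1..2 ^ d + 1 :: nat} \<subseteq> {1..}" by auto
  ultimately have "(\<lambda>P. 1 / real P * (\<Sum>j=1..P. h (restrict (\<zeta> j) {1..2 ^ d + 1}))) \<longlonglongrightarrow> (\<integral>x. h x \<partial>unit_cube {1..2 ^ d + 1})"
    using \<zeta> unfolding low_discrepancy_def by blast
  moreover have "h (restrict (\<zeta> j) {1..2 ^ d + 1}) = f (limit_euler T \<sigma> \<mu> d k (particle_input H \<zeta> d u j))" for j
  proof -
    have "shift (restrict (\<zeta> j) {1..2 ^ d + 1}) = (\<lambda>i\<in>{1..2 ^ d + 1}. frac (\<zeta> j i + u i))"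
      unfolding shift_def by (rule restrict_ext) simp
    then show ?thesis by (simp only: h_def particle_input_def)
  qed
  moreover have "(\<integral>x. h x \<partial>unit_cube {1..2 ^ d + 1}) = (\<integral>y. f (limit_euler T \<sigma> \<mu> d k y) \<partial>input_law \<mu> d)"
  proof -
    have fE': "(\<lambda>x. f (limit_euler T \<sigma> \<mu> d k (cube_input H d x))) \<in> borel_measurable (unit_cube {1..2 ^ d + 1})"
      by (rule measurable_compose[OF cube_input_law(1)[OF H \<mu>] fE])
    then have fE'': "(\<lambda>x. f (limit_euler T \<sigma> \<mu> d k (cube_input H d x))) \<in> borel_measurable (PiM {1..2 ^ d + 1} (\<lambda>_. borel))"
      by (subst (asm) measurable_cong_sets[OF sets_unit_cube refl])
    have shift: "shift \<in> measurable (unit_cube {1..2 ^ d + 1}) (PiM {1..2 ^ d + 1} (\<lambda>_. borel))"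
      unfolding shift_def by measurable
    have "(\<integral>x. h x \<partial>unit_cube {1..2 ^ d + 1}) = (\<integral>x. f (limit_euler T \<sigma> \<mu> d k (cube_input H d x)) \<partial>distr (unit_cube {1..2 ^ d + 1}) (PiM {1..2 ^ d + 1} (\<lambda>_. borel)) shift)"
      unfolding h_def by (rule integral_distr[OF shift fE'', symmetric])
    also have "\<dots> = (\<integral>x. f (limit_euler T \<sigma> \<mu> d k (cube_input H d x)) \<partial>unit_cube {1..2 ^ d + 1})"
      unfolding shift_def by (subst distr_unit_cube_shift) auto
    also have "\<dots> = (\<integral>y. f (limit_euler T \<sigma> \<mu> d k y) \<partial>distr (unit_cube {1..2 ^ d + 1}) (input_law \<mu> d) (cube_input H d))"
      by (rule integral_distr[OF cube_input_law(1)[OF H \<mu>] fE, symmetric])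
    finally show ?thesis by (simp only: cube_input_law(2)[OF H \<mu>])
  qed
  ultimately show ?thesis by (simp only: average_def)
qed

lemma euler_particle_Suc_eq:
  assumes "k < 2 ^ d"
  shows "euler_particle a \<kappa> \<sigma> T d P (coupled_initial H \<zeta> u) (coupled_path T d \<zeta> u) (Suc k) p =
    (let X = euler_particle a \<kappa> \<sigma> T d P (coupled_initial H \<zeta> u) (coupled_path T d \<zeta> u) k in
      X p + a (X p, average P (\<lambda>j. \<kappa> (X p, X j))) * (T / 2 ^ d) + limit_noise T \<sigma> d k (particle_input H \<zeta> d u p))"
proof -
  have "dyadic_node T d (Suc k) - dyadic_node T d k = T / 2 ^ d"
    by (simp add: dyadic_node_def field_simps)
  then show ?thesis
    by (simp add: Let_def average_def limit_noise_def particle_input_def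
        coupled_path_increment[OF T assms, where H=H])
qed

text \<open>The limit does not depend on the shift \<open>u\<close>, so integrating over
  \<open>u\<close> afterwards leaves it unchanged.\<close>

lemma euler_terminal_tendsto:
  assumes g: "bounded (range g)" "Lg-lipschitz_on UNIV g"
  shows "(\<lambda>P. average P (\<lambda>i. g (euler_terminal a \<kappa> \<sigma> T H \<zeta> d P u i))) \<longlonglongrightarrow>
    (\<integral>y. g (limit_euler T \<sigma> \<mu> d (2 ^ d) y) \<partial>input_law \<mu> d)"
  unfolding euler_terminal_def limit_euler_def
proof (rule particle_system_tendsto[OF law_prob initial_measurable limit_noise_measurable _ _ _ _ g])
  show "euler_particle a \<kappa> \<sigma> T d P (coupled_initial H \<zeta> u) (coupled_path T d \<zeta> u) 0 p = particle_input H \<zeta> d u p 1" for P p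
    by (simp only: euler_particle.simps particle_input_def coupled_initial_eq[where d=d])
  show "(\<lambda>P. average P (\<lambda>j. f (mean_field_euler a \<kappa> (T / 2 ^ d) (input_law \<mu> d) (\<lambda>y. y 1) (limit_noise T \<sigma> d) k (particle_input H \<zeta> d u j)))) \<longlonglongrightarrow>
      (\<integral>y. f (mean_field_euler a \<kappa> (T / 2 ^ d) (input_law \<mu> d) (\<lambda>y. y 1) (limit_noise T \<sigma> d) k y) \<partial>input_law \<mu> d)"
    if "k \<le> 2 ^ d" "continuous_on UNIV f" "bounded (range f)" for k f
    using limit_euler_weak[OF that] unfolding limit_euler_def .
qed (use T euler_particle_Suc_eq in \<open>auto simp: Let_def\<close>)

lemma euler_terminal_measurable:
  "(\<lambda>u. euler_terminal a \<kappa> \<sigma> T H \<zeta> d P u p) \<in> borel_measurable (PiM {1..2 ^ d + 1} (\<lambda>_. borel))"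
proof -
  have input: "(\<lambda>u. particle_input H \<zeta> d u p) \<in> measurable (PiM {1..2 ^ d + 1} (\<lambda>_. borel)) (input_law \<mu> d)" for p
    \<comment> \<open>Point and shift enter symmetrically: here \<open>u\<close> is the variable and
      the point \<zeta> p plays the part of the shift.\<close>
    using measurable_cube_input[OF H \<mu>, of d "\<zeta> p"] by (simp add: particle_input_def add.commute)
  have "(\<lambda>u. euler_particle a \<kappa> \<sigma> T d P (coupled_initial H \<zeta> u) (coupled_path T d \<zeta> u) k p)
      \<in> borel_measurable (PiM {1..2 ^ d + 1} (\<lambda>_. borel))" if "k \<le> 2 ^ d" for k
    using that
  proof (induction k arbitrary: p)
    case 0
    have "(\<lambda>u. particle_input H \<zeta> d u p 1) \<in> borel_measurable (PiM {1..2 ^ d + 1} (\<lambda>_. borel))"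
      by (rule measurable_compose[OF input initial_measurable])
    then show ?case by (simp only: euler_particle.simps particle_input_def coupled_initial_eq[where d=d])
  next
    case (Suc k)
    then have k: "k < 2 ^ d" by simp
    have X[measurable]: "(\<lambda>u. euler_particle a \<kappa> \<sigma> T d P (coupled_initial H \<zeta> u) (coupled_path T d \<zeta> u) k p)
      \<in> borel_measurable (PiM {1..2 ^ d + 1} (\<lambda>_. borel))" for p using Suc by simp
    have [measurable]: "(\<lambda>u. limit_noise T \<sigma> d k (particle_input H \<zeta> d u p)) \<in> borel_measurable (PiM {1..2 ^ d + 1} (\<lambda>_. borel))"
      by (rule measurable_compose[OF input limit_noise_measurable[OF k]])
    show ?case
      unfolding euler_particle_Suc_eq[OF k] Let_def average_def
      by (intro borel_measurable_add borel_measurable_times borel_measurable_const borel_measurable_sum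
          borel_measurable_lipschitz_pair[OF a_lipschitz] borel_measurable_lipschitz_pair[OF \<kappa>_lipschitz] X) measurable
  qed
  then show ?thesis by (simp add: euler_terminal_def)
qed

lemma expectation_euler_terminal_tendsto:
  assumes g: "bounded (range g)" "Lg-lipschitz_on UNIV g"
  shows "(\<lambda>P. \<integral>u. average P (\<lambda>i. g (euler_terminal a \<kappa> \<sigma> T H \<zeta> d P u i)) \<partial>unit_cube {1..2 ^ d + 1}) \<longlonglongrightarrow>
    (\<integral>y. g (limit_euler T \<sigma> \<mu> d (2 ^ d) y) \<partial>input_law \<mu> d)"
proof -
  interpret Q: prob_space "unit_cube {1..2 ^ d + 1}" by (rule prob_space_unit_cube)
  obtain B where B: "\<And>x. \<bar>g x\<bar> \<le> B" using g(1) unfolding bounded_iff by auto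
  have B0: "0 \<le> B" using B[of 0] by linarith
  have "(\<lambda>P. \<integral>u. average P (\<lambda>i. g (euler_terminal a \<kappa> \<sigma> T H \<zeta> d P u i)) \<partial>unit_cube {1..2 ^ d + 1}) \<longlonglongrightarrow>
    (\<integral>u. (\<integral>y. g (limit_euler T \<sigma> \<mu> d (2 ^ d) y) \<partial>input_law \<mu> d) \<partial>unit_cube {1..2 ^ d + 1})"
  proof (rule integral_dominated_convergence[where w="\<lambda>_. B"])
    show "AE u in unit_cube {1..2 ^ d + 1}. norm (average P (\<lambda>i. g (euler_terminal a \<kappa> \<sigma> T H \<zeta> d P u i))) \<le> B" for P
      using B B0 by (auto intro!: AE_I2 order.trans[OF abs_average_le average_le_const])
    show "(\<lambda>u. average P (\<lambda>i. g (euler_terminal a \<kappa> \<sigma> T H \<zeta> d P u i))) \<in> borel_measurable (unit_cube {1..2 ^ d + 1})" for P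
      unfolding average_def measurable_cong_sets[OF sets_unit_cube refl]
      by (intro borel_measurable_times borel_measurable_const borel_measurable_sum
          borel_measurable_continuous_on[OF lipschitz_on_continuous_on[OF g(2)]] euler_terminal_measurable)
    show "integrable (unit_cube {1..2 ^ d + 1}) (\<lambda>_. B)" by (rule Q.integrable_const)
  qed (auto intro: euler_terminal_tendsto[OF g])
  then show ?thesis by (simp add: prob_space.prob_space[OF prob_space_unit_cube])
qed

end

end

text \<open>The intermediate quantity is \<open>L\<close>, the mean of \<open>g\<close> under the
  mean-field Euler scheme. Half of \<epsilon> goes to the time discretisation and fixes \<delta>;
  the other half goes to the particles and fixes their number for the given dissection.\<close>

lemma (in lipschitz_coefficients) particle_scheme_weak_convergence:
  fixes M :: "'a measure" and T \<sigma> :: real and \<xi> :: "'a \<Rightarrow> real" and H :: "real \<Rightarrow> real"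
    and \<zeta> :: "nat \<Rightarrow> nat \<Rightarrow> real" and W Z :: "real \<Rightarrow> 'a \<Rightarrow> real" and g :: "real \<Rightarrow> real"
  assumes T: "0 < T"
    and \<xi>: "\<xi> \<in> borel_measurable M"
    and H: "continuous_on {0..1} H" "distr (restrict_space lborel {0..1}) borel H = distr M borel \<xi>"
    and \<zeta>: "low_discrepancy \<zeta>"
    and W: "wiener_process M W"
      "prob_space.indep_set M {\<xi> -` A \<inter> space M | A. A \<in> sets borel}
         {(\<lambda>\<omega>. \<lambda>t\<in>{0..}. W t \<omega>) -` B \<inter> space M | B. B \<in> sets (PiM {0..} (\<lambda>_. borel))}"
    and Z: "mckean_vlasov_strong_solution M a \<kappa> \<sigma> T \<xi> W Z"
    and g: "bounded (range g)" "Lg-lipschitz_on UNIV g"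
    and \<epsilon>: "0 < \<epsilon>"
  shows "\<exists>\<delta>>0. \<forall>d. T / 2 ^ d < \<delta> \<longrightarrow>
    (\<exists>P\<^sub>0\<ge>1. \<forall>U. uniform_on_cube M (2 ^ d + 1) U \<longrightarrow>
      (\<forall>P\<ge>P\<^sub>0.
        \<bar>prob_space.expectation M (\<lambda>\<omega>. g (Z T \<omega>)
            - 1 / real P * (\<Sum>i=1..P. g (euler_terminal a \<kappa> \<sigma> T H \<zeta> d P (U \<omega>) i)))\<bar> \<le> \<epsilon>))"
proof -
  interpret prob_space M using W(1) by (simp add: wiener_process_def)
  have Lg0: "0 \<le> Lg" by (rule lipschitz_on_nonneg[OF g(2)])
  obtain Bg where Bg: "\<And>x. \<bar>g x\<bar> \<le> Bg" using g(1) unfolding bounded_iff by auto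
  have g_cont: "continuous_on UNIV g" by (rule lipschitz_on_continuous_on[OF g(2)])
  have ZT: "Z T \<in> borel_measurable M" using Z_measurable[OF W(1) \<xi> T Z, of T] T by simp
  \<comment> \<open>The Lipschitz constant of \<open>g\<close> times the strong error bound:
    continuous in the step size and 0 at step size 0.\<close>
  define rate where "rate h = Lg * ((A * h + \<bar>\<sigma>\<bar> * sqrt h) * exp (La * (1 + 2 * Lk) * T))" for h
  have "(rate \<longlongrightarrow> Lg * ((A * 0 + \<bar>\<sigma>\<bar> * sqrt 0) * exp (La * (1 + 2 * Lk) * T))) (at 0)"
    unfolding rate_def by (intro tendsto_intros)
  then have "\<forall>\<^sub>F h in at 0. rate h < \<epsilon> / 2"
    using \<epsilon> by (intro order_tendstoD(2)) auto
  then obtain \<delta> where \<delta>: "\<delta> > 0" "\<And>h. h \<noteq> 0 \<Longrightarrow> \<bar>h\<bar> < \<delta> \<Longrightarrow> rate h < \<epsilon> / 2"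
    unfolding eventually_at by (auto simp: dist_real_def)
  have "\<exists>P\<^sub>0\<ge>1. \<forall>U. uniform_on_cube M (2 ^ d + 1) U \<longrightarrow>
      (\<forall>P\<ge>P\<^sub>0.
        \<bar>prob_space.expectation M (\<lambda>\<omega>. g (Z T \<omega>)
            - 1 / real P * (\<Sum>i=1..P. g (euler_terminal a \<kappa> \<sigma> T H \<zeta> d P (U \<omega>) i)))\<bar> \<le> \<epsilon>)"
    if d: "T / 2 ^ d < \<delta>" for d
  proof -
    define h where "h = T / 2 ^ d"
    have h: "0 < h" "\<bar>h\<bar> < \<delta>" using T d by (auto simp: h_def)
    define \<mu> where "\<mu> = distr M borel \<xi>"
    have \<mu>: "\<mu> = distr (restrict_space lborel {0..1}) borel H" by (simp add: \<mu>_def H(2))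
    let ?I = "{1..2 ^ d + 1} :: nat set"
    let ?E = "limit_euler T \<sigma> \<mu> d"
    let ?\<phi> = "wiener_input \<xi> W h d"
    define L where "L = (\<integral>y. g (?E (2 ^ d) y) \<partial>input_law \<mu> d)"
    define X where "X = mean_field_euler a \<kappa> h M \<xi>
      (\<lambda>k \<omega>. \<sigma> * (W (real (Suc k) * h) \<omega> - W (real k * h) \<omega>)) (2 ^ d)"
    have n: "real (2 ^ d) * h = T" by (simp add: h_def)
    note X_meas = driven_euler_measurable[OF W(1) \<xi> T Z h(1), where k="2 ^ d", folded X_def]
    note Z_X_int = driven_euler_error[OF W(1) \<xi> T Z h(1) eq_refl[OF n],
        unfolded n, THEN conjunct1, folded X_def]
    note Z_X_le = driven_euler_strong_error[OF W(1) \<xi> T Z h(1) n, folded X_def]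
    note \<phi> = wiener_input_law[OF W(1) \<xi> W(2) h(1), of d, folded \<mu>_def]
    \<comment> \<open>The scheme driven by \<open>W\<close> is the limit scheme evaluated at the
      stored increments, so both have the same mean of \<open>g\<close>.\<close>
    have X_eq: "X \<omega> = ?E (2 ^ d) (?\<phi> \<omega>)" if \<omega>: "\<omega> \<in> space M" for \<omega>
      unfolding X_def limit_euler_def h_def[symmetric]
    proof (rule mean_field_euler_transfer[OF law_prob[OF T H(1) \<mu> \<zeta>] \<phi>
          initial_measurable[OF T H(1) \<mu> \<zeta>] limit_noise_measurable[OF T H(1) \<mu> \<zeta>] _ _ \<omega>])
      show "\<xi> \<omega> = ?\<phi> \<omega> 1" for \<omega> by (simp add: wiener_input_def)
      show "\<sigma> * (W (real (Suc k) * h) \<omega> - W (real k * h) \<omega>) = limit_noise T \<sigma> d k (?\<phi> \<omega>)"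
        if "k < 2 ^ d" for k \<omega>
        using h(1) by (simp add: limit_noise_def h_def[symmetric] wiener_input_slot[OF that])
    qed
    have gE: "(\<lambda>y. g (?E (2 ^ d) y)) \<in> borel_measurable (input_law \<mu> d)"
      by (rule borel_measurable_continuous_on[OF g_cont limit_euler_measurable[OF T H(1) \<mu> \<zeta>]]) simp
    have "(\<integral>\<omega>. g (X \<omega>) \<partial>M) = (\<integral>\<omega>. g (?E (2 ^ d) (?\<phi> \<omega>)) \<partial>M)"
      by (rule Bochner_Integration.integral_cong) (auto simp: X_eq)
    also have "\<dots> = (\<integral>y. g (?E (2 ^ d) y) \<partial>distr M (input_law \<mu> d) ?\<phi>)"
      by (rule integral_distr[OF \<phi>(1) gE, symmetric])
    finally have gX: "(\<integral>\<omega>. g (X \<omega>) \<partial>M) = L" by (simp add: L_def \<phi>(2))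
    have g_int: "integrable M (\<lambda>\<omega>. g (Y \<omega>))" if "Y \<in> borel_measurable M" for Y
      by (rule integrable_const_bound[where B=Bg])
        (auto simp: Bg intro: borel_measurable_continuous_on[OF g_cont that])
    have "\<bar>(\<integral>\<omega>. g (Z T \<omega>) \<partial>M) - L\<bar> = \<bar>\<integral>\<omega>. g (Z T \<omega>) - g (X \<omega>) \<partial>M\<bar>"
      using g_int[OF ZT] g_int[OF X_meas] by (simp add: gX)
    also have "\<dots> \<le> (\<integral>\<omega>. \<bar>g (Z T \<omega>) - g (X \<omega>)\<bar> \<partial>M)" by (rule integral_abs_bound)
    also have "\<dots> \<le> (\<integral>\<omega>. Lg * \<bar>Z T \<omega> - X \<omega>\<bar> \<partial>M)"
      using g_int[OF ZT] g_int[OF X_meas] Z_X_int lipschitz_onD[OF g(2)]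
      by (intro integral_mono) (auto simp: dist_real_def)
    also have "\<dots> = Lg * (\<integral>\<omega>. \<bar>Z T \<omega> - X \<omega>\<bar> \<partial>M)" by simp
    also have "\<dots> \<le> rate h"
      unfolding rate_def by (intro mult_left_mono Z_X_le Lg0)
    also have "\<dots> < \<epsilon> / 2" using \<delta>(2)[of h] h by simp
    finally have time_error: "\<bar>(\<integral>\<omega>. g (Z T \<omega>) \<partial>M) - L\<bar> < \<epsilon> / 2" .
    \<comment> \<open>\<open>U\<close> enters the expectation through its law alone, so
      \<open>c\<close>, and with it \<open>P0\<close>, is fixed before \<open>U\<close> is
      chosen.\<close>
    define c where "c P = (\<integral>u. average P (\<lambda>i. g (euler_terminal a \<kappa> \<sigma> T H \<zeta> d P u i)) \<partial>unit_cube ?I)" for P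
    have "c \<longlonglongrightarrow> L"
      unfolding c_def L_def
      by (rule expectation_euler_terminal_tendsto[OF T H(1) \<mu> \<zeta> g])
    then have "\<forall>\<^sub>F P in sequentially. \<bar>c P - L\<bar> < \<epsilon> / 2"
      using \<epsilon> unfolding tendsto_iff dist_real_def by (auto dest: spec[of _ "\<epsilon> / 2"])
    then obtain P0 where P0: "\<And>P. P0 \<le> P \<Longrightarrow> \<bar>c P - L\<bar> < \<epsilon> / 2"
      unfolding eventually_sequentially by blast
    have "\<bar>\<integral>\<omega>. g (Z T \<omega>) - 1 / real P * (\<Sum>i=1..P. g (euler_terminal a \<kappa> \<sigma> T H \<zeta> d P (U \<omega>) i)) \<partial>M\<bar> \<le> \<epsilon>"
      if U: "uniform_on_cube M (2 ^ d + 1) U" and P: "max 1 P0 \<le> P" for U P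
    proof -
      define avg where "avg u = average P (\<lambda>i. g (euler_terminal a \<kappa> \<sigma> T H \<zeta> d P u i))" for u
      have U_meas: "U \<in> measurable M (PiM ?I (\<lambda>_. borel))"
        and U_law: "distr M (PiM ?I (\<lambda>_. borel)) U = unit_cube ?I"
        using U by (auto simp: uniform_on_cube_def)
      have avg: "avg \<in> borel_measurable (PiM ?I (\<lambda>_. borel))"
        unfolding avg_def average_def
        by (intro borel_measurable_times borel_measurable_const borel_measurable_sum
            borel_measurable_continuous_on[OF g_cont] euler_terminal_measurable[OF T H(1) \<mu> \<zeta>])
      have "\<bar>avg u\<bar> \<le> Bg" for u
        unfolding avg_def using Bg order.trans[OF abs_ge_zero Bg[of 0]]
        by (intro order.trans[OF abs_average_le average_le_const]) auto
      then have avg_int: "integrable M (\<lambda>\<omega>. avg (U \<omega>))"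
        by (intro integrable_const_bound[where B=Bg] measurable_compose[OF U_meas avg]) auto
      have "(\<integral>\<omega>. avg (U \<omega>) \<partial>M) = c P"
        unfolding c_def avg_def[symmetric] U_law[symmetric] by (rule integral_distr[OF U_meas avg, symmetric])
      then have "(\<integral>\<omega>. g (Z T \<omega>) - avg (U \<omega>) \<partial>M) = ((\<integral>\<omega>. g (Z T \<omega>) \<partial>M) - L) - (c P - L)"
        using g_int[OF ZT] avg_int by simp
      moreover have "\<bar>c P - L\<bar> < \<epsilon> / 2" using P0 P by simp
      ultimately have "\<bar>\<integral>\<omega>. g (Z T \<omega>) - avg (U \<omega>) \<partial>M\<bar> \<le> \<epsilon>"
        using time_error by linarith
      then show ?thesis by (simp add: avg_def average_def)
    qed
    then show ?thesis by (intro exI[of _ "max 1 P0"]) auto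
  qed
  then show ?thesis using \<delta>(1) by blast
qed

theorem theorem1:
  fixes M :: "'a measure"
    and a \<kappa> :: "real \<times> real \<Rightarrow> real"
    and T \<sigma> :: real
    and \<xi> :: "'a \<Rightarrow> real"
    and H :: "real \<Rightarrow> real"
    and \<zeta> :: "nat \<Rightarrow> nat \<Rightarrow> real"
    and W Z :: "real \<Rightarrow> 'a \<Rightarrow> real"
    and g :: "real \<Rightarrow> real"
  assumes "prob_space M"
    and "T > 0"
    and A1: "C1_bounded a"
    and A2: "\<xi> \<in> borel_measurable M"
      "continuous_on {0..1} H"
      "distr (restrict_space lborel {0..1}) borel H = distr M borel \<xi>"
    and A3: "bounded_with_C0_bounded_partials \<kappa>"
    and A4: "low_discrepancy \<zeta>"
    and W: "wiener_process M W"
      "prob_space.indep_set M {\<xi> -` A \<inter> space M | A. A \<in> sets borel}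
         {(\<lambda>\<omega>. \<lambda>t\<in>{0..}. W t \<omega>) -` B \<inter> space M | B. B \<in> sets (PiM {0..} (\<lambda>_. borel))}"
    and Z: "mckean_vlasov_strong_solution M a \<kappa> \<sigma> T \<xi> W Z"
    and g: "bounded (range g)" "\<exists>L. L-lipschitz_on UNIV g"
  shows "\<forall>\<epsilon>>0. \<exists>\<delta>>0. \<forall>d. T / 2 ^ d < \<delta> \<longrightarrow>
    (\<exists>P\<^sub>0\<ge>1. \<forall>U. uniform_on_cube M (2 ^ d + 1) U \<longrightarrow>
      (\<forall>P\<ge>P\<^sub>0.
        \<bar>prob_space.expectation M (\<lambda>\<omega>. g (Z T \<omega>)
            - 1 / real P * (\<Sum>i=1..P. g (euler_terminal a \<kappa> \<sigma> T H \<zeta> d P (U \<omega>) i)))\<bar> \<le> \<epsilon>))"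
proof (intro allI impI)
  fix \<epsilon> :: real assume \<epsilon>: "0 < \<epsilon>"
  obtain A La where "\<And>p. \<bar>a p\<bar> \<le> A"
    "\<And>x v x' v'. \<bar>a (x, v) - a (x', v')\<bar> \<le> La * (\<bar>x - x'\<bar> + \<bar>v - v'\<bar>)"
    using C1_bounded_lipschitz[OF A1] by metis
  moreover obtain K Lk where "\<And>p. \<bar>\<kappa> p\<bar> \<le> K"
    "\<And>x v x' v'. \<bar>\<kappa> (x, v) - \<kappa> (x', v')\<bar> \<le> Lk * (\<bar>x - x'\<bar> + \<bar>v - v'\<bar>)"
    using bounded_partials_lipschitz[OF A3] by metis
  ultimately interpret lipschitz_coefficients a \<kappa> A La K Lk
    by unfold_locales
  obtain Lg where "Lg-lipschitz_on UNIV g" using g(2) by blast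
  then show "\<exists>\<delta>>0. \<forall>d. T / 2 ^ d < \<delta> \<longrightarrow>
    (\<exists>P\<^sub>0\<ge>1. \<forall>U. uniform_on_cube M (2 ^ d + 1) U \<longrightarrow>
      (\<forall>P\<ge>P\<^sub>0.
        \<bar>prob_space.expectation M (\<lambda>\<omega>. g (Z T \<omega>)
            - 1 / real P * (\<Sum>i=1..P. g (euler_terminal a \<kappa> \<sigma> T H \<zeta> d P (U \<omega>) i)))\<bar> \<le> \<epsilon>))"
    using particle_scheme_weak_convergence[OF assms(2) A2 A4 W Z g(1) _ \<epsilon>] by blast
qed

end
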